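(* Let $T(s)\in\mathcal{F}_\infty^{m\times m}$, and let $\mathbf{T}_{T(s)}:\mathcal{D}_{\mathbf{T}_{T(s)}}\subseteq\mathcal{L}_2^m\to\mathcal{L}_2^m$ be the maximal operator associated with $T(s)$. Then $$\bar\sigma(\mathbf{T}_{T(s)})=\operatorname*{ess\,sup}_{\omega\in\mathbb{R}}\bar\sigma(T(i\omega)),\qquad \underline{\sigma}(\mathbf{T}_{T(s)})=\operatorname*{ess\,inf}_{\omega\in\mathbb{R}}\underline{\sigma}(T(i\omega)).$$
   Context: $\mathcal{L}_2^m$ is the Hilbert space of square-integrable functions $[0,\infty)\to\mathbb{C}^m$ with $\langle u,y\rangle=\int_0^\infty u(t)^*y(t)\,dt$. $\mathcal{H}_2^m$ is the Hardy space of the open right half-plane ($\mathbb{C}^m$-valued analytic functions $\hat f$ with $\sup_{\sigma>0}\big(\frac1{2\pi}\int_{-\infty}^\infty \hat f(\sigma+i\omega)^*\hat f(\sigma+i\omega)\,d\omega\big)^{1/2}<\infty$), and $\mathcal{H}_\infty^{p\times q}$ is the space of bounded analytic $p\times q$ matrix functions on the open right half-plane. The Fourier (Laplace) transform $u\mapsto\hat u$ is a Hilbert space isomorphism $\mathcal{L}_2^m\to\mathcal{H}_2^m$. $\mathcal{F}_\infty^{m\times m}$ denotes the quotient field over $\mathcal{H}_\infty^{m\times m}$: the transfer functions $T$ that can be written $T=NM^{-1}$ with $\begin{pmatrix}M\\N\end{pmatrix}\in\mathcal{H}_\infty^{2m\times m}$ (with $M$ invertible, i.e. $\det M\not\equiv0$).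 $T(i\omega)$ denotes the boundary value, defined for almost every $\omega\in\mathbb{R}$ through the boundary values of $N$ and $M$. For a linear operator $\mathbf{T}:\mathcal{D}_{\mathbf{T}}\subseteq\mathcal{L}_2^m\to\mathcal{L}_2^m$ with graph $\mathcal{G}_{\mathbf{T}}=\{(u,\mathbf{T}u):u\in\mathcal{D}_{\mathbf{T}}\}$, let $\hat{\mathbf{T}}$ be the corresponding operator on $\mathcal{H}_2^m$, i.e. $\hat{\mathbf{T}}\hat u=\widehat{\mathbf{T}u}$. Write $\mathbf{T}_1\preceq\mathbf{T}_2$ if $\mathcal{G}_{\mathbf{T}_1}\subseteq\mathcal{G}_{\mathbf{T}_2}$. Given $T\in\mathcal{F}_\infty^{m\times m}$, let $$\mathcal{T}=\left\{\mathbf{T}:\mathcal{G}_{\hat{\mathbf{T}}}=\begin{pmatrix}M\\N\end{pmatrix}\mathcal{H}_2^m,\ \begin{pmatrix}M\\N\end{pmatrix}\in\mathcal{H}_\infty^{2m\times m},\ T=NM^{-1}\right\}.$$ The maximal operator $\mathbf{T}_{T(s)}$ is the maximum element of $\mathcal{T}$ with respect to $\preceq$ (that is, $\mathbf{T}_{T(s)}\in\mathcal{T}$ and $\mathbf{T}\preceq\mathbf{T}_{T(s)}$ for all $\mathbf{T}\in\mathcal{T}$). It is a known result (Georgiou and Smith) that for every $T\in\mathcal{F}_\infty^{m\times m}$ this maximum exists and is a closed operator. For an operator $\mathbf{T}$, $\bar\sigma(\mathbf{T})=\sup_{0\ne u\in\mathcal{D}_{\mathbf{T}}}\|\mathbf{T}u\|/\|u\|$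 and $\underline{\sigma}(\mathbf{T})=\inf_{0\ne u\in\mathcal{D}_{\mathbf{T}}}\|\mathbf{T}u\|/\|u\|$ (values in $[0,\infty]$). For a complex matrix, $\bar\sigma$ and $\underline{\sigma}$ are the largest and smallest singular values. *)

theory Defs
  imports
    "HOL-Complex_Analysis.Complex_Analysis"
    "HOL-Probability.Essential_Supremum"
begin

no_notation fps_nth (infixl \<open>$\<close> 75)

section \<open>Square-integrable functions on the half-line\<close>

definition halfline :: "real measure" where
  "halfline = lebesgue_on {0..}"

definition square_integrable :: "(real \<Rightarrow> complex^'m::finite) \<Rightarrow> bool" where
  "square_integrable f \<longleftrightarrow>
     f \<in> borel_measurable halfline \<and> integrable halfline (\<lambda>t. (norm (f t))\<^sup>2)"

definition L2_rel :: "(real \<Rightarrow> complex^'m::finite) \<Rightarrow> (real \<Rightarrow> complex^'m) \<Rightarrow> bool" where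
  "L2_rel f g \<longleftrightarrow> square_integrable f \<and> square_integrable g \<and> (AE t in halfline. f t = g t)"

lemma square_integrable_zero: "square_integrable (\<lambda>_. 0)"
  by (simp add: square_integrable_def)

lemma square_integrable_add:
  assumes "square_integrable f" "square_integrable g"
  shows "square_integrable (\<lambda>t. f t + g t)"
proof -
  have m: "f \<in> borel_measurable halfline" "g \<in> borel_measurable halfline"
    using assms by (auto simp: square_integrable_def)
  have i: "integrable halfline (\<lambda>t. 2 * (norm (f t))\<^sup>2 + 2 * (norm (g t))\<^sup>2)"
    using assms by (auto simp: square_integrable_def)
  have "(norm (x + y))\<^sup>2 \<le> 2 * (norm x)\<^sup>2 + 2 * (norm y)\<^sup>2" for x y :: "complex^'a"
  proof -
    have "(norm (x + y))\<^sup>2 \<le> (norm x + norm y)\<^sup>2"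
      by (intro power_mono norm_triangle_ineq) auto
    also have "\<dots> \<le> 2 * (norm x)\<^sup>2 + 2 * (norm y)\<^sup>2"
      using sum_squares_bound[of "norm x" "norm y"] by (simp add: power2_sum)
    finally show ?thesis .
  qed
  then have "integrable halfline (\<lambda>t. (norm (f t + g t))\<^sup>2)"
    by (intro Bochner_Integration.integrable_bound[OF i]) (use m in auto)
  then show ?thesis
    using m by (auto simp: square_integrable_def)
qed

lemma norm_vector_scalar_mult: "norm (c *s (x :: complex^'m::finite)) = norm c * norm x"
  by (simp add: norm_vec_def L2_set_def norm_mult power_mult_distrib
      flip: sum_distrib_left) (simp add: real_sqrt_mult)

lemma vector_scalar_mult_borel_measurable:
  fixes f :: "'a \<Rightarrow> complex^'m::finite"
  assumes "f \<in> borel_measurable M"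
  shows "(\<lambda>t. c *s f t) \<in> borel_measurable M"
proof -
  have "continuous_on UNIV (\<lambda>x :: complex^'m. c *s x)"
    unfolding vector_scalar_mult_def by (intro continuous_intros)
  then show ?thesis
    using assms by (rule borel_measurable_continuous_on)
qed

lemma square_integrable_scale:
  assumes "square_integrable f"
  shows "square_integrable (\<lambda>t. c *s f t)"
  using assms vector_scalar_mult_borel_measurable[of f halfline c]
  by (auto simp: square_integrable_def norm_vector_scalar_mult power_mult_distrib)

lemma vec_scaleR_conv_scalar_mult: "r *\<^sub>R (x :: complex^'m::finite) = of_real r *s x"
  by (auto simp: vec_eq_iff complex_eq_iff)

lemma square_integrable_scaleR:
  "square_integrable f \<Longrightarrow> square_integrable (\<lambda>t. r *\<^sub>R f t)"
  using square_integrable_scale[of f "of_real r"] by (simp add: vec_scaleR_conv_scalar_mult)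

lemma square_integrable_uminus:
  "square_integrable f \<Longrightarrow> square_integrable (\<lambda>t. - f t)"
  using square_integrable_scaleR[of f "-1"] by simp

lemma square_integrable_diff:
  "square_integrable f \<Longrightarrow> square_integrable g \<Longrightarrow> square_integrable (\<lambda>t. f t - g t)"
  using square_integrable_add[OF _ square_integrable_uminus, of f g] by simp

lemma integrable_inner_square_integrable:
  fixes f g :: "real \<Rightarrow> complex^'m::finite"
  assumes "square_integrable f" "square_integrable g"
  shows "integrable halfline (\<lambda>t. f t \<bullet> g t)"
proof -
  have m: "f \<in> borel_measurable halfline" "g \<in> borel_measurable halfline"
    using assms by (auto simp: square_integrable_def)
  have i: "integrable halfline (\<lambda>t. (norm (f t))\<^sup>2 + (norm (g t))\<^sup>2)"
    using assms by (auto simp: square_integrable_def)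
  have "\<bar>x \<bullet> y\<bar> \<le> (norm x)\<^sup>2 + (norm y)\<^sup>2" for x y :: "complex^'m"
  proof -
    have "\<bar>x \<bullet> y\<bar> \<le> norm x * norm y"
      by (rule Cauchy_Schwarz_ineq2)
    moreover have "2 * (norm x * norm y) \<le> (norm x)\<^sup>2 + (norm y)\<^sup>2"
      using sum_squares_bound[of "norm x" "norm y"] by simp
    moreover have "0 \<le> norm x * norm y"
      by simp
    ultimately show ?thesis
      by linarith
  qed
  then show ?thesis
    by (intro Bochner_Integration.integrable_bound[OF i]) (use m in auto)
qed

quotient_type (overloaded) 'm L2 = "real \<Rightarrow> complex^('m::finite)" / partial: L2_rel
proof (rule part_equivpI)
  show "\<exists>f :: real \<Rightarrow> complex^'m. L2_rel f f"
    using square_integrable_zero by (auto simp: L2_rel_def)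
  show "symp (L2_rel :: (real \<Rightarrow> complex^'m) \<Rightarrow> _)"
    by (auto simp: symp_def L2_rel_def eq_commute)
  show "transp (L2_rel :: (real \<Rightarrow> complex^'m) \<Rightarrow> _)"
    unfolding transp_def L2_rel_def by (auto elim: eventually_elim2)
qed

text \<open>The real inner product is the real part of the Hermitian one, so the induced norm
  is the usual \<open>L\<^sup>2\<close> norm.\<close>

instantiation L2 :: (finite) real_inner
begin

lift_definition zero_L2 :: "'a L2" is "\<lambda>_. 0"
  by (simp add: L2_rel_def square_integrable_zero)

lift_definition plus_L2 :: "'a L2 \<Rightarrow> 'a L2 \<Rightarrow> 'a L2" is "\<lambda>f g t. f t + g t"
  by (auto simp: L2_rel_def square_integrable_add)

lift_definition minus_L2 :: "'a L2 \<Rightarrow> 'a L2 \<Rightarrow> 'a L2" is "\<lambda>f g t. f t - g t"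
  by (auto simp: L2_rel_def square_integrable_diff)

lift_definition uminus_L2 :: "'a L2 \<Rightarrow> 'a L2" is "\<lambda>f t. - f t"
  by (auto simp: L2_rel_def square_integrable_uminus)

lift_definition scaleR_L2 :: "real \<Rightarrow> 'a L2 \<Rightarrow> 'a L2" is "\<lambda>r f t. r *\<^sub>R f t"
  by (auto simp: L2_rel_def square_integrable_scaleR)

lift_definition inner_L2 :: "'a L2 \<Rightarrow> 'a L2 \<Rightarrow> real"
  is "\<lambda>f g. \<integral>t. f t \<bullet> g t \<partial>halfline"
  by (rule integral_cong_AE) (auto simp: L2_rel_def square_integrable_def)

definition norm_L2 :: "'a L2 \<Rightarrow> real" where
  "norm_L2 u = sqrt (u \<bullet> u)"

definition dist_L2 :: "'a L2 \<Rightarrow> 'a L2 \<Rightarrow> real" where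
  "dist_L2 u v = norm (u - v)"

definition sgn_L2 :: "'a L2 \<Rightarrow> 'a L2" where
  "sgn_L2 u = inverse (norm u) *\<^sub>R u"

definition uniformity_L2 :: "('a L2 \<times> 'a L2) filter" where
  "uniformity_L2 = (INF e\<in>{0<..}. principal {(u, v). dist u v < e})"

definition open_L2 :: "'a L2 set \<Rightarrow> bool" where
  "open_L2 U \<longleftrightarrow> (\<forall>u\<in>U. eventually (\<lambda>(u', v). u' = u \<longrightarrow> v \<in> U) uniformity)"

instance
proof
  fix u v w :: "'a L2" and r s :: real
  show "u + v + w = u + (v + w)"
    by transfer (auto simp: L2_rel_def square_integrable_add add.assoc)
  show "u + v = v + u"
    by transfer (auto simp: L2_rel_def square_integrable_add add.commute)
  show "0 + u = u"
    by transfer (auto simp: L2_rel_def)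
  show "- u + u = 0"
    by transfer (auto simp: L2_rel_def square_integrable_zero)
  show "u - v = u + - v"
    by transfer (auto simp: L2_rel_def square_integrable_diff)
  show "r *\<^sub>R (u + v) = r *\<^sub>R u + r *\<^sub>R v"
    by transfer (auto simp: L2_rel_def square_integrable_add square_integrable_scaleR algebra_simps)
  show "(r + s) *\<^sub>R u = r *\<^sub>R u + s *\<^sub>R u"
    by transfer (auto simp: L2_rel_def square_integrable_add square_integrable_scaleR
        scaleR_left_distrib)
  show "r *\<^sub>R s *\<^sub>R u = (r * s) *\<^sub>R u"
    by transfer (auto simp: L2_rel_def square_integrable_scaleR)
  show "1 *\<^sub>R u = u"
    by transfer (auto simp: L2_rel_def)
  show "u \<bullet> v = v \<bullet> u"
    by transfer (simp add: inner_commute)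
  show "(u + v) \<bullet> w = u \<bullet> w + v \<bullet> w"
    by transfer
      (simp add: L2_rel_def inner_add_left Bochner_Integration.integral_add
        integrable_inner_square_integrable)
  show "r *\<^sub>R u \<bullet> v = r * (u \<bullet> v)"
    by transfer simp
  show "0 \<le> u \<bullet> u"
    by transfer simp
  show "u \<bullet> u = 0 \<longleftrightarrow> u = 0"
  proof transfer
    fix f :: "real \<Rightarrow> complex^'a"
    assume "L2_rel f f"
    then have f: "square_integrable f"
      by (simp add: L2_rel_def)
    have "(\<integral>t. f t \<bullet> f t \<partial>halfline) = 0 \<longleftrightarrow> (AE t in halfline. f t \<bullet> f t = 0)"
      by (intro integral_nonneg_eq_0_iff_AE integrable_inner_square_integrable f) auto
    then show "(\<integral>t. f t \<bullet> f t \<partial>halfline) = 0 \<longleftrightarrow> L2_rel f (\<lambda>_. 0)"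
      using f by (simp add: L2_rel_def square_integrable_zero)
  qed
qed (simp_all add: norm_L2_def dist_L2_def sgn_L2_def uniformity_L2_def open_L2_def)

end

lift_definition scaleC_L2 :: "complex \<Rightarrow> 'm::finite L2 \<Rightarrow> 'm L2" is "\<lambda>c f t. c *s f t"
  by (auto simp: L2_rel_def square_integrable_scale)


section \<open>Hardy spaces of the right half-plane\<close>

definition rhp :: "complex set" where
  "rhp = {s. Re s > 0}"

text \<open>Square-integrable Hardy functions and Laplace transforms are extended by zero outside
  the open right half-plane, so that equality of such functions is equality on the half-plane.
  The finiteness condition does not depend on the factor \<open>1 / (2 * pi)\<close> and the square root
  in the norm.\<close>

definition hardy2 :: "(complex \<Rightarrow> complex^'m::finite) set" where
  "hardy2 = {f. (\<forall>i. (\<lambda>s. f s $ i) holomorphic_on rhp) \<and> (\<forall>s. s \<notin> rhp \<longrightarrow> f s = 0) \<and>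
     (SUP \<sigma>\<in>{0<..}. \<integral>\<^sup>+\<omega>. ennreal ((norm (f (Complex \<sigma> \<omega>)))\<^sup>2) \<partial>lborel) < \<infinity>}"

definition hardy_inf :: "(complex \<Rightarrow> complex^'q::finite^'p::finite) set" where
  "hardy_inf = {F. (\<forall>i j. (\<lambda>s. F s $ i $ j) holomorphic_on rhp) \<and> bounded (F ` rhp)}"

lift_definition laplace :: "'m::finite L2 \<Rightarrow> complex \<Rightarrow> complex^'m"
  is "\<lambda>u s. if s \<in> rhp then \<integral>t. exp (- (s * of_real t)) *s u t \<partial>halfline else 0"
proof -
  fix f g :: "real \<Rightarrow> complex^'m"
  assume fg: "L2_rel f g"
  have meas: "(\<lambda>t. exp (- (s * of_real t)) *s h t) \<in> borel_measurable halfline"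
    if "h \<in> borel_measurable halfline" for s and h :: "real \<Rightarrow> complex^'m"
  proof -
    have "continuous_on {0..} (\<lambda>t::real. exp (- (s * of_real t)))"
      by (intro continuous_intros)
    then have e: "(\<lambda>t::real. exp (- (s * of_real t))) \<in> borel_measurable halfline"
      unfolding halfline_def by (intro continuous_imp_measurable_on_sets_lebesgue) auto
    have "continuous_on UNIV (\<lambda>p :: complex \<times> (complex^'m). fst p *s snd p)"
      unfolding vector_scalar_mult_def by (intro continuous_intros)
    from borel_measurable_continuous_on[OF this borel_measurable_Pair[OF e that]]
    show ?thesis
      by simp
  qed
  show "(\<lambda>s. if s \<in> rhp then \<integral>t. exp (- (s * of_real t)) *s f t \<partial>halfline else 0) =
        (\<lambda>s. if s \<in> rhp then \<integral>t. exp (- (s * of_real t)) *s g t \<partial>halfline else 0)"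
    using fg by (auto simp: fun_eq_iff L2_rel_def square_integrable_def
        intro!: integral_cong_AE meas)
qed


section \<open>Transfer functions\<close>

text \<open>A transfer function is an element of a quotient field, hence a function on the half-plane
  determined up to a set without accumulation points in the half-plane (the zeros of
  \<open>det M\<close>, where \<open>N M\<^sup>-\<^sup>1\<close> need not be defined).\<close>

definition right_fraction ::
    "(complex \<Rightarrow> complex^'m^'m) \<Rightarrow> (complex \<Rightarrow> complex^'m^'m) \<Rightarrow>
     (complex \<Rightarrow> complex^'m^'m::finite) \<Rightarrow> bool" where
  "right_fraction T M N \<longleftrightarrow>
     M \<in> hardy_inf \<and> N \<in> hardy_inf \<and> (\<exists>s\<in>rhp. det (M s) \<noteq> 0) \<and>
     (\<forall>\<^sub>\<approx>s\<in>rhp. T s = N s ** matrix_inv (M s))"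

definition F_inf :: "(complex \<Rightarrow> complex^'m^'m::finite) set" where
  "F_inf = {T. \<exists>M N. right_fraction T M N}"

definition boundary_value :: "(complex \<Rightarrow> complex^'q^'p) \<Rightarrow> real \<Rightarrow> complex^'q::finite^'p::finite"
  where "boundary_value F \<omega> = Lim (at_right 0) (\<lambda>\<sigma>. F (Complex \<sigma> \<omega>))"

text \<open>The boundary function of a transfer function is determined up to a null set, whichever
  fraction is used.\<close>

definition is_boundary_function ::
    "(complex \<Rightarrow> complex^'m^'m) \<Rightarrow> (real \<Rightarrow> complex^'m^'m::finite) \<Rightarrow> bool" where
  "is_boundary_function T B \<longleftrightarrow>
     (\<exists>M N. right_fraction T M N \<and>
       (AE \<omega> in lebesgue. B \<omega> = boundary_value N \<omega> ** matrix_inv (boundary_value M \<omega>)))"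


section \<open>Operators\<close>

definition linear_operator :: "('m::finite L2 \<rightharpoonup> 'm L2) \<Rightarrow> bool" where
  "linear_operator A \<longleftrightarrow>
     A 0 = Some 0 \<and>
     (\<forall>u v y z. A u = Some y \<longrightarrow> A v = Some z \<longrightarrow> A (u + v) = Some (y + z)) \<and>
     (\<forall>c u y. A u = Some y \<longrightarrow> A (scaleC_L2 c u) = Some (scaleC_L2 c y))"

definition laplace_graph ::
    "('m::finite L2 \<rightharpoonup> 'm L2) \<Rightarrow> ((complex \<Rightarrow> complex^'m) \<times> (complex \<Rightarrow> complex^'m)) set" where
  "laplace_graph A = map_prod laplace laplace ` Map.graph A"

definition fraction_operators ::
    "(complex \<Rightarrow> complex^'m^'m) \<Rightarrow> ('m::finite L2 \<rightharpoonup> 'm L2) set" where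
  "fraction_operators T = {A. linear_operator A \<and>
     (\<exists>M N. right_fraction T M N \<and>
        laplace_graph A = (\<lambda>f. (\<lambda>s. M s *v f s, \<lambda>s. N s *v f s)) ` hardy2)}"

definition is_maximal_operator ::
    "(complex \<Rightarrow> complex^'m^'m) \<Rightarrow> ('m::finite L2 \<rightharpoonup> 'm L2) \<Rightarrow> bool" where
  "is_maximal_operator T A \<longleftrightarrow>
     A \<in> fraction_operators T \<and> (\<forall>B\<in>fraction_operators T. Map.graph B \<subseteq> Map.graph A)"

definition op_sigma_max :: "('m::finite L2 \<rightharpoonup> 'm L2) \<Rightarrow> ennreal" where
  "op_sigma_max A = (SUP u\<in>dom A - {0}. ennreal (norm (the (A u)) / norm u))"

definition op_sigma_min :: "('m::finite L2 \<rightharpoonup> 'm L2) \<Rightarrow> ennreal" where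
  "op_sigma_min A = (INF u\<in>dom A - {0}. ennreal (norm (the (A u)) / norm u))"


section \<open>Singular values and the essential infimum\<close>

definition conj_transpose :: "complex^'n^'m \<Rightarrow> complex^'m^'n" where
  "conj_transpose A = (\<chi> i j. cnj (A $ j $ i))"

definition singular_values :: "complex^'m^'m::finite \<Rightarrow> real set" where
  "singular_values A =
     {r. 0 \<le> r \<and> (\<exists>v. v \<noteq> 0 \<and> (conj_transpose A ** A) *v v = of_real (r\<^sup>2) *s v)}"

definition sigma_max :: "complex^'m^'m::finite \<Rightarrow> real" where
  "sigma_max A = Max (singular_values A)"

definition sigma_min :: "complex^'m^'m::finite \<Rightarrow> real" where
  "sigma_min A = Min (singular_values A)"

definition essinf :: "'a measure \<Rightarrow> ('a \<Rightarrow> ennreal) \<Rightarrow> ennreal" where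
  "essinf M f = Sup {z. AE x in M. z \<le> f x}"

end

theory Submission
  imports Defs "HOL-Probability.Characteristic_Functions" "HOL-Probability.Sinc_Integral"
begin

no_notation fps_nth (infixl \<open>$\<close> 75)

text \<open>Let \<open>A\<close> be any operator whose graph is \<open>(M, N)\<close> applied to the Hardy space, with
  \<open>T = N M\<^sup>-\<^sup>1\<close>. For \<open>C \<ge> 0\<close>, the bound
  \<open>\<parallel>A u\<parallel> \<le> C \<parallel>u\<parallel>\<close> on the whole domain is equivalent to
  \<open>\<parallel>N(i \<omega>) v\<parallel> \<le> C \<parallel>M(i \<omega>) v\<parallel>\<close> for all \<open>v\<close> and almost every \<open>\<omega>\<close>, that is to
  \<open>\<sigma>\<^sub>m\<^sub>a\<^sub>x(T(i \<omega>)) \<le> C\<close> almost everywhere; exchanging \<open>M\<close> and \<open>N\<close> gives the statement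
  on smallest singular values. From the boundary to the operator one compares \<open>N f\<close> and
  \<open>M f\<close> on the lines \<open>Re s = \<sigma>\<close> and lets \<open>\<sigma> \<rightarrow> 0\<close>, using Plancherel's theorem and
  Fatou's theorem on radial limits. In the other direction one tests with
  \<open>f(s) = v / ((s + \<epsilon> - i \<omega>\<^sub>0) (s + 1))\<close>, whose squared modulus on the axis is a weighted
  Poisson kernel: as \<open>\<epsilon> \<rightarrow> 0\<close> it concentrates at \<open>\<omega>\<^sub>0\<close>. That \<open>det M\<close> does not vanish on
  a set of positive measure of the axis is the uniqueness theorem for bounded analytic functions.\<close>

section \<open>Almost everywhere differentiability of Lipschitz functions\<close>

text \<open>Two obstacles shape the proof. First, a function f in \<open>hardy2\<close> comes
  without boundary values, so no integral over the axis involves f itself: a matrix inequality valid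
  on the axis is moved to the lines Re s = \<open>sig k\<close> at the price of a slack \<delta>,
  and is there applied to the vector f(\<open>sig k\<close> + i \<omega>). This vector moves with k,
  so the inequality must hold for all vectors at once; invertibility of the boundary matrix provides
  that. Second, boundary limits of bounded functions are reached through a primitive G. It is
  Lipschitz up to the axis, and wherever y -> G(i y) is differentiable, G' has a radial limit. A
  bound on boundary values known only almost everywhere is likewise used through the increments G(s
  + i t) - G(s), which are continuous on the closed half-plane. Concentration of Poisson kernels is
  used in a weak form: the means are tested against an L2 function, with the same approximate
  identity that yields Plancherel's theorem from Gaussians.\<close>

definition steep :: "(real \<Rightarrow> real) \<Rightarrow> real \<Rightarrow> real set" where
  "steep h q = {x. \<forall>d>0. \<exists>a b. a < x \<and> x < b \<and> b - a < d \<and> q * (b - a) < h b - h a}"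

text \<open>The intervals contain x in their interior, so each scale gives an open set and
  \<open>steep\<close> is a countable intersection of open sets. One-sided difference quotients
  would not give this directly.\<close>

lemma steep_borel [measurable]: "steep h q \<in> sets borel"
proof -
  define W where "W n = \<Union>{{a<..<b} | a b. b - a < inverse (real (Suc n)) \<and> q * (b - a) < h b - h a}" for n
  have "open (W n)" for n
    unfolding W_def by (rule open_Union) auto
  moreover have "steep h q = (\<Inter>n. W n)"
  proof (intro equalityI subsetI)
    fix x assume "x \<in> steep h q"
    then show "x \<in> (\<Inter>n. W n)"
      unfolding steep_def W_def
      by (auto simp del: of_nat_Suc) (metis greaterThanLessThan_iff of_nat_0_less_iff positive_imp_inverse_positive zero_less_Suc)
  next
    fix x assume x: "x \<in> (\<Inter>n. W n)"
    show "x \<in> steep h q"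
      unfolding steep_def
    proof (clarify)
      fix d :: real assume "d > 0"
      then obtain n where n: "inverse (real (Suc n)) < d"
        using reals_Archimedean by blast
      from x obtain a b where "x \<in> {a<..<b}" "b - a < inverse (real (Suc n))" "q * (b - a) < h b - h a"
        unfolding W_def by blast
      then show "\<exists>a b. a < x \<and> x < b \<and> b - a < d \<and> q * (b - a) < h b - h a"
        using n by (intro exI[of _ a] exI[of _ b]) auto
    qed
  qed
  ultimately show ?thesis
    by auto
qed

text \<open>By Vitali's covering theorem, almost all of \<open>E\<close> is covered by disjoint intervals that
  \<open>h\<close> stretches by more than \<open>q\<close>.\<close>

lemma emeasure_image_steep:
  fixes h k :: "real \<Rightarrow> real"
  assumes mono: "strict_mono h" and inv: "\<And>x. k (h x) = x" "\<And>y. h (k y) = y"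
    and cont: "continuous_on UNIV h" "continuous_on UNIV k"
    and E: "E \<in> sets borel" "E \<subseteq> steep h q" and fin: "emeasure lborel (h ` E) < \<infinity>" and q: "0 < q"
  shows "ennreal q * emeasure lborel E \<le> emeasure lborel (h ` E)"
proof (rule ennreal_le_epsilon)
  fix e :: real assume e: "e > 0"
  have hE: "h ` E = k -` E"
  proof (intro equalityI subsetI)
    fix y assume "y \<in> k -` E"
    then show "y \<in> h ` E"
      using inv(2)[of y] by (intro image_eqI[of y h "k y"]) auto
  qed (auto simp: inv)
  have hEb: "h ` E \<in> sets borel"
    unfolding hE using measurable_sets[OF borel_measurable_continuous_onI[OF cont(2)] E(1)] by simp
  obtain V where V: "open V" "h ` E \<subseteq> V" "emeasure lborel (V - h ` E) < e"
    using outer_regular_lborel[OF hEb e] by blast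
  have Vb: "V \<in> sets borel" using V by simp
  have "V = h ` E \<union> (V - h ` E)" using V by blast
  then have "emeasure lborel V \<le> emeasure lborel (h ` E) + emeasure lborel (V - h ` E)"
    using emeasure_subadditive[of "h ` E" lborel "V - h ` E"] hEb Vb by simp
  also have "\<dots> \<le> emeasure lborel (h ` E) + e"
    using V(3) by (intro add_left_mono) auto
  finally have Vm: "emeasure lborel V \<le> emeasure lborel (h ` E) + e" .
  define U where "U = h -` V"
  have U: "open U" "E \<subseteq> U"
    using V cont(1) by (auto simp: U_def open_vimage)
  \<comment> \<open>Intervals are stored as centre and radius, the index type expected by the
    covering theorem for balls. Containment in \<open>U\<close> puts their images in V.\<close>
  define K where "K = {p :: real \<times> real. 0 < snd p \<and> cball (fst p) (snd p) \<subseteq> U \<and>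
      q * (2 * snd p) < h (fst p + snd p) - h (fst p - snd p)}"
  obtain C where C: "countable C" "C \<subseteq> K"
     "pairwise (\<lambda>i j. disjnt (cball (fst i) (snd i)) (cball (fst j) (snd j))) C"
     "negligible (E - (\<Union>i \<in> C. cball (fst i) (snd i)))"
  proof (rule Vitali_covering_theorem_cballs[where a = "fst :: real \<times> real \<Rightarrow> real" and r = snd and K = K and S = E])
    fix x d :: real assume x: "x \<in> E" and d: "0 < d"
    then obtain t where t: "t > 0" "ball x t \<subseteq> U"
      using U by (meson in_mono open_contains_ball)
    then obtain a b where ab: "a < x" "x < b" "b - a < min t d" "q * (b - a) < h b - h a"
    proof -
      have "x \<in> steep h q" "0 < min t d" using E(2) x d t by auto
      then show ?thesis using that unfolding steep_def by blast
    qed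
    have cb: "cball ((a + b) / 2) ((b - a) / 2) = {a..b}"
      by (simp add: cball_eq_atLeastAtMost field_simps)
    have "{a..b} \<subseteq> ball x t"
      using ab by (auto simp: dist_real_def)
    with t have "{a..b} \<subseteq> U" by blast
    with ab show "\<exists>i. i \<in> K \<and> x \<in> cball (fst i) (snd i) \<and> snd i < d"
      by (intro exI[of _ "((a + b) / 2, (b - a) / 2)"]) (auto simp: K_def cb field_simps)
  qed (auto simp: K_def)
  define I where "I i = cball (fst i) (snd i)" for i :: "real \<times> real"
  have hI: "h ` I i = {h (fst i - snd i)..h (fst i + snd i)}" for i
  proof -
    have I: "I i = {fst i - snd i..fst i + snd i}"
      by (simp add: I_def cball_eq_atLeastAtMost)
    have "y \<in> h ` I i" if "y \<in> {h (fst i - snd i)..h (fst i + snd i)}" for y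
    proof -
      have "k y \<in> I i"
        using that strict_mono_less_eq[OF mono, of "fst i - snd i" "k y"]
          strict_mono_less_eq[OF mono, of "k y" "fst i + snd i"] inv by (auto simp: I)
      then show ?thesis
        using inv(2) by (metis image_eqI)
    qed
    then show ?thesis
      using strict_mono_less_eq[OF mono] by (auto simp: I)
  qed
  have dis: "disjoint_family_on I C"
    using C(3) by (auto simp: disjoint_family_on_def pairwise_def disjnt_def I_def)
  then have dis': "disjoint_family_on (\<lambda>i. h ` I i) C"
    using strict_mono_imp_inj_on[OF mono] by (simp add: disjoint_family_on_def flip: image_Int)
  have Ib: "I i \<in> sets lborel" for i by (simp add: I_def)
  have hIb: "h ` I i \<in> sets lborel" for i by (simp add: hI)
  have UIb: "(\<Union>i\<in>C. I i) \<in> sets lborel"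
    using C(1) Ib by (intro sets.countable_UN') auto
  have DB: "E - (\<Union>i\<in>C. I i) \<in> sets lborel"
    using E(1) UIb by (intro sets.Diff) auto
  have "emeasure lebesgue (E - (\<Union>i\<in>C. I i)) = 0"
    using C(4) unfolding negligible_iff_null_sets I_def by (rule null_setsD1)
  then have "emeasure lborel (E - (\<Union>i\<in>C. I i)) = 0"
    using DB by simp
  moreover have "emeasure lborel E \<le> emeasure lborel ((\<Union>i\<in>C. I i) \<union> (E - (\<Union>i\<in>C. I i)))"
    using UIb DB by (intro emeasure_mono sets.Un) auto
  moreover note emeasure_subadditive[OF UIb DB]
  ultimately have "emeasure lborel E \<le> emeasure lborel (\<Union>i\<in>C. I i)"
    by simp
  also have "\<dots> = (\<integral>\<^sup>+i. emeasure lborel (I i) \<partial>count_space C)"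
    using C(1) dis Ib by (intro emeasure_UN_countable) auto
  finally have "ennreal q * emeasure lborel E \<le> ennreal q * (\<integral>\<^sup>+i. emeasure lborel (I i) \<partial>count_space C)"
    by (rule mult_left_mono) simp
  also have "\<dots> = (\<integral>\<^sup>+i. ennreal q * emeasure lborel (I i) \<partial>count_space C)"
    by (simp add: nn_integral_cmult)
  also have "\<dots> \<le> (\<integral>\<^sup>+i. emeasure lborel (h ` I i) \<partial>count_space C)"
  proof (rule nn_integral_mono)
    fix i assume "i \<in> space (count_space C)"
    then have "i \<in> K" using C(2) by auto
    then have *: "0 < snd i" "q * (2 * snd i) < h (fst i + snd i) - h (fst i - snd i)"
      by (auto simp: K_def)
    have "h (fst i - snd i) \<le> h (fst i + snd i)"
      using * strict_mono_less_eq[OF mono] by auto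
    moreover have "emeasure lborel (I i) = ennreal (2 * snd i)"
      using * by (simp add: I_def cball_eq_atLeastAtMost)
    ultimately show "ennreal q * emeasure lborel (I i) \<le> emeasure lborel (h ` I i)"
      using * q by (simp add: hI ennreal_mult[symmetric] ennreal_leI)
  qed
  also have "\<dots> = emeasure lborel (\<Union>i\<in>C. h ` I i)"
    using C(1) dis' hIb by (intro emeasure_UN_countable[symmetric]) auto
  also have "\<dots> \<le> emeasure lborel V"
  proof (rule emeasure_mono)
    show "(\<Union>i\<in>C. h ` I i) \<subseteq> V"
      using C(2) by (auto simp: K_def I_def U_def subset_iff)
  qed (use Vb in simp)
  also note Vm
  finally show "ennreal q * emeasure lborel E \<le> emeasure lborel (h ` E) + e" .
qed

text \<open>The derivative is the infimum D of the rationals q for which x is not in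
  \<open>steep h q\<close>. Above D the quotients over short intervals around x are bounded by q;
  below D the hypothesis turns steepness into a lower bound. So these quotients converge, and
  continuity of h carries this to quotients with one endpoint at x.\<close>

lemma differentiable_if_steepness_agrees:
  fixes h :: "real \<Rightarrow> real"
  assumes cont: "continuous_on UNIV h"
    and lower: "\<And>x y. x \<le> y \<Longrightarrow> y - x \<le> h y - h x"
    and upper: "\<And>x y. x \<le> y \<Longrightarrow> h y - h x \<le> M * (y - x)"
    and x: "\<And>p q. p \<in> \<rat> \<Longrightarrow> q \<in> \<rat> \<Longrightarrow> 0 < p \<Longrightarrow> p < q \<Longrightarrow> x \<notin> steep h q \<or> x \<notin> steep (\<lambda>x. - h x) (- p)"
  shows "\<exists>D. (h has_real_derivative D) (at x)"
proof -
  define S where "S = {q \<in> \<rat>. 0 < q \<and> x \<notin> steep h q}"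
  have "q \<ge> 1" if "q \<in> S" for q
  proof (rule ccontr)
    assume "\<not> q \<ge> 1"
    have "x \<in> steep h q"
      unfolding steep_def
    proof (clarify)
      fix d :: real assume d: "d > 0"
      have "q * (x + d/3 - (x - d/3)) < 1 * (x + d/3 - (x - d/3))"
        using d \<open>\<not> q \<ge> 1\<close> by (intro mult_strict_right_mono) auto
      also have "\<dots> \<le> h (x + d/3) - h (x - d/3)"
        using lower[of "x - d/3" "x + d/3"] d by simp
      finally show "\<exists>a b. a < x \<and> x < b \<and> b - a < d \<and> q * (b - a) < h b - h a"
        using d by (intro exI[of _ "x - d/3"] exI[of _ "x + d/3"]) auto
    qed
    with that show False by (simp add: S_def)
  qed
  then have S1: "bdd_below S" "\<And>q. q \<in> S \<Longrightarrow> 1 \<le> q"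
    by (auto simp: bdd_below_def)
  obtain r where r: "r \<in> \<rat>" "r > max 0 M"
    using Rats_dense_in_real[of "max 0 M" "max 0 M + 1"] by auto
  have "x \<notin> steep h r"
    unfolding steep_def
  proof clarify
    assume "\<forall>d>0. \<exists>a b. a < x \<and> x < b \<and> b - a < d \<and> r * (b - a) < h b - h a"
    then obtain a b where ab: "a < x" "x < b" "r * (b - a) < h b - h a"
      by (meson zero_less_one)
    have "h b - h a \<le> M * (b - a)"
      using upper[of a b] ab by simp
    also have "\<dots> \<le> r * (b - a)"
      using ab r by (intro mult_right_mono) auto
    finally show False using ab by simp
  qed
  with r have "r \<in> S" by (simp add: S_def)
  then have Sne: "S \<noteq> {}" by auto
  define D where "D = Inf S"
  have D1: "D \<ge> 1"
    unfolding D_def using Sne S1 by (intro cInf_greatest) auto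
  have *: "\<exists>d>0. \<forall>a b. a < x \<longrightarrow> x < b \<longrightarrow> b - a < d \<longrightarrow> \<bar>h b - h a - D * (b - a)\<bar> \<le> e * (b - a)" if e: "e > 0" for e
  proof -
    have "Inf S < D + e" using e by (simp add: D_def)
    then obtain q where q: "q \<in> S" "q < D + e"
      using cInf_lessD[OF Sne] by blast
    then have "x \<notin> steep h q" by (simp add: S_def)
    then obtain d1 where d1: "d1 > 0" "\<And>a b. a < x \<Longrightarrow> x < b \<Longrightarrow> b - a < d1 \<Longrightarrow> h b - h a \<le> q * (b - a)"
      unfolding steep_def by (simp add: not_less) (meson not_le)
    \<comment> \<open>Two rationals p < p' below D: x is steep for p', and the hypothesis for the
      pair then excludes quotients below p on short intervals.\<close>
    obtain p where p: "p \<in> \<rat>" "max 0 (D - e) < p" "p < D"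
      using Rats_dense_in_real[of "max 0 (D - e)" D] D1 e by auto
    obtain p' where p': "p' \<in> \<rat>" "p < p'" "p' < D"
      using Rats_dense_in_real[of p D] p by auto
    have "p' \<notin> S"
      using cInf_lower[OF _ S1(1), of p'] p' unfolding D_def by auto
    with p' p have "x \<in> steep h p'" by (auto simp: S_def)
    with x[of p p'] p p' have "x \<notin> steep (\<lambda>x. - h x) (- p)" by auto
    then obtain d2 where d2: "d2 > 0" "\<And>a b. a < x \<Longrightarrow> x < b \<Longrightarrow> b - a < d2 \<Longrightarrow> - h b + h a \<le> - p * (b - a)"
      unfolding steep_def by (simp add: not_less) (meson not_le)
    show ?thesis
    proof (intro exI[of _ "min d1 d2"] conjI allI impI)
      fix a b assume ab: "a < x" "x < b" "b - a < min d1 d2"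
      have "h b - h a \<le> q * (b - a)" "p * (b - a) \<le> h b - h a"
        using d1(2)[of a b] d2(2)[of a b] ab by auto
      moreover have "q * (b - a) \<le> (D + e) * (b - a)" "(D - e) * (b - a) \<le> p * (b - a)"
        using q p ab by (auto intro!: mult_right_mono)
      ultimately show "\<bar>h b - h a - D * (b - a)\<bar> \<le> e * (b - a)"
        by (simp add: abs_le_iff algebra_simps)
    qed (use d1 d2 in auto)
  qed
  have contx: "isCont h x"
    using cont by (simp add: continuous_on_eq_continuous_at)
  have "(h has_derivative (\<lambda>y. D * y)) (at x)"
    unfolding has_derivative_within_alt
  proof (intro conjI allI impI)
    fix e :: real assume "e > 0"
    then obtain d where d: "d > 0" "\<And>a b. a < x \<Longrightarrow> x < b \<Longrightarrow> b - a < d \<Longrightarrow> \<bar>h b - h a - D * (b - a)\<bar> \<le> e * (b - a)"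
      using * by blast
    show "\<exists>d>0. \<forall>y\<in>UNIV. norm (y - x) < d \<longrightarrow> norm (h y - h x - D * (y - x)) \<le> e * norm (y - x)"
    proof (intro exI[of _ "d / 2"] conjI ballI impI)
      fix y assume y: "norm (y - x) < d / 2"
      consider "y = x" | "y > x" | "y < x" by linarith
      then show "norm (h y - h x - D * (y - x)) \<le> e * norm (y - x)"
      proof cases
        case 2
        \<comment> \<open>The interval from a to y has x inside and is shorter than d, because both
          halves are shorter than d/2. Letting a tend to x from the left gives the quotient from x
          to y.\<close>
        have "eventually (\<lambda>a. a \<in> {x - d/2<..<x}) (at_left x)"
          using d by (intro eventually_at_left_real) auto
        then have ev: "eventually (\<lambda>a. \<bar>h y - h a - D * (y - a)\<bar> \<le> e * (y - a)) (at_left x)"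
          by (rule eventually_mono) (use d y 2 in auto)
        have "((\<lambda>a. \<bar>h y - h a - D * (y - a)\<bar>) \<longlongrightarrow> \<bar>h y - h x - D * (y - x)\<bar>) (at_left x)"
          using contx by (intro tendsto_intros) (auto simp: isCont_def filterlim_at_split)
        moreover have "((\<lambda>a. e * (y - a)) \<longlongrightarrow> e * (y - x)) (at_left x)"
          by (intro tendsto_intros)
        ultimately have "\<bar>h y - h x - D * (y - x)\<bar> \<le> e * (y - x)"
          using ev by (intro tendsto_le[OF trivial_limit_at_left_real])
        then show ?thesis using 2 by simp
      next
        case 3
        have "eventually (\<lambda>b. b \<in> {x<..<x + d/2}) (at_right x)"
          using d by (intro eventually_at_right_real) auto
        then have ev: "eventually (\<lambda>b. \<bar>h b - h y - D * (b - y)\<bar> \<le> e * (b - y)) (at_right x)"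
          by (rule eventually_mono) (use d y 3 in auto)
        have "((\<lambda>b. \<bar>h b - h y - D * (b - y)\<bar>) \<longlongrightarrow> \<bar>h x - h y - D * (x - y)\<bar>) (at_right x)"
          using contx by (intro tendsto_intros) (auto simp: isCont_def filterlim_at_split)
        moreover have "((\<lambda>b. e * (b - y)) \<longlongrightarrow> e * (x - y)) (at_right x)"
          by (intro tendsto_intros)
        ultimately have "\<bar>h x - h y - D * (x - y)\<bar> \<le> e * (x - y)"
          using ev by (intro tendsto_le[OF trivial_limit_at_right_real])
        moreover have "norm (h y - h x - D * (y - x)) = \<bar>h x - h y - D * (x - y)\<bar>"
          by (simp add: abs_if algebra_simps)
        ultimately show ?thesis using 3 by simp
      qed simp
    qed (use d in auto)
  qed (rule bounded_linear_mult_right)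
  then show ?thesis
    by (auto simp: has_field_derivative_def)
qed

lemma steep_shallow_null:
  fixes h :: "real \<Rightarrow> real"
  assumes mono: "strict_mono h" and inv: "\<And>x. k (h x) = x" "\<And>y. h (k y) = y"
    and cont: "continuous_on UNIV h" "continuous_on UNIV k"
    and pq: "0 < p" "p < q"
  shows "steep h q \<inter> steep (\<lambda>x. - h x) (- p) \<in> null_sets lborel"
proof -
  have kmono: "strict_mono k"
    using inv strict_mono_less[OF mono] by (metis strict_monoI)
  define A where "A n = steep h q \<inter> steep (\<lambda>x. - h x) (- p) \<inter> {- real n..real n}" for n :: nat
  have "A n \<in> null_sets lborel" for n
  proof -
    have Ab: "A n \<in> sets borel" by (simp add: A_def)
    have hA: "h ` A n = k -` A n"
    proof (intro equalityI subsetI)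
      fix y assume "y \<in> k -` A n"
      then show "y \<in> h ` A n"
        using inv(2)[of y] by (intro image_eqI[of y h "k y"]) auto
    qed (auto simp: inv)
    have hAb: "h ` A n \<in> sets borel"
      unfolding hA using measurable_sets[OF borel_measurable_continuous_onI[OF cont(2)] Ab] by simp
    have "emeasure lborel (A n) \<le> emeasure lborel {- real n..real n}"
      by (intro emeasure_mono) (auto simp: A_def)
    then have fin: "emeasure lborel (A n) < \<infinity>"
      by (auto simp: top.not_eq_extremum[symmetric] top_unique)
    have "h ` A n \<subseteq> {h (- real n)..h (real n)}"
      using strict_mono_less_eq[OF mono] by (auto simp: A_def)
    then have "emeasure lborel (h ` A n) \<le> emeasure lborel {h (- real n)..h (real n)}"
      by (intro emeasure_mono) auto
    then have fin': "emeasure lborel (h ` A n) < \<infinity>"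
      by (auto simp: top.not_eq_extremum[symmetric] top_unique emeasure_lborel_Icc_eq split: if_splits)
    have 1: "ennreal q * emeasure lborel (A n) \<le> emeasure lborel (h ` A n)"
      using pq by (intro emeasure_image_steep[OF mono inv cont Ab _ fin']) (auto simp: A_def)
    have kh: "k ` h ` A n = A n"
      by (simp add: image_image inv)
    have "h ` A n \<subseteq> steep k (1 / p)"
    proof
      fix y assume "y \<in> h ` A n"
      then obtain x where x: "x \<in> steep (\<lambda>x. - h x) (- p)" "y = h x" by (auto simp: A_def)
      show "y \<in> steep k (1 / p)"
        unfolding steep_def
      proof clarify
        fix d :: real assume "d > 0"
        then have "d / p > 0" using pq by simp
        then obtain a b where ab: "a < x" "x < b" "b - a < d / p" "- p * (b - a) < - h b - - h a"
          using x(1) unfolding steep_def by blast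
        have "h b - h a < p * (b - a)" "p * (b - a) < d" using ab pq by (auto simp: field_simps)
        then show "\<exists>a b. a < y \<and> y < b \<and> b - a < d \<and> 1 / p * (b - a) < k b - k a"
          using ab pq strict_mono_less[OF mono] by (intro exI[of _ "h a"] exI[of _ "h b"]) (auto simp: inv x field_simps)
      qed
    qed
    then have 2: "ennreal (1 / p) * emeasure lborel (h ` A n) \<le> emeasure lborel (A n)"
      using emeasure_image_steep[OF kmono inv(2) inv(1) cont(2) cont(1) hAb, of "1 / p"] fin pq
      by (simp add: kh)
    obtain m where m: "m \<ge> 0" "emeasure lborel (A n) = ennreal m"
      using fin by (cases "emeasure lborel (A n)") auto
    obtain m' where m': "m' \<ge> 0" "emeasure lborel (h ` A n) = ennreal m'"
      using fin' by (cases "emeasure lborel (h ` A n)") auto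
    have "q * m \<le> m'" "1 / p * m' \<le> m"
      using 1 2 pq m m' by (auto simp: ennreal_mult[symmetric] simp del: times_divide_eq_left)
    then have "q * m \<le> p * m" using pq by (simp add: field_simps)
    then have "m = 0" using pq m by (simp add: mult_le_cancel_right)
    then show ?thesis using m Ab by (intro null_setsI) auto
  qed
  then have "(\<Union>n. A n) \<in> null_sets lborel" by auto
  moreover have "(\<Union>n. A n) = steep h q \<inter> steep (\<lambda>x. - h x) (- p)"
  proof -
    have "\<exists>n. \<bar>x\<bar> \<le> real n" for x :: real by (rule real_arch_simple)
    then show ?thesis by (auto simp: A_def abs_le_iff) (metis minus_le_iff)
  qed
  ultimately show ?thesis by simp
qed

text \<open>Differentiability can fail only where the upper and lower quotients are separated by a
  pair of rationals p < q, and there are countably many such pairs.\<close>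

theorem Lipschitz_differentiable_AE:
  fixes g :: "real \<Rightarrow> real"
  assumes lip: "\<And>x y. \<bar>g x - g y\<bar> \<le> L * \<bar>x - y\<bar>"
  shows "AE x in lborel. \<exists>D. (g has_real_derivative D) (at x)"
proof -
  \<comment> \<open>The added slope L + 1 makes every difference quotient at least 1, so h is an
    increasing homeomorphism with 1-Lipschitz inverse; differentiability is unaffected.\<close>
  define h where "h x = g x + (L + 1) * x" for x
  have lower: "y - x \<le> h y - h x" if "x \<le> y" for x y
    using lip[of y x] that by (auto simp: h_def abs_le_iff algebra_simps)
  have upper: "h y - h x \<le> (2 * L + 1) * (y - x)" if "x \<le> y" for x y
    using lip[of y x] that by (auto simp: h_def abs_le_iff algebra_simps)
  have mono: "strict_mono h"
  proof (rule strict_monoI)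
    fix x y :: real assume "x < y"
    with lower[of x y] show "h x < h y" by linarith
  qed
  have "L-lipschitz_on UNIV g"
    using lip lip[of 1 0] by (intro lipschitz_onI) (auto simp: dist_real_def intro: order_trans[OF abs_ge_zero])
  then have "continuous_on UNIV g"
    by (rule lipschitz_on_continuous_on)
  then have conth: "continuous_on UNIV h"
    unfolding h_def by (intro continuous_intros)
  have "\<exists>x. h x = y" for y
  proof -
    define b where "b = \<bar>y - h 0\<bar>"
    have "h (- b) \<le> y" "y \<le> h b"
      using lower[of "- b" 0] lower[of 0 b] by (auto simp: b_def)
    then have "\<exists>x. - b \<le> x \<and> x \<le> b \<and> h x = y"
      using conth by (intro IVT') (auto simp: b_def intro: continuous_on_subset)
    then show ?thesis by blast
  qed
  then obtain k where k: "\<And>y. h (k y) = y" by metis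
  have kh: "k (h x) = x" for x
    using k[of "h x"] mono by (simp add: strict_mono_eq)
  have "\<bar>k x - k y\<bar> \<le> 1 * \<bar>x - y\<bar>" for x y
    using lower[of "k x" "k y"] lower[of "k y" "k x"] by (cases "k x \<le> k y") (auto simp: k)
  then have "1-lipschitz_on UNIV k"
    by (intro lipschitz_onI) (auto simp: dist_real_def)
  then have contk: "continuous_on UNIV k"
    by (rule lipschitz_on_continuous_on)
  have "AE x in lborel. x \<notin> (\<Union>p\<in>\<rat>. \<Union>q\<in>\<rat>. if 0 < p \<and> p < q then steep h q \<inter> steep (\<lambda>x. - h x) (- p) else {})"
    using steep_shallow_null[OF mono kh k conth contk] countable_rat
    by (intro AE_not_in null_sets_UN') auto
  then show ?thesis
  proof (rule eventually_mono)
    fix x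
    assume x: "x \<notin> (\<Union>p\<in>\<rat>. \<Union>q\<in>\<rat>. if 0 < p \<and> p < q then steep h q \<inter> steep (\<lambda>x. - h x) (- p) else {})"
    have "\<exists>D. (h has_real_derivative D) (at x)"
    proof (rule differentiable_if_steepness_agrees[OF conth lower upper])
      fix p q :: real assume "p \<in> \<rat>" "q \<in> \<rat>" "0 < p" "p < q"
      then show "x \<notin> steep h q \<or> x \<notin> steep (\<lambda>x. - h x) (- p)"
        using x by (auto split: if_splits)
    qed
    then obtain D where D: "(h has_real_derivative D) (at x)" by blast
    have "((\<lambda>x. h x - (L + 1) * x) has_real_derivative (D - (L + 1) * 1)) (at x)"
      by (auto intro!: derivative_eq_intros D)
    then show "\<exists>D. (g has_real_derivative D) (at x)"
      by (auto simp: h_def)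
  qed
qed

corollary Lipschitz_vector_differentiable_AE:
  fixes g :: "real \<Rightarrow> complex"
  assumes lip: "\<And>x y. norm (g x - g y) \<le> L * \<bar>x - y\<bar>"
  shows "AE x in lborel. \<exists>D. (g has_vector_derivative D) (at x)"
proof -
  have "AE x in lborel. \<exists>D. ((\<lambda>x. Re (g x)) has_real_derivative D) (at x)"
    using lip abs_Re_le_cmod by (intro Lipschitz_differentiable_AE[of _ L]) (metis minus_complex.simps(1) order_trans)
  moreover have "AE x in lborel. \<exists>D. ((\<lambda>x. Im (g x)) has_real_derivative D) (at x)"
    using lip abs_Im_le_cmod by (intro Lipschitz_differentiable_AE[of _ L]) (metis minus_complex.simps(2) order_trans)
  ultimately show ?thesis
  proof eventually_elim
    case (elim x)
    then obtain D E where "((\<lambda>x. Re (g x)) has_real_derivative D) (at x)"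
      "((\<lambda>x. Im (g x)) has_real_derivative E) (at x)" by blast
    then have "(g has_vector_derivative (Complex D E)) (at x)"
      by (simp add: has_vector_derivative_complex_iff has_real_derivative_iff_has_vector_derivative)
    then show ?case by blast
  qed
qed

section \<open>Boundary behaviour of bounded holomorphic functions\<close>

abbreviation chp :: "complex set" where "chp \<equiv> {s. 0 \<le> Re s}"

lemma rhp_halfspace: "rhp = {s. inner 1 s > 0}"
  by (simp add: rhp_def)

lemma open_rhp: "open rhp"
  unfolding rhp_halfspace by (rule open_halfspace_gt)

lemma convex_rhp: "convex rhp"
  unfolding rhp_halfspace by (rule convex_halfspace_gt)

lemma closure_rhp: "closure rhp = chp"
  using closure_halfspace_gt[of "1::complex" 0] by (simp add: rhp_halfspace)

lemma interior_chp: "interior chp = rhp"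
  using interior_halfspace_ge[of "1::complex" 0] by (simp add: rhp_halfspace)

lemma convex_chp: "convex chp"
  using convex_halfspace_ge[of 0 "1::complex"] by simp

lemma rhp_subset_chp: "rhp \<subseteq> chp"
  by (auto simp: rhp_def)

text \<open>On a convex set a bound on the derivative is a Lipschitz constant, and a Lipschitz
  function extends uniquely to the closure. Boundary questions about F become questions about
  differentiability of G on the axis.\<close>

lemma bounded_holomorphic_primitive:
  assumes F: "F holomorphic_on rhp" and B: "\<And>s. s \<in> rhp \<Longrightarrow> norm (F s) \<le> B"
  obtains G where "continuous_on chp G" "\<And>s. s \<in> rhp \<Longrightarrow> (G has_field_derivative F s) (at s)"
    "\<And>a b. a \<in> chp \<Longrightarrow> b \<in> chp \<Longrightarrow> norm (G a - G b) \<le> B * norm (a - b)"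
proof -
  obtain G0 where G0: "\<And>s. s \<in> rhp \<Longrightarrow> (G0 has_field_derivative F s) (at s within rhp)"
    using holomorphic_convex_primitive'[OF convex_rhp open_rhp F] by blast
  have "0 \<le> B"
    using order_trans[OF norm_ge_zero B[of 1]] by (simp add: rhp_def)
  have lip0: "B-lipschitz_on rhp G0"
  proof (rule lipschitz_onI)
    fix a b assume "a \<in> rhp" "b \<in> rhp"
    then show "dist (G0 a) (G0 b) \<le> B * dist a b"
      using field_differentiable_bound[OF convex_rhp G0 B] by (simp add: dist_norm)
  qed fact
  obtain G where G: "uniformly_continuous_on (closure rhp) G" "\<And>x. x \<in> rhp \<Longrightarrow> G0 x = G x"
    using uniformly_continuous_on_extension_on_closure[OF lipschitz_on_uniformly_continuous[OF lip0]] by metis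
  have cont: "continuous_on (closure rhp) G"
    using G(1) by (rule uniformly_continuous_imp_continuous)
  have "B-lipschitz_on rhp G"
    using lip0 G(2) by (simp add: lipschitz_on_def)
  from lipschitz_on_closure[OF this cont]
  have lip: "B-lipschitz_on chp G" by (simp add: closure_rhp)
  show thesis
  proof
    show "continuous_on chp G" using cont by (simp add: closure_rhp)
    show "(G has_field_derivative F s) (at s)" if "s \<in> rhp" for s
    proof -
      have "(G has_field_derivative F s) (at s within rhp)"
        by (rule has_field_derivative_transform_within[OF G0[OF that] zero_less_one that]) (rule G(2))
      then show ?thesis
        by (simp only: at_within_open[OF that open_rhp])
    qed
    show "norm (G a - G b) \<le> B * norm (a - b)" if "a \<in> chp" "b \<in> chp" for a b
      using lipschitz_onD[OF lip that] by (simp add: dist_norm)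
  qed
qed

text \<open>The derivative at \<open>1\<close> is expressed through the boundary by the kernel
  \<open>1 / (w - 1)\<^sup>2 - 1 / (w + 1)\<^sup>2 = 4 w / ((w - 1)\<^sup>2 (w + 1)\<^sup>2)\<close>, which decays like
  \<open>\<bar>w\<bar>\<^sup>-\<^sup>3\<close>, fast enough for functions of linear growth.\<close>

lemma deriv_at_1_rectangle_integral:
  assumes cont: "continuous_on chp H" and hol: "H holomorphic_on rhp" and R: "R > 1"
  shows "((\<lambda>w. H w * (1 / (w - 1)\<^sup>2 - 1 / (w + 1)\<^sup>2)) has_contour_integral
      2 * of_real pi * \<i> * deriv H 1) (rectpath (Complex 0 (- R)) (Complex R R))"
proof -
  let ?\<gamma> = "rectpath (Complex 0 (- R)) (Complex R R)"
  have 1: "1 \<in> rhp" by (simp add: rhp_def)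
  have pim: "path_image ?\<gamma> \<subseteq> chp - {1}"
    using R by (auto simp: path_image_rectpath)
  \<comment> \<open>Since f/(w - 1) + H(1)/(w - 1)^2 = H/(w - 1)^2, the value H'(1) comes from
    Cauchy's formula for f, with H merely continuous on the axis. The term with (w - 1)^2 has a
    primitive, and the pole -1 of the remaining term lies outside the half-plane.\<close>
  define f where "f w = (if w = 1 then deriv H 1 else (H w - H 1) / (w - 1))" for w
  have fhol: "f holomorphic_on rhp"
    unfolding f_def using hol 1 open_rhp by (intro pole_lemma) (auto simp: interior_open)
  have fcont: "continuous_on chp f"
    unfolding continuous_on_eq_continuous_within
  proof
    fix w assume w: "w \<in> chp"
    show "continuous (at w within chp) f"
    proof (cases "w \<in> rhp")
      case True
      then have "isCont f w"
        using continuous_on_eq_continuous_at[OF open_rhp, THEN iffD1, OF holomorphic_on_imp_continuous_on[OF fhol]] True by blast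
      then show ?thesis by (rule continuous_at_imp_continuous_at_within)
    next
      case False
      then have "w \<noteq> 1" using 1 by auto
      then have "continuous (at w within chp) (\<lambda>w. (H w - H 1) / (w - 1))"
        using cont w by (intro continuous_intros) (auto simp: continuous_on_eq_continuous_within)
      then show ?thesis
      proof (rule continuous_transform_within[where \<delta> = "dist w 1"])
        show "(H v - H 1) / (v - 1) = f v" if "v \<in> chp" "dist v w < dist w 1" for v
          using that by (auto simp: f_def dist_commute)
      qed (use w \<open>w \<noteq> 1\<close> in auto)
    qed
  qed
  have A: "((\<lambda>w. f w / (w - 1)) has_contour_integral of_real (2 * pi) * \<i> * winding_number ?\<gamma> 1 * f 1) ?\<gamma>"
  proof (rule Cauchy_integral_formula_weak[where S = chp and k = "{}" and z = 1 and f = f])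
    show "f field_differentiable at x" if "x \<in> interior chp - {}" for x
      using that fhol open_rhp by (auto simp: interior_chp holomorphic_on_open field_differentiable_def)
  qed (use convex_chp fcont pim 1 in \<open>auto simp: interior_chp\<close>)
  have wn: "winding_number ?\<gamma> 1 = 1"
    using R by (intro winding_number_rectpath) (auto simp: in_box_complex_iff)
  have B: "((\<lambda>w. 1 / (w - 1)\<^sup>2) has_contour_integral 0) ?\<gamma>"
  proof -
    have "((\<lambda>w. 1 / (w - 1)\<^sup>2) has_contour_integral
        - (1 / (pathfinish ?\<gamma> - 1)) - - (1 / (pathstart ?\<gamma> - 1))) ?\<gamma>"
    proof (rule contour_integral_primitive[where S = "- {1}"])
      show "((\<lambda>w. - (1 / (w - 1))) has_field_derivative 1 / (x - 1)\<^sup>2) (at x within - {1})" if "x \<in> - {1}" for x :: complex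
        using that by (auto intro!: derivative_eq_intros simp: power2_eq_square)
    qed (use pim in auto)
    then show ?thesis by simp
  qed
  have C: "((\<lambda>w. H w / (w + 1)\<^sup>2) has_contour_integral 0) ?\<gamma>"
  proof (rule Cauchy_theorem_convex[where S = chp and K = "{}"])
    have nz: "w + 1 \<noteq> 0" if "w \<in> chp" for w
      using that by (auto simp: complex_eq_iff)
    show "continuous_on chp (\<lambda>w. H w / (w + 1)\<^sup>2)"
      using cont nz by (intro continuous_intros) auto
    have "(\<lambda>w. H w / (w + 1)\<^sup>2) holomorphic_on rhp"
      using hol nz rhp_subset_chp by (intro holomorphic_intros) auto
    then show "(\<lambda>w. H w / (w + 1)\<^sup>2) field_differentiable at x" if "x \<in> interior chp - {}" for x
      using that open_rhp by (auto simp: interior_chp holomorphic_on_open field_differentiable_def)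
  qed (use convex_chp pim in auto)
  have "((\<lambda>w. f w / (w - 1) + H 1 * (1 / (w - 1)\<^sup>2) - H w / (w + 1)\<^sup>2) has_contour_integral
      2 * of_real pi * \<i> * deriv H 1 + H 1 * 0 - 0) ?\<gamma>"
    using A by (intro has_contour_integral_add has_contour_integral_diff has_contour_integral_lmul B C)
      (simp add: wn f_def)
  then have "((\<lambda>w. f w / (w - 1) + H 1 * (1 / (w - 1)\<^sup>2) - H w / (w + 1)\<^sup>2) has_contour_integral
      2 * of_real pi * \<i> * deriv H 1) ?\<gamma>"
    by simp
  then show ?thesis
  proof (rule has_contour_integral_eq)
    fix x assume "x \<in> path_image ?\<gamma>"
    then have "x \<noteq> 1" using pim by auto
    then show "f x / (x - 1) + H 1 * (1 / (x - 1)\<^sup>2) - H x / (x + 1)\<^sup>2 = H x * (1 / (x - 1)\<^sup>2 - 1 / (x + 1)\<^sup>2)"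
      by (simp add: f_def diff_divide_distrib power2_eq_square algebra_simps)
  qed
qed

text \<open>The three sides off the axis have total length 4 R and carry an integrand of size at
  most 256 B/R^2. On the axis the length is 2 R and the integrand is at most 4 R \<eta>.\<close>

lemma norm_deriv_at_1_le:
  assumes cont: "continuous_on chp H" and hol: "H holomorphic_on rhp" and R: "R \<ge> 2"
    and lin: "\<And>w. w \<in> chp \<Longrightarrow> norm (H w) \<le> B * norm w"
    and bdy: "\<And>y. \<bar>y\<bar> \<le> R \<Longrightarrow> norm (H (Complex 0 y)) \<le> \<eta>"
  shows "2 * pi * norm (deriv H 1) \<le> 1024 * B / R + 8 * R\<^sup>2 * \<eta>"
proof -
  let ?K = "\<lambda>w::complex. 1 / (w - 1)\<^sup>2 - 1 / (w + 1)\<^sup>2"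
  let ?f = "\<lambda>w. H w * ?K w"
  have B: "0 \<le> B" using lin[of 1] norm_ge_zero[of "H 1"] by (simp del: norm_ge_zero)
  have \<eta>: "0 \<le> \<eta>" using bdy[of 0] norm_ge_zero[of "H (Complex 0 0)"] R by (simp del: norm_ge_zero)
  have K: "?K w = 4 * w / ((w - 1)\<^sup>2 * (w + 1)\<^sup>2)" if "w \<noteq> 1" "w \<noteq> - 1" for w
  proof -
    have "w - 1 \<noteq> 0" "w + 1 \<noteq> 0" using that by (auto simp: add_eq_0_iff2)
    then have "?K w = ((w + 1)\<^sup>2 - (w - 1)\<^sup>2) / ((w - 1)\<^sup>2 * (w + 1)\<^sup>2)"
      by (simp add: diff_frac_eq)
    also have "(w + 1)\<^sup>2 - (w - 1)\<^sup>2 = 4 * w"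
      by (simp add: power2_eq_square algebra_simps)
    finally show ?thesis .
  qed
  define a1 a2 a3 a4 where "a1 = Complex 0 (- R)" and "a2 = Complex R (- R)"
    and "a3 = Complex R R" and "a4 = Complex 0 R"
  have far: "norm (?f w) \<le> 256 * B / R\<^sup>2" if w: "w \<in> chp" "R \<le> norm w" "norm w \<le> 2 * R" for w
  proof -
    \<comment> \<open>The assumption R \<ge> 2 enters here: subtracting 1 from a modulus of at least
      R leaves at least R/2.\<close>
    have n1: "R / 2 \<le> norm (w - 1)" "R / 2 \<le> norm (w + 1)"
      using norm_triangle_ineq2[of w 1] norm_triangle_ineq2[of w "- 1"] w R by auto
    then have ne: "w \<noteq> 1" "w \<noteq> - 1" using R by auto
    have "(R / 2)\<^sup>2 * (R / 2)\<^sup>2 \<le> norm (w - 1) ^ 2 * norm (w + 1) ^ 2"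
      using n1 R by (intro mult_mono power_mono) auto
    then have "norm (?K w) \<le> 4 * (2 * R) / ((R / 2)\<^sup>2 * (R / 2)\<^sup>2)"
      unfolding K[OF ne] using w R by (simp add: norm_divide norm_mult norm_power del: times_divide_eq_right) (intro frac_le, auto)
    also have "\<dots> = 128 / R ^ 3"
      using R by (simp add: field_simps power2_eq_square power3_eq_cube)
    finally have Kb: "norm (?K w) \<le> 128 / R ^ 3" .
    have "norm (H w) \<le> B * (2 * R)"
      using lin[OF w(1)] w B by (meson mult_left_mono order_trans)
    then have "norm (H w) * norm (?K w) \<le> B * (2 * R) * (128 / R ^ 3)"
      using Kb B R by (intro mult_mono) auto
    also have "\<dots> = 256 * B / R\<^sup>2"
      using R by (simp add: field_simps power2_eq_square power3_eq_cube)
    finally show ?thesis by (simp add: norm_mult)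
  qed
  have near: "norm (?f w) \<le> \<eta> * (4 * R)" if w: "Re w = 0" "\<bar>Im w\<bar> \<le> R" for w
  proof -
    have n1: "1 \<le> norm (w - 1)" "1 \<le> norm (w + 1)"
      using w abs_Re_le_cmod[of "w - 1"] abs_Re_le_cmod[of "w + 1"] by auto
    then have ne: "w \<noteq> 1" "w \<noteq> - 1" by auto
    have "norm w \<le> R"
      using w by (simp add: cmod_def)
    moreover have "1 * 1 \<le> norm (w - 1) ^ 2 * norm (w + 1) ^ 2"
      using n1 by (intro mult_mono one_le_power) auto
    ultimately have "norm (?K w) \<le> 4 * R / 1"
      unfolding K[OF ne] using R by (simp add: norm_divide norm_mult norm_power del: div_by_1) (intro frac_le, auto)
    moreover have "w = Complex 0 (Im w)" using w by (simp add: complex_eq_iff)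
    then have "norm (H w) \<le> \<eta>" using bdy[of "Im w"] w by simp
    ultimately show ?thesis
      using \<eta> R by (auto simp: norm_mult intro!: mult_mono)
  qed
  have int: "(?f has_contour_integral 2 * of_real pi * \<i> * deriv H 1) (rectpath a1 a3)"
    unfolding a1_def a3_def using deriv_at_1_rectangle_integral[OF cont hol] R by simp
  then have ci: "?f contour_integrable_on linepath a1 a2" "?f contour_integrable_on linepath a2 a3"
    "?f contour_integrable_on linepath a3 a4" "?f contour_integrable_on linepath a4 a1"
    using contour_integrable_on_def[of ?f "rectpath a1 a3"]
    by (auto simp: rectpath_def Let_def a1_def a2_def a3_def a4_def)
  have "2 * of_real pi * \<i> * deriv H 1 = contour_integral (rectpath a1 a3) ?f"
    using int by (rule contour_integral_unique[symmetric])
  also have "\<dots> = contour_integral (linepath a1 a2) ?f + (contour_integral (linepath a2 a3) ?f +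
      (contour_integral (linepath a3 a4) ?f + contour_integral (linepath a4 a1) ?f))"
    using ci by (simp add: rectpath_def Let_def a1_def a2_def a3_def a4_def)
  finally have eq: "2 * of_real pi * \<i> * deriv H 1 = \<dots>" .
  have seg: "norm (contour_integral (linepath p q) ?f) \<le> 256 * B / R\<^sup>2 * norm (q - p)"
    if "?f contour_integrable_on linepath p q"
      "\<And>w. w \<in> closed_segment p q \<Longrightarrow> w \<in> chp \<and> R \<le> norm w \<and> norm w \<le> 2 * R" for p q
    using that B R far by (intro contour_integral_bound_linepath) auto
  have nb: "norm w \<le> 2 * R" if "\<bar>Re w\<bar> \<le> R" "\<bar>Im w\<bar> \<le> R" for w
    using that cmod_le[of w] by linarith
  have s1: "norm (contour_integral (linepath a1 a2) ?f) \<le> 256 * B / R\<^sup>2 * R"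
  proof -
    have "w \<in> chp \<and> R \<le> norm w \<and> norm w \<le> 2 * R" if "w \<in> closed_segment a1 a2" for w
    proof -
      have "Im w = - R" "0 \<le> Re w" "Re w \<le> R"
        using that R by (auto simp: a1_def a2_def closed_segment_same_Im closed_segment_eq_real_ivl)
      then show ?thesis
        using nb[of w] abs_Im_le_cmod[of w] R by auto
    qed
    moreover have "norm (a2 - a1) = R" using R by (simp add: a1_def a2_def cmod_def)
    ultimately show ?thesis using seg[OF ci(1)] by simp
  qed
  have s2: "norm (contour_integral (linepath a2 a3) ?f) \<le> 256 * B / R\<^sup>2 * (2 * R)"
  proof -
    have "w \<in> chp \<and> R \<le> norm w \<and> norm w \<le> 2 * R" if "w \<in> closed_segment a2 a3" for w
    proof -
      have "Re w = R" "- R \<le> Im w" "Im w \<le> R"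
        using that R by (auto simp: a2_def a3_def closed_segment_same_Re closed_segment_eq_real_ivl)
      then show ?thesis
        using nb[of w] abs_Re_le_cmod[of w] R by auto
    qed
    moreover have "norm (a3 - a2) = 2 * R" using R by (simp add: a3_def a2_def cmod_def real_sqrt_mult)
    ultimately show ?thesis using seg[OF ci(2)] by simp
  qed
  have s3: "norm (contour_integral (linepath a3 a4) ?f) \<le> 256 * B / R\<^sup>2 * R"
  proof -
    have "w \<in> chp \<and> R \<le> norm w \<and> norm w \<le> 2 * R" if "w \<in> closed_segment a3 a4" for w
    proof -
      have "Im w = R" "0 \<le> Re w" "Re w \<le> R"
        using that R by (auto simp: a3_def a4_def closed_segment_same_Im closed_segment_eq_real_ivl)
      then show ?thesis
        using nb[of w] abs_Im_le_cmod[of w] R by auto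
    qed
    moreover have "norm (a4 - a3) = R" using R by (simp add: a3_def a4_def cmod_def)
    ultimately show ?thesis using seg[OF ci(3)] by simp
  qed
  have s4: "norm (contour_integral (linepath a4 a1) ?f) \<le> \<eta> * (4 * R) * (2 * R)"
  proof -
    have "norm (?f w) \<le> \<eta> * (4 * R)" if "w \<in> closed_segment a4 a1" for w
    proof -
      have "Re w = 0" "- R \<le> Im w" "Im w \<le> R"
        using that R by (auto simp: a4_def a1_def closed_segment_same_Re closed_segment_eq_real_ivl)
      then show ?thesis by (intro near) auto
    qed
    moreover have "norm (a1 - a4) = 2 * R" using R by (simp add: a1_def a4_def cmod_def real_sqrt_mult)
    ultimately show ?thesis
      using contour_integral_bound_linepath[OF ci(4), of "\<eta> * (4 * R)"] \<eta> R by simp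
  qed
  have "2 * pi * norm (deriv H 1) = norm (2 * of_real pi * \<i> * deriv H 1)"
    by (simp add: norm_mult)
  also have "\<dots> \<le> 256 * B / R\<^sup>2 * R + (256 * B / R\<^sup>2 * (2 * R) + (256 * B / R\<^sup>2 * R + \<eta> * (4 * R) * (2 * R)))"
    unfolding eq by (intro norm_triangle_mono s1 s2 s3 s4)
  also have "\<dots> = 1024 * B / R + 8 * R\<^sup>2 * \<eta>"
    using R by (simp add: field_simps power2_eq_square)
  finally show ?thesis .
qed

text \<open>Rescaling the primitive \<open>G\<close> at \<open>i \<omega>\<close> by \<open>x\<close> and subtracting its linear part, one
  gets functions of uniformly linear growth that are small on the axis near \<open>0\<close>.\<close>

lemma radial_limit_at_vector_derivative:
  assumes cont: "continuous_on chp G" and der: "\<And>s. s \<in> rhp \<Longrightarrow> (G has_field_derivative F s) (at s)"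
    and lip: "\<And>a b. a \<in> chp \<Longrightarrow> b \<in> chp \<Longrightarrow> norm (G a - G b) \<le> B * norm (a - b)"
    and D: "((\<lambda>y. G (Complex 0 y)) has_vector_derivative D) (at \<omega>)"
  shows "((\<lambda>\<sigma>. F (Complex \<sigma> \<omega>)) \<longlongrightarrow> - \<i> * D) (at_right 0)"
proof -
  \<comment> \<open>Differentiating along y -> i y multiplies a complex derivative by i, so c is the
    value that G' should take at i \<omega>.\<close>
  define c where "c = - \<i> * D"
  define C where "C = B + norm c"
  have B: "0 \<le> B"
    using order_trans[OF norm_ge_zero lip[of 1 0]] by simp
  have C: "0 \<le> C" using B by (simp add: C_def)
  have bound: "2 * pi * norm (F (Complex x \<omega>) - c) \<le> 1024 * C / R + 8 * R\<^sup>2 * (\<epsilon> * R)"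
    if x: "0 < x" and R: "2 \<le> R" and \<epsilon>: "0 \<le> \<epsilon>"
      and small: "\<And>t. \<bar>t\<bar> \<le> x * R \<Longrightarrow> norm (G (Complex 0 (\<omega> + t)) - G (Complex 0 \<omega>) - of_real t * D) \<le> \<epsilon> * \<bar>t\<bar>" for x R \<epsilon>
  proof -
    let ?p = "\<lambda>w. Complex 0 \<omega> + of_real x * w"
    define H where "H w = (G (?p w) - G (Complex 0 \<omega>)) / of_real x - c * w" for w
    have pc: "?p w \<in> chp" if "w \<in> chp" for w using that x by simp
    have pr: "?p w \<in> rhp" if "w \<in> rhp" for w using that x by (simp add: rhp_def)
    have contH: "continuous_on chp H"
      unfolding H_def using x pc
      by (intro continuous_intros continuous_on_compose2[OF cont]) auto
    have derH: "(H has_field_derivative F (?p w) - c) (at w)" if "w \<in> rhp" for w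
    proof -
      have "((\<lambda>w. G (?p w)) has_field_derivative F (?p w) * of_real x) (at w)"
        by (rule DERIV_chain2[where f = G and g = ?p, OF der[OF pr[OF that]]]) (auto intro!: derivative_eq_intros)
      then have "((\<lambda>w. (G (?p w) - G (Complex 0 \<omega>)) / of_real x - c * w) has_field_derivative
          (F (?p w) * of_real x - 0) / of_real x - c * 1) (at w)"
        by (intro DERIV_diff DERIV_cdivide DERIV_const DERIV_cmult DERIV_ident)
      then show ?thesis
        using x by (simp add: H_def[abs_def])
    qed
    then have holH: "H holomorphic_on rhp"
      using open_rhp by (auto simp: holomorphic_on_open)
    have "norm (H w) \<le> C * norm w" if w: "w \<in> chp" for w
    proof -
      have "norm (G (?p w) - G (Complex 0 \<omega>)) \<le> B * norm (?p w - Complex 0 \<omega>)"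
        using pc[OF w] by (intro lip) auto
      then have "norm ((G (?p w) - G (Complex 0 \<omega>)) / of_real x) \<le> B * norm w"
        using x by (simp add: norm_divide norm_mult field_simps)
      then have "norm (H w) \<le> B * norm w + norm (c * w)"
        unfolding H_def
        using norm_triangle_ineq4[of "(G (?p w) - G (Complex 0 \<omega>)) / of_real x" "c * w"] by linarith
      then show ?thesis
        by (simp add: C_def norm_mult algebra_simps)
    qed
    moreover have "norm (H (Complex 0 y)) \<le> \<epsilon> * R" if y: "\<bar>y\<bar> \<le> R" for y
    proof -
      have p: "?p (Complex 0 y) = Complex 0 (\<omega> + x * y)"
        by (simp add: complex_eq_iff)
      have cy: "c * Complex 0 y = of_real y * D"
        by (simp add: c_def complex_eq_iff)
      have "H (Complex 0 y) = (G (Complex 0 (\<omega> + x * y)) - G (Complex 0 \<omega>) - of_real (x * y) * D) / of_real x"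
        using x unfolding H_def p cy by (simp add: field_simps)
      moreover have "norm (G (Complex 0 (\<omega> + x * y)) - G (Complex 0 \<omega>) - of_real (x * y) * D) \<le> \<epsilon> * \<bar>x * y\<bar>"
        using x y by (intro small) (simp add: abs_mult)
      ultimately have "norm (H (Complex 0 y)) \<le> \<epsilon> * \<bar>y\<bar>"
        using x by (simp add: norm_divide abs_mult del: of_real_mult) (simp add: field_simps)
      also have "\<dots> \<le> \<epsilon> * R"
        using y \<epsilon> by (rule mult_left_mono)
      finally show ?thesis .
    qed
    ultimately have "2 * pi * norm (deriv H 1) \<le> 1024 * C / R + 8 * R\<^sup>2 * (\<epsilon> * R)"
      by (intro norm_deriv_at_1_le contH holH R)
    moreover have "deriv H 1 = F (Complex x \<omega>) - c"
    proof -
      have "?p 1 = Complex x \<omega>" by (simp add: complex_eq_iff)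
      then show ?thesis
        using DERIV_imp_deriv[OF derH[of 1]] by (simp add: rhp_def)
    qed
    ultimately show ?thesis by simp
  qed
  show ?thesis
    unfolding c_def[symmetric]
  proof (rule tendstoI)
    fix e :: real assume e: "e > 0"
    \<comment> \<open>R is chosen so that 1024 C/R \<le> e, and \<epsilon> below so that 8 R^3
      \<epsilon> = e. The total 2 e stays below 2 \<pi> e, which leaves e after division by 2
      \<pi>.\<close>
    define R where "R = max 2 (1024 * C / e)"
    have R: "R \<ge> 2" "1024 * C / R \<le> e"
      using e C by (auto simp: R_def field_simps max_def)
    define \<epsilon> where "\<epsilon> = e / (8 * R ^ 3)"
    have \<epsilon>: "\<epsilon> > 0" "8 * R\<^sup>2 * (\<epsilon> * R) = e"
      using e R by (auto simp: \<epsilon>_def power2_eq_square power3_eq_cube)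
    from D \<epsilon>(1) obtain d where d: "d > 0" "\<And>y. norm (y - \<omega>) < d \<Longrightarrow>
        norm (G (Complex 0 y) - G (Complex 0 \<omega>) - (y - \<omega>) *\<^sub>R D) \<le> \<epsilon> * norm (y - \<omega>)"
      unfolding has_vector_derivative_def has_derivative_within_alt by blast
    have "eventually (\<lambda>x. x \<in> {0<..<d / R}) (at_right 0)"
      using d R by (intro eventually_at_right_real) auto
    then show "\<forall>\<^sub>F x in at_right 0. dist (F (Complex x \<omega>)) c < e"
    proof (rule eventually_mono)
      fix x assume x: "x \<in> {0<..<d / R}"
      then have "x * R < d" using R by (auto simp: field_simps)
      then have "norm (G (Complex 0 (\<omega> + t)) - G (Complex 0 \<omega>) - of_real t * D) \<le> \<epsilon> * \<bar>t\<bar>" if "\<bar>t\<bar> \<le> x * R" for t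
        using d(2)[of "\<omega> + t"] that by (simp add: scaleR_conv_of_real)
      then have "2 * pi * norm (F (Complex x \<omega>) - c) \<le> e + e"
        using bound[of x R \<epsilon>] x R \<epsilon> by auto
      moreover have "2 * e < 2 * pi * e"
        using e pi_gt3 by (intro mult_strict_right_mono) auto
      ultimately have "2 * pi * norm (F (Complex x \<omega>) - c) < 2 * pi * e" by linarith
      then show "dist (F (Complex x \<omega>)) c < e"
        by (simp add: dist_norm)
    qed
  qed
qed

text \<open>The trace y -> G(i y) of a bounded function's primitive is Lipschitz, hence
  differentiable almost everywhere, and each point of differentiability gives a radial limit of
  F.\<close>

theorem Fatou_radial_limits:
  assumes F: "F holomorphic_on rhp" and B: "bounded (F ` rhp)"
  shows "AE \<omega> in lborel. \<exists>l. ((\<lambda>\<sigma>. F (Complex \<sigma> \<omega>)) \<longlongrightarrow> l) (at_right 0)"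
proof -
  obtain B where B: "\<And>s. s \<in> rhp \<Longrightarrow> norm (F s) \<le> B"
    using B by (auto simp: bounded_iff)
  obtain G where G: "continuous_on chp G" "\<And>s. s \<in> rhp \<Longrightarrow> (G has_field_derivative F s) (at s)"
    "\<And>a b. a \<in> chp \<Longrightarrow> b \<in> chp \<Longrightarrow> norm (G a - G b) \<le> B * norm (a - b)"
    using bounded_holomorphic_primitive[OF F B] by metis
  have "norm (G (Complex 0 x) - G (Complex 0 y)) \<le> B * \<bar>x - y\<bar>" for x y
    using G(3)[of "Complex 0 x" "Complex 0 y"] by (simp add: cmod_def)
  from Lipschitz_vector_differentiable_AE[OF this]
  show ?thesis
    by (rule eventually_mono) (use radial_limit_at_vector_derivative[OF G] in blast)
qed

section \<open>Maximum principles on the half-plane\<close>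

lemma Phragmen_Lindelof_chp:
  assumes cont: "continuous_on chp h" and hol: "h holomorphic_on rhp"
    and B: "\<And>s. s \<in> chp \<Longrightarrow> norm (h s) \<le> B" and t: "0 < t"
    and bdy: "\<And>s. Re s = 0 \<Longrightarrow> norm (h s) \<le> t" and s: "s \<in> rhp"
  shows "norm (h s) \<le> t"
proof -
  \<comment> \<open>Division by 1 + \<delta> s, of modulus at least 1 on the closed half-plane,
    forces decay at infinity, so the maximum principle on a large half-disc applies. Afterwards
    \<delta> tends to 0.\<close>
  have *: "norm (h s) \<le> t * norm (1 + of_real \<delta> * s)" if \<delta>: "\<delta> > 0" for \<delta> :: real
  proof -
    have n1: "norm (1 + of_real \<delta> * z) \<ge> 1" "norm (1 + of_real \<delta> * z) \<ge> \<delta> * norm z - 1" if "z \<in> chp" for z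
    proof -
      have "1 \<le> Re (1 + of_real \<delta> * z)" using that \<delta> by simp
      also have "\<dots> \<le> norm (1 + of_real \<delta> * z)" by (rule complex_Re_le_cmod)
      finally show "norm (1 + of_real \<delta> * z) \<ge> 1" .
      show "norm (1 + of_real \<delta> * z) \<ge> \<delta> * norm z - 1"
        using norm_triangle_ineq2[of "of_real \<delta> * z" "- 1"] \<delta> by (simp add: norm_mult add.commute)
    qed
    then have nz: "1 + of_real \<delta> * z \<noteq> 0" if "z \<in> chp" for z
      using that by fastforce
    define \<phi> where "\<phi> z = h z / (1 + of_real \<delta> * z)" for z
    have "0 \<le> B" using order_trans[OF norm_ge_zero B[of 0]] by simp
    \<comment> \<open>The first entry puts s inside the half-disc. The second makes \<delta> |z| - 1
      \<ge> B/t on the arc, so the quotient is at most t there.\<close>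
    define \<rho> where "\<rho> = max (norm s + 1) ((1 + B / t) / \<delta>)"
    define S where "S = rhp \<inter> ball 0 \<rho>"
    have clS: "closure S \<subseteq> chp"
      using closure_mono[of S rhp] by (auto simp: S_def closure_rhp)
    have "norm (\<phi> s) \<le> t"
    proof (rule maximum_modulus_frontier[where S = S and f = \<phi> and \<xi> = s])
      have "\<phi> holomorphic_on rhp"
        unfolding \<phi>_def using hol nz rhp_subset_chp by (intro holomorphic_intros) auto
      then show "\<phi> holomorphic_on interior S"
        by (rule holomorphic_on_subset) (use interior_subset[of S] in \<open>auto simp: S_def\<close>)
      show "continuous_on (closure S) \<phi>"
        unfolding \<phi>_def using cont nz clS
        by (intro continuous_intros) (auto intro: continuous_on_subset)
      show "bounded S" by (auto simp: S_def)
      show "s \<in> S" using s by (auto simp: S_def \<rho>_def)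
      fix z assume z: "z \<in> frontier S"
      then have zc: "z \<in> chp" using clS by (auto simp: frontier_def)
      have "open S" using open_rhp by (auto simp: S_def)
      then have "z \<notin> S" using z by (auto simp: frontier_def interior_open)
      moreover have "norm z \<le> \<rho>"
      proof -
        have "closure S \<subseteq> cball 0 \<rho>" by (intro closure_minimal) (auto simp: S_def)
        then show ?thesis using z by (auto simp: frontier_def)
      qed
      ultimately consider "Re z = 0" | "norm z = \<rho>"
        using zc by (force simp: S_def rhp_def)
      then show "norm (\<phi> z) \<le> t"
      proof cases
        case 1
        then have "norm (h z) \<le> t * 1" using bdy by simp
        also have "\<dots> \<le> t * norm (1 + of_real \<delta> * z)"
          using n1(1)[OF zc] t by (intro mult_left_mono) auto
        finally show ?thesis using nz[OF zc] by (simp add: \<phi>_def norm_divide field_simps)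
      next
        case 2
        have "B / t \<le> \<delta> * norm z - 1"
          using \<delta> unfolding 2 \<rho>_def by (simp add: field_simps max_def)
        also have "\<dots> \<le> norm (1 + of_real \<delta> * z)" by (rule n1(2)[OF zc])
        finally have "B \<le> t * norm (1 + of_real \<delta> * z)" using t by (simp add: field_simps)
        with B[OF zc] have "norm (h z) \<le> t * norm (1 + of_real \<delta> * z)" by linarith
        then show ?thesis using nz[OF zc] by (simp add: \<phi>_def norm_divide field_simps)
      qed
    qed
    then show ?thesis
      using nz[of s] s rhp_subset_chp by (auto simp: \<phi>_def norm_divide field_simps)
  qed
  have "((\<lambda>\<delta>. t * norm (1 + of_real \<delta> * s)) \<longlongrightarrow> t * norm (1 + of_real 0 * s)) (at_right 0)"
    by (intro tendsto_intros)
  then have "norm (h s) \<le> t * norm (1 + of_real 0 * s)"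
    by (rule tendsto_lowerbound) (auto simp: eventually_at_right_less * intro: eventually_mono[OF eventually_at_right_less])
  then show ?thesis by simp
qed

lemma tendsto_at_right_0_sequentially:
  fixes f :: "real \<Rightarrow> 'a::topological_space"
  assumes "(f \<longlongrightarrow> l) (at_right 0)"
  shows "(\<lambda>k. f (inverse (real (Suc k)))) \<longlonglongrightarrow> l"
proof (rule filterlim_compose[OF assms])
  show "filterlim (\<lambda>k. inverse (real (Suc k))) (at_right 0) sequentially"
    unfolding filterlim_at using LIMSEQ_inverse_real_of_nat by (auto simp: eventually_at_topological)
qed

text \<open>Integration removes the exceptional null set: the increment of G over i t is bounded by
  t everywhere on the axis, hence in the half-plane by Phragmen-Lindelof. Dividing by t and letting
  t tend to 0 recovers F.\<close>

theorem bounded_holomorphic_max_principle: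
  assumes F: "F holomorphic_on rhp" and B: "bounded (F ` rhp)"
    and bdy: "AE \<omega> in lborel. \<exists>l. ((\<lambda>\<sigma>. F (Complex \<sigma> \<omega>)) \<longlongrightarrow> l) (at_right 0) \<and> norm l \<le> 1"
    and s: "s \<in> rhp"
  shows "norm (F s) \<le> 1"
proof -
  obtain B where B: "\<And>s. s \<in> rhp \<Longrightarrow> norm (F s) \<le> B"
    using B by (auto simp: bounded_iff)
  obtain G where G: "continuous_on chp G" "\<And>s. s \<in> rhp \<Longrightarrow> (G has_field_derivative F s) (at s)"
    "\<And>a b. a \<in> chp \<Longrightarrow> b \<in> chp \<Longrightarrow> norm (G a - G b) \<le> B * norm (a - b)"
    using bounded_holomorphic_primitive[OF F B] by metis
  have B0: "0 \<le> B" using order_trans[OF norm_ge_zero B[OF s]] .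
  have Fcont: "continuous_on rhp F" using F by (rule holomorphic_on_imp_continuous_on)
  have lip: "norm (G (Complex 0 b) - G (Complex 0 a)) \<le> b - a" if ab: "a \<le> b" for a b
  proof -
    define \<sigma> where "\<sigma> k = inverse (real (Suc k))" for k
    have \<sigma>: "\<sigma> k > 0" for k by (simp add: \<sigma>_def)
    have cF: "continuous_on UNIV (\<lambda>y. F (Complex (\<sigma> k) y))" for k
      by (rule continuous_on_compose2[OF Fcont])
        (auto simp: rhp_def \<sigma> Complex_eq intro!: continuous_intros)
    have Fb: "norm (F (Complex (\<sigma> k) y)) \<le> B" for k y
      using \<sigma> by (intro B) (simp add: rhp_def)
    \<comment> \<open>With max 1 in the integrand the pointwise limit is the constant 1 almost
      everywhere, so the limiting integral is b - a and no boundary function of F has to be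
      integrated.\<close>
    have line: "norm (G (Complex (\<sigma> k) b) - G (Complex (\<sigma> k) a)) \<le>
        (\<integral>y. indicator {a..b} y * max 1 (norm (F (Complex (\<sigma> k) y))) \<partial>lborel)" for k
    proof -
      have der: "((\<lambda>y. G (Complex (\<sigma> k) y)) has_vector_derivative \<i> * F (Complex (\<sigma> k) y)) (at y within {a..b})" for y
      proof -
        have "((\<lambda>y. Complex (\<sigma> k) y) has_vector_derivative \<i>) (at y within {a..b})"
          by (auto simp: has_vector_derivative_complex_iff intro!: derivative_eq_intros)
        from field_vector_diff_chain_within[OF this, of G "F (Complex (\<sigma> k) y)"]
        show ?thesis
          using G(2)[of "Complex (\<sigma> k) y"] \<sigma>
          by (auto simp: rhp_def o_def intro: has_field_derivative_at_within)
      qed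
      have int: "integrable lborel (\<lambda>y. indicator {a..b} y *\<^sub>R (\<i> * F (Complex (\<sigma> k) y)))"
        by (rule borel_integrable_compact)
          (auto intro!: continuous_intros continuous_on_subset[OF cF])
      have "G (Complex (\<sigma> k) b) - G (Complex (\<sigma> k) a) = (\<integral>y. indicator {a..b} y *\<^sub>R (\<i> * F (Complex (\<sigma> k) y)) \<partial>lborel)"
        by (rule integral_FTC_atLeastAtMost[OF ab der, symmetric])
          (auto intro!: continuous_intros continuous_on_subset[OF cF])
      also have "norm \<dots> \<le> (\<integral>y. norm (indicator {a..b} y *\<^sub>R (\<i> * F (Complex (\<sigma> k) y))) \<partial>lborel)"
        by (rule integral_norm_bound)
      also have "\<dots> \<le> (\<integral>y. indicator {a..b} y * max 1 (norm (F (Complex (\<sigma> k) y))) \<partial>lborel)"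
      proof (rule integral_mono[OF integrable_norm[OF int]])
        have "set_integrable lborel {a..b} (\<lambda>y. max 1 (norm (F (Complex (\<sigma> k) y))))"
          unfolding set_integrable_def by (rule borel_integrable_compact) (auto intro!: continuous_intros continuous_on_subset[OF cF])
        then show "integrable lborel (\<lambda>y. indicator {a..b} y * max 1 (norm (F (Complex (\<sigma> k) y))))"
          by (simp add: set_integrable_def)
      qed (auto simp: norm_mult split: split_indicator)
      finally show ?thesis .
    qed
    have lim1: "(\<lambda>k. \<integral>y. indicator {a..b} y * max 1 (norm (F (Complex (\<sigma> k) y))) \<partial>lborel) \<longlonglongrightarrow>
        (\<integral>y. indicator {a..b} y * 1 \<partial>lborel)"
    proof (rule integral_dominated_convergence[where w = "\<lambda>y. indicator {a..b} y * max 1 B"])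
      show "(\<lambda>y. indicator {a..b} y * max 1 (norm (F (Complex (\<sigma> k) y)))) \<in> borel_measurable lborel" for k
        using borel_measurable_continuous_onI[OF cF[of k]] by measurable
      show "AE y in lborel. (\<lambda>k. indicator {a..b} y * max 1 (norm (F (Complex (\<sigma> k) y)))) \<longlonglongrightarrow> indicator {a..b} y * 1"
        using bdy
      proof eventually_elim
        case (elim y)
        then obtain l where l: "((\<lambda>\<sigma>. F (Complex \<sigma> y)) \<longlongrightarrow> l) (at_right 0)" "norm l \<le> 1" by blast
        have "(\<lambda>k. F (Complex (\<sigma> k) y)) \<longlonglongrightarrow> l"
          unfolding \<sigma>_def by (rule tendsto_at_right_0_sequentially[OF l(1)])
        then have "(\<lambda>k. indicator {a..b} y * max 1 (norm (F (Complex (\<sigma> k) y)))) \<longlonglongrightarrow> indicator {a..b} y * max 1 (norm l)"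
          by (intro tendsto_intros)
        then show ?case using l(2) by (simp add: max_absorb1)
      qed
      show "AE y in lborel. norm (indicator {a..b} y * max 1 (norm (F (Complex (\<sigma> k) y)))) \<le> indicator {a..b} y * max 1 B" for k
        using Fb[of k] by (intro AE_I2) (auto simp: max.coboundedI2 split: split_indicator)
      have "integrable lborel (indicat_real {a..b})"
        by (intro integrable_real_indicator) (auto simp: emeasure_lborel_Icc_eq)
      then show "integrable lborel (\<lambda>y. indicator {a..b} y * max 1 B)"
        by (rule integrable_mult_left)
    qed auto
    have lim2: "(\<lambda>k. norm (G (Complex (\<sigma> k) b) - G (Complex (\<sigma> k) a))) \<longlonglongrightarrow> norm (G (Complex 0 b) - G (Complex 0 a))"
    proof -
      have "(\<lambda>k. Complex (\<sigma> k) y) \<longlonglongrightarrow> Complex 0 y" for y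
        unfolding \<sigma>_def Complex_eq using LIMSEQ_inverse_real_of_nat
        by (intro tendsto_intros) (auto intro!: tendsto_eq_intros)
      then have "(\<lambda>k. G (Complex (\<sigma> k) y)) \<longlonglongrightarrow> G (Complex 0 y)" for y
        by (rule continuous_on_tendsto_compose[OF G(1)]) (simp_all add: less_imp_le[OF \<sigma>])
      then show ?thesis by (intro tendsto_intros)
    qed
    have "norm (G (Complex 0 b) - G (Complex 0 a)) \<le> (\<integral>y. indicator {a..b} y * 1 \<partial>lborel)"
      using lim2 lim1 by (rule LIMSEQ_le) (use line in auto)
    then show ?thesis using ab by simp
  qed
  \<comment> \<open>The increment is continuous on the closed half-plane, bounded by B t everywhere
    and by t on the axis, as Phragmen-Lindelof requires.\<close>
  have shift: "norm (G (s + \<i> * of_real t) - G s) \<le> t" if t: "t > 0" for t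
  proof -
    have sc: "z + \<i> * of_real t \<in> chp" "z + \<i> * of_real t \<in> rhp" if "z \<in> rhp" for z
      using that by (auto simp: rhp_def)
    have sc': "z + \<i> * of_real t \<in> chp" if "z \<in> chp" for z
      using that by auto
    show ?thesis
    proof (rule Phragmen_Lindelof_chp[where h = "\<lambda>s. G (s + \<i> * of_real t) - G s" and B = "B * t"])
      show "continuous_on chp (\<lambda>s. G (s + \<i> * of_real t) - G s)"
        using sc' by (intro continuous_intros G(1) continuous_on_compose2[OF G(1)]) auto
      have "((\<lambda>s. G (s + \<i> * of_real t) - G s) has_field_derivative F (z + \<i> * of_real t) * 1 - F z) (at z)"
        if "z \<in> rhp" for z
        by (intro DERIV_diff G(2)[OF that]
            DERIV_chain2[where f = G and g = "\<lambda>s. s + \<i> * of_real t", OF G(2)[OF sc(2)[OF that]]])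
          (auto intro!: derivative_eq_intros)
      then show "(\<lambda>s. G (s + \<i> * of_real t) - G s) holomorphic_on rhp"
        unfolding holomorphic_on_open[OF open_rhp] by blast
      show "norm (G (z + \<i> * of_real t) - G z) \<le> B * t" if "z \<in> chp" for z
        using G(3)[OF sc'[OF that] that] t by (simp add: norm_mult)
      show "norm (G (z + \<i> * of_real t) - G z) \<le> t" if "Re z = 0" for z
      proof -
        have "z = Complex 0 (Im z)" "z + \<i> * of_real t = Complex 0 (Im z + t)"
          using that by (auto simp: complex_eq_iff)
        then show ?thesis using lip[of "Im z" "Im z + t"] t by simp
      qed
    qed (use t s in auto)
  qed
  have "((\<lambda>h. (G (s + h) - G s) / h) \<longlongrightarrow> F s) (at 0)"
    using G(2)[OF s] by (simp add: DERIV_def)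
  moreover have "filterlim (\<lambda>t. \<i> * of_real t) (at 0) (at_right (0::real))"
    unfolding filterlim_at
  proof
    show "((\<lambda>t. \<i> * of_real t) \<longlongrightarrow> 0) (at_right (0::real))"
      by (auto intro!: tendsto_eq_intros)
    show "\<forall>\<^sub>F t in at_right (0::real). \<i> * of_real t \<in> UNIV \<and> \<i> * of_real t \<noteq> (0::complex)"
      by (rule eventually_mono[OF eventually_at_right_less[of "0::real"]]) auto
  qed
  ultimately have "((\<lambda>t. (G (s + \<i> * of_real t) - G s) / (\<i> * of_real t)) \<longlongrightarrow> F s) (at_right (0::real))"
    by (rule filterlim_compose)
  then have "((\<lambda>t. norm ((G (s + \<i> * of_real t) - G s) / (\<i> * of_real t))) \<longlongrightarrow> norm (F s)) (at_right (0::real))"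
    by (rule tendsto_norm)
  then show ?thesis
  proof (rule tendsto_upperbound)
    show "\<forall>\<^sub>F t in at_right (0::real). norm ((G (s + \<i> * of_real t) - G s) / (\<i> * of_real t)) \<le> 1"
      by (rule eventually_mono[OF eventually_at_right_less[of "0::real"]])
        (use shift in \<open>auto simp: norm_divide norm_mult\<close>)
  qed simp
qed

section \<open>Cauchy transforms of compact sets and boundary uniqueness\<close>

definition cauchy_transform :: "real set \<Rightarrow> complex \<Rightarrow> complex" where
  "cauchy_transform K s = (\<integral>\<omega>. indicator K \<omega> *\<^sub>R (1 / (s - \<i> * of_real \<omega>)) \<partial>lborel)"

lemma integrable_inverse_one_plus_square: "integrable lborel (\<lambda>x::real. 1 / (1 + x\<^sup>2))"
  using integrable_inverse_1_plus_square by (simp add: set_integrable_def inverse_eq_divide)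

lemma norm_minus_imag_ge: "Re s \<le> norm (s - \<i> * of_real \<omega>)"
  using complex_Re_le_cmod[of "s - \<i> * of_real \<omega>"] by simp

lemma minus_imag_neq_0: "s \<in> rhp \<Longrightarrow> s - \<i> * of_real \<omega> \<noteq> 0"
  by (auto simp: rhp_def complex_eq_iff)

context
  fixes K :: "real set"
  assumes K: "compact K"
begin

lemma integrable_indicator_compact: "integrable lborel (indicat_real K)"
  using K emeasure_compact_finite[OF K] by (intro integrable_real_indicator) (auto simp: compact_imp_closed)

lemma integrable_on_compact_bounded:
  fixes f :: "real \<Rightarrow> complex"
  assumes f: "continuous_on UNIV f" and b: "\<And>x. norm (f x) \<le> b"
  shows "integrable lborel (\<lambda>x. indicator K x *\<^sub>R f x)"
proof (rule Bochner_Integration.integrable_bound)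
  show "integrable lborel (\<lambda>x. indicat_real K x * b)"
    using integrable_indicator_compact by (rule integrable_mult_left)
  have "K \<in> sets lborel" using K by (simp add: compact_imp_closed)
  then show "(\<lambda>x. indicator K x *\<^sub>R f x) \<in> borel_measurable lborel"
    using borel_measurable_continuous_onI[OF f] by (intro borel_measurable_scaleR borel_measurable_indicator) auto
  show "AE x in lborel. norm (indicat_real K x *\<^sub>R f x) \<le> norm (indicat_real K x * b)"
    using b by (intro AE_I2) (auto intro: order_trans[OF _ abs_ge_self] split: split_indicator)
qed

lemma integrable_cauchy_kernel:
  assumes s: "s \<in> rhp"
  shows "integrable lborel (\<lambda>\<omega>. indicator K \<omega> *\<^sub>R (1 / (s - \<i> * of_real \<omega>) ^ n))"
proof (rule integrable_on_compact_bounded)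
  show "continuous_on UNIV (\<lambda>\<omega>. 1 / (s - \<i> * of_real \<omega>) ^ n)"
    using minus_imag_neq_0[OF s] by (intro continuous_intros) auto
  show "norm (1 / (s - \<i> * of_real \<omega>) ^ n) \<le> 1 / Re s ^ n" for \<omega>
    using s norm_minus_imag_ge[of s \<omega>]
    by (auto simp: norm_divide norm_power rhp_def intro!: divide_left_mono power_mono mult_pos_pos zero_less_power)
qed

text \<open>Differentiation under the integral sign: difference quotient minus candidate derivative
  has the kernel h/((s + h - i \<omega>)(s - i \<omega>)^2), which is O(h) uniformly in \<omega>
  once |h| < Re s/2.\<close>

lemma holomorphic_cauchy_transform: "cauchy_transform K holomorphic_on rhp"
  unfolding holomorphic_on_open[OF open_rhp]
proof
  fix s assume s: "s \<in> rhp"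
  let ?L = "measure lborel K"
  define x where "x = Re s"
  have x: "x > 0" using s by (simp add: x_def rhp_def)
  define D where "D = - (\<integral>\<omega>. indicator K \<omega> *\<^sub>R (1 / (s - \<i> * of_real \<omega>) ^ 2) \<partial>lborel)"
  have est: "norm ((cauchy_transform K (s + h) - cauchy_transform K s) / h - D) \<le> norm h * (2 / x ^ 3 * ?L)"
    if h: "h \<noteq> 0" "norm h < x / 2" for h
  proof -
    have sh: "Re (s + h) \<ge> x / 2"
      using h abs_Re_le_cmod[of h] by (simp add: x_def abs_if split: if_splits)
    then have shr: "s + h \<in> rhp" using x by (simp add: rhp_def)
    let ?k = "\<lambda>\<omega>. h / ((s + h - \<i> * of_real \<omega>) * (s - \<i> * of_real \<omega>)\<^sup>2)"
    have pt: "(1 / (s + h - \<i> * of_real \<omega>) - 1 / (s - \<i> * of_real \<omega>)) / h + 1 / (s - \<i> * of_real \<omega>) ^ 2 = ?k \<omega>" for \<omega>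
      using minus_imag_neq_0[OF s, of \<omega>] minus_imag_neq_0[OF shr, of \<omega>] h
      by (simp add: divide_simps power2_eq_square)
    have i: "integrable lborel (\<lambda>\<omega>. indicator K \<omega> *\<^sub>R (1 / (s + h - \<i> * of_real \<omega>)))"
      "integrable lborel (\<lambda>\<omega>. indicator K \<omega> *\<^sub>R (1 / (s - \<i> * of_real \<omega>)))"
      "integrable lborel (\<lambda>\<omega>. indicator K \<omega> *\<^sub>R (1 / (s - \<i> * of_real \<omega>) ^ 2))"
      using integrable_cauchy_kernel[OF shr, of 1] integrable_cauchy_kernel[OF s, of 1]
        integrable_cauchy_kernel[OF s, of 2] by simp_all
    have "(cauchy_transform K (s + h) - cauchy_transform K s) / h - D =
        (\<integral>\<omega>. (indicator K \<omega> *\<^sub>R (1 / (s + h - \<i> * of_real \<omega>)) - indicator K \<omega> *\<^sub>R (1 / (s - \<i> * of_real \<omega>))) / h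
          + indicator K \<omega> *\<^sub>R (1 / (s - \<i> * of_real \<omega>) ^ 2) \<partial>lborel)"
      unfolding cauchy_transform_def D_def using i by simp
    also have "\<dots> = (\<integral>\<omega>. indicator K \<omega> *\<^sub>R ?k \<omega> \<partial>lborel)"
      by (intro Bochner_Integration.integral_cong refl) (simp add: pt[symmetric] split: split_indicator)
    also have "norm \<dots> \<le> (\<integral>\<omega>. norm h * (2 / x ^ 3) * indicator K \<omega> \<partial>lborel)"
    proof (rule Bochner_Integration.integral_norm_bound_integral)
      have kb: "norm (?k \<omega>) \<le> norm h * (2 / x ^ 3)" for \<omega>
      proof -
        have "x / 2 * x\<^sup>2 \<le> norm (s + h - \<i> * of_real \<omega>) * (norm (s - \<i> * of_real \<omega>))\<^sup>2"
          using norm_minus_imag_ge[of "s + h" \<omega>] norm_minus_imag_ge[of s \<omega>] sh x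
          by (intro mult_mono power_mono) (auto simp: x_def)
        then have "norm h / (norm (s + h - \<i> * of_real \<omega>) * (norm (s - \<i> * of_real \<omega>))\<^sup>2) \<le> norm h / (x / 2 * x\<^sup>2)"
          using x by (intro frac_le) auto
        then have "norm (?k \<omega>) \<le> norm h / (x / 2 * x\<^sup>2)"
          by (simp only: norm_divide norm_mult norm_power)
        then show ?thesis
          by (simp add: power2_eq_square power3_eq_cube)
      qed
      show "integrable lborel (\<lambda>\<omega>. indicator K \<omega> *\<^sub>R ?k \<omega>)"
        by (rule integrable_on_compact_bounded[OF _ kb])
          (use minus_imag_neq_0[OF s] minus_imag_neq_0[OF shr] in \<open>auto intro!: continuous_intros\<close>)
      show "integrable lborel (\<lambda>\<omega>. norm h * (2 / x ^ 3) * indicator K \<omega>)"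
        using integrable_indicator_compact by (rule integrable_mult_right)
      show "norm (indicator K \<omega> *\<^sub>R ?k \<omega>) \<le> norm h * (2 / x ^ 3) * indicator K \<omega>" for \<omega>
        using kb[of \<omega>] by (simp split: split_indicator)
    qed
    also have "\<dots> = norm h * (2 / x ^ 3 * ?L)"
      using K x by (simp add: compact_imp_closed)
    finally show ?thesis .
  qed
  have "((\<lambda>h. (cauchy_transform K (s + h) - cauchy_transform K s) / h - D) \<longlongrightarrow> 0) (at 0)"
  proof (rule Lim_null_comparison)
    show "\<forall>\<^sub>F h in at 0. norm ((cauchy_transform K (s + h) - cauchy_transform K s) / h - D) \<le> norm h * (2 / x ^ 3 * ?L)"
      unfolding eventually_at using x est by (intro exI[of _ "x / 2"]) auto
    show "((\<lambda>h. norm h * (2 / x ^ 3 * ?L)) \<longlongrightarrow> 0) (at (0::complex))"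
      using x by (auto intro!: tendsto_eq_intros)
  qed
  then have "(cauchy_transform K has_field_derivative D) (at s)"
    unfolding DERIV_def by (simp add: LIM_zero_iff)
  then show "\<exists>D. (cauchy_transform K has_field_derivative D) (at s)" ..
qed

text \<open>The kernel is the Poisson kernel without its factor 1/\<pi>, so the real part behaves
  like \<pi> times the harmonic measure of K.\<close>

lemma Re_cauchy_transform:
  assumes s: "s \<in> rhp"
  shows "Re (cauchy_transform K s) = (\<integral>\<omega>. indicator K \<omega> * (Re s / ((Re s)\<^sup>2 + (Im s - \<omega>)\<^sup>2)) \<partial>lborel)"
    and "integrable lborel (\<lambda>\<omega>. indicator K \<omega> * (Re s / ((Re s)\<^sup>2 + (Im s - \<omega>)\<^sup>2)))"
proof -
  have int: "integrable lborel (\<lambda>\<omega>. indicator K \<omega> *\<^sub>R (1 / (s - \<i> * of_real \<omega>)))"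
    using integrable_cauchy_kernel[OF s, of 1] by simp
  have eq: "Re (indicator K \<omega> *\<^sub>R (1 / (s - \<i> * of_real \<omega>))) = indicator K \<omega> * (Re s / ((Re s)\<^sup>2 + (Im s - \<omega>)\<^sup>2))" for \<omega>
    by (simp add: Re_divide)
  show "Re (cauchy_transform K s) = (\<integral>\<omega>. indicator K \<omega> * (Re s / ((Re s)\<^sup>2 + (Im s - \<omega>)\<^sup>2)) \<partial>lborel)"
    unfolding cauchy_transform_def integral_Re[OF int, symmetric] eq ..
  show "integrable lborel (\<lambda>\<omega>. indicator K \<omega> * (Re s / ((Re s)\<^sup>2 + (Im s - \<omega>)\<^sup>2)))"
    using integrable_Re[OF int] unfolding eq .
qed

text \<open>The whole Poisson kernel has the same mass from every point, as the substitution
  \<omega> = Im s + Re s * x shows. The resulting bound is independent of s and keeps exp(n w)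
  bounded on the half-plane.\<close>

lemma Re_cauchy_transform_le:
  assumes s: "s \<in> rhp"
  shows "Re (cauchy_transform K s) \<le> (\<integral>x. 1 / (1 + x\<^sup>2) \<partial>lborel)"
proof -
  define \<sigma> y where "\<sigma> = Re s" and "y = Im s"
  have \<sigma>: "\<sigma> > 0" using s by (simp add: \<sigma>_def rhp_def)
  let ?p = "\<lambda>\<omega>. \<sigma> / (\<sigma>\<^sup>2 + (y - \<omega>)\<^sup>2)"
  have eq: "\<sigma> * ?p (y + \<sigma> * x) = 1 / (1 + x\<^sup>2)" for x
  proof -
    have "\<sigma> * ?p (y + \<sigma> * x) = \<sigma>\<^sup>2 / (\<sigma>\<^sup>2 * (1 + x\<^sup>2))"
      by (simp add: power2_eq_square algebra_simps)
    then show ?thesis using \<sigma> by simp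
  qed
  have "integrable lborel (\<lambda>x. (1 / \<sigma>) * (1 / (1 + x\<^sup>2)))"
    by (intro integrable_mult_right integrable_inverse_one_plus_square)
  also have "(\<lambda>x. (1 / \<sigma>) * (1 / (1 + x\<^sup>2))) = (\<lambda>x. ?p (y + \<sigma> * x))"
    unfolding eq[symmetric] using \<sigma> by simp
  finally have int: "integrable lborel ?p"
    using \<sigma> by (subst (asm) lborel_integrable_real_affine_iff) auto
  have "Re (cauchy_transform K s) \<le> (\<integral>\<omega>. ?p \<omega> \<partial>lborel)"
    unfolding Re_cauchy_transform[OF s] using Re_cauchy_transform(2)[OF s] int \<sigma>
    by (intro integral_mono) (auto simp: \<sigma>_def y_def split: split_indicator)
  also have "\<dots> = \<bar>\<sigma>\<bar> *\<^sub>R (\<integral>x. ?p (y + \<sigma> * x) \<partial>lborel)"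
    using \<sigma> by (intro lborel_integral_real_affine) auto
  also have "\<dots> = (\<integral>x. \<sigma> * ?p (y + \<sigma> * x) \<partial>lborel)"
    using \<sigma> by (simp only: integral_mult_right_zero real_scaleR_def abs_of_pos)
  finally show ?thesis unfolding eq .
qed

lemma Re_cauchy_transform_pos:
  assumes s: "s \<in> rhp" and pos: "measure lborel K > 0"
  shows "Re (cauchy_transform K s) > 0"
proof -
  define \<sigma> y where "\<sigma> = Re s" and "y = Im s"
  have \<sigma>: "\<sigma> > 0" using s by (simp add: \<sigma>_def rhp_def)
  obtain N where N: "\<And>\<omega>. \<omega> \<in> K \<Longrightarrow> \<bar>y - \<omega>\<bar> \<le> N"
  proof -
    obtain N where N: "\<And>\<omega>. \<omega> \<in> K \<Longrightarrow> \<bar>\<omega>\<bar> \<le> N"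
      using compact_imp_bounded[OF K] by (auto simp: bounded_iff)
    have "\<bar>y - \<omega>\<bar> \<le> \<bar>y\<bar> + N" if "\<omega> \<in> K" for \<omega>
      using N[OF that] by linarith
    then show ?thesis by (rule that)
  qed
  let ?c = "\<sigma> / (\<sigma>\<^sup>2 + N\<^sup>2)"
  have "?c > 0" using \<sigma> by (intro divide_pos_pos add_pos_nonneg) auto
  then have "0 < ?c * measure lborel K" using pos by (rule mult_pos_pos)
  also have "\<dots> = (\<integral>\<omega>. ?c * indicator K \<omega> \<partial>lborel)"
    using K by (simp add: compact_imp_closed)
  also have "\<dots> \<le> Re (cauchy_transform K s)"
    unfolding Re_cauchy_transform[OF s]
  proof (rule integral_mono)
    show "integrable lborel (\<lambda>\<omega>. ?c * indicator K \<omega>)"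
      using integrable_indicator_compact by (rule integrable_mult_right)
    show "?c * indicator K \<omega> \<le> indicator K \<omega> * (Re s / ((Re s)\<^sup>2 + (Im s - \<omega>)\<^sup>2))" for \<omega>
    proof (cases "\<omega> \<in> K")
      case True
      have "(y - \<omega>)\<^sup>2 \<le> N\<^sup>2" using N[OF True] by (metis abs_ge_zero power2_abs power_mono)
      then show ?thesis
        using True \<sigma> by (auto simp: \<sigma>_def[symmetric] y_def[symmetric] intro!: divide_left_mono mult_pos_pos add_pos_nonneg)
    qed simp
  qed (rule Re_cauchy_transform(2)[OF s])
  finally show ?thesis .
qed

text \<open>At distance at least d from K the kernel is at most \<sigma>/d^2. Hence |exp(n w)| has
  boundary value 1 off K, for every n.\<close>

lemma Re_cauchy_transform_tendsto_0:
  assumes \<omega>: "\<omega> \<notin> K"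
  shows "((\<lambda>\<sigma>. Re (cauchy_transform K (Complex \<sigma> \<omega>))) \<longlongrightarrow> 0) (at_right 0)"
proof -
  have "open (- K)" using K by (simp add: compact_imp_closed open_Compl)
  then obtain d where d: "d > 0" "ball \<omega> d \<subseteq> - K"
    using \<omega> by (meson ComplI open_contains_ball)
  let ?L = "measure lborel K"
  show ?thesis
  proof (rule Lim_null_comparison)
    show "\<forall>\<^sub>F \<sigma> in at_right 0. norm (Re (cauchy_transform K (Complex \<sigma> \<omega>))) \<le> \<sigma> / d\<^sup>2 * ?L"
    proof (rule eventually_mono[OF eventually_at_right_less[of "0::real"]])
      fix \<sigma> :: real assume \<sigma>: "0 < \<sigma>"
      have s: "Complex \<sigma> \<omega> \<in> rhp" using \<sigma> by (simp add: rhp_def)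
      have "norm (Re (cauchy_transform K (Complex \<sigma> \<omega>))) \<le> (\<integral>t. \<sigma> / d\<^sup>2 * indicator K t \<partial>lborel)"
        unfolding Re_cauchy_transform[OF s]
      proof (rule Bochner_Integration.integral_norm_bound_integral[OF Re_cauchy_transform(2)[OF s]])
        show "integrable lborel (\<lambda>t. \<sigma> / d\<^sup>2 * indicator K t)"
          using integrable_indicator_compact by (rule integrable_mult_right)
        show "norm (indicator K t * (Re (Complex \<sigma> \<omega>) / ((Re (Complex \<sigma> \<omega>))\<^sup>2 + (Im (Complex \<sigma> \<omega>) - t)\<^sup>2))) \<le> \<sigma> / d\<^sup>2 * indicator K t" for t
        proof (cases "t \<in> K")
          case True
          then have "d \<le> \<bar>\<omega> - t\<bar>" using d(2) by (force simp: dist_real_def)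
          then have "d\<^sup>2 \<le> (\<omega> - t)\<^sup>2" using d(1) by (metis less_imp_le power2_abs power_mono)
          then have "\<sigma> / (\<sigma>\<^sup>2 + (\<omega> - t)\<^sup>2) \<le> \<sigma> / d\<^sup>2"
            using \<sigma> d(1) by (intro divide_left_mono) (auto intro!: mult_pos_pos add_pos_nonneg add_increasing)
          then show ?thesis using True \<sigma> by simp
        qed simp
      qed
      then show "norm (Re (cauchy_transform K (Complex \<sigma> \<omega>))) \<le> \<sigma> / d\<^sup>2 * ?L"
        using K by (simp add: compact_imp_closed)
    qed
    show "((\<lambda>\<sigma>. \<sigma> / d\<^sup>2 * ?L) \<longlongrightarrow> 0) (at_right 0)"
      using d(1) by (auto intro!: tendsto_eq_intros)
  qed
qed

end

text \<open>If \<open>F\<close> had boundary value \<open>0\<close> on a compact set \<open>K\<close> of positive measure, then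
  \<open>F exp (n w)\<close>, where \<open>w\<close> is the Cauchy transform of \<open>K\<close>, would satisfy the maximum
  principle with a bound independent of \<open>n\<close>, while \<open>Re w > 0\<close>.\<close>

theorem boundary_uniqueness:
  assumes F: "F holomorphic_on rhp" and bd: "bounded (F ` rhp)" and s: "s \<in> rhp" "F s \<noteq> 0"
  shows "AE \<omega> in lborel. \<not> ((\<lambda>\<sigma>. F (Complex \<sigma> \<omega>)) \<longlongrightarrow> 0) (at_right 0)"
proof -
  obtain B where B: "B > 0" "\<And>s. s \<in> rhp \<Longrightarrow> norm (F s) \<le> B"
    using bd by (auto simp: bounded_pos)
  have Fcont: "continuous_on rhp F" using F by (rule holomorphic_on_imp_continuous_on)
  define \<sigma> where "\<sigma> k = inverse (real (Suc k))" for k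
  have \<sigma>: "\<sigma> k > 0" for k by (simp add: \<sigma>_def)
  have meas [measurable]: "(\<lambda>y. F (Complex (\<sigma> k) y)) \<in> borel_measurable borel" for k
  proof (rule borel_measurable_continuous_onI)
    show "continuous_on UNIV (\<lambda>y. F (Complex (\<sigma> k) y))"
      by (rule continuous_on_compose2[OF Fcont])
        (auto simp: rhp_def \<sigma> Complex_eq intro!: continuous_intros)
  qed
  \<comment> \<open>Countable quantifiers along the sequence \<open>\<sigma> k\<close> make this set
    Borel; it contains every \<omega> with radial limit 0.\<close>
  define Z where "Z = {\<omega> \<in> space borel. \<forall>j. \<exists>N. \<forall>k\<ge>N. norm (F (Complex (\<sigma> k) \<omega>)) < inverse (real (Suc j))}"
  have Zm: "Z \<in> sets borel"
    unfolding Z_def by measurable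
  have Zlim: "(\<lambda>k. F (Complex (\<sigma> k) \<omega>)) \<longlonglongrightarrow> 0 \<longleftrightarrow> \<omega> \<in> Z" for \<omega>
  proof
    assume "(\<lambda>k. F (Complex (\<sigma> k) \<omega>)) \<longlonglongrightarrow> 0"
    then show "\<omega> \<in> Z"
      unfolding Z_def LIMSEQ_iff by (auto simp del: of_nat_Suc)
  next
    assume Z: "\<omega> \<in> Z"
    show "(\<lambda>k. F (Complex (\<sigma> k) \<omega>)) \<longlonglongrightarrow> 0"
      unfolding LIMSEQ_iff
    proof (intro allI impI)
      fix r :: real assume "r > 0"
      then obtain j where "inverse (real (Suc j)) < r" using reals_Archimedean by blast
      moreover obtain N where "\<forall>k\<ge>N. norm (F (Complex (\<sigma> k) \<omega>)) < inverse (real (Suc j))"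
        using Z unfolding Z_def by blast
      ultimately show "\<exists>N. \<forall>k\<ge>N. norm (F (Complex (\<sigma> k) \<omega>) - 0) < r" by force
    qed
  qed
  have "Z \<in> null_sets lborel"
  proof (rule ccontr)
    assume "Z \<notin> null_sets lborel"
    have "\<exists>n::nat. Z \<inter> {- real n..real n} \<notin> null_sets lborel"
    proof (rule ccontr)
      assume "\<nexists>n::nat. Z \<inter> {- real n..real n} \<notin> null_sets lborel"
      then have "(\<Union>n. Z \<inter> {- real n..real n}) \<in> null_sets lborel" by (intro null_sets_UN) simp
      moreover have "(\<Union>n. Z \<inter> {- real n..real n}) = Z"
      proof -
        have "\<exists>n. \<bar>x\<bar> \<le> real n" for x :: real by (rule real_arch_simple)
        then show ?thesis by (auto simp: abs_le_iff) (metis minus_le_iff)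
      qed
      ultimately show False using \<open>Z \<notin> null_sets lborel\<close> by simp
    qed
    then obtain n :: nat where n: "Z \<inter> {- real n..real n} \<notin> null_sets lborel" by blast
    define Z' where "Z' = Z \<inter> {- real n..real n}"
    have Z'm: "Z' \<in> sets borel" using Zm by (simp add: Z'_def)
    have "emeasure lborel Z' \<le> emeasure lborel {- real n..real n}"
      by (rule emeasure_mono) (auto simp: Z'_def)
    then have fin: "emeasure lborel Z' < \<infinity>" by (auto simp: top.not_eq_extremum[symmetric] top_unique)
    have "emeasure lborel Z' \<noteq> 0" using n Z'm by (auto simp: Z'_def null_sets_def)
    then obtain m where m: "m > 0" "emeasure lborel Z' = ennreal m"
      using fin by (cases "emeasure lborel Z'") (auto simp: less_le)
    \<comment> \<open>Inner approximation with defect below the measure m of \<open>Z'\<close>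
      leaves positive measure for K.\<close>
    obtain K where K: "closed K" "K \<subseteq> Z'" "emeasure lebesgue (Z' - K) < ennreal m"
      using sets_lebesgue_inner_closed[of Z' m] Z'm m(1) by (metis sets_completionI_sets sets_lborel)
    have "bounded K" by (rule bounded_subset[of "{- real n..real n}"]) (use K(2) in \<open>auto simp: Z'_def\<close>)
    with K have cK: "compact K" by (simp add: compact_eq_bounded_closed)
    have Kpos: "measure lborel K > 0"
    proof (rule ccontr)
      assume "\<not> measure lborel K > 0"
      then have "measure lborel K = 0" using measure_nonneg[of lborel K] by linarith
      then have "emeasure lborel K = 0"
        using emeasure_compact_finite[OF cK] by (auto simp: measure_def enn2real_eq_0_iff)
      moreover have "Z' = K \<union> (Z' - K)" using K by auto
      then have "emeasure lborel Z' \<le> emeasure lborel K + emeasure lborel (Z' - K)"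
        using emeasure_subadditive[of K lborel "Z' - K"] K(1) Z'm by simp
      moreover have "emeasure lborel (Z' - K) < ennreal m"
        using K(1,3) Z'm by simp
      ultimately show False using m by simp
    qed
    let ?w = "cauchy_transform K"
    define \<kappa> :: real where "\<kappa> = (\<integral>x. 1 / (1 + x\<^sup>2) \<partial>lborel)"
    have bnd: "norm (F z / of_real B * exp (of_nat n * ?w z)) \<le> 1" if z: "z \<in> rhp" for z and n :: nat
    proof (rule bounded_holomorphic_max_principle[OF _ _ _ z])
      let ?G = "\<lambda>z. F z / of_real B * exp (of_nat n * ?w z)"
      show hol: "?G holomorphic_on rhp"
        using B(1) by (intro holomorphic_intros F holomorphic_cauchy_transform[OF cK]) auto
      have Fb: "norm (F z / of_real B) \<le> 1" if "z \<in> rhp" for z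
        using B that by (simp add: norm_divide)
      have eb: "norm (exp (of_nat n * ?w z)) \<le> exp (n * \<kappa>)" if "z \<in> rhp" for z
        using Re_cauchy_transform_le[OF cK that] by (simp add: \<kappa>_def norm_exp_eq_Re mult_left_mono)
      show bdG: "bounded (?G ` rhp)"
        unfolding bounded_iff
      proof (intro exI[of _ "1 * exp (n * \<kappa>)"] ballI)
        fix v assume "v \<in> ?G ` rhp"
        then obtain z where z: "z \<in> rhp" "v = ?G z" by blast
        show "norm v \<le> 1 * exp (n * \<kappa>)"
          unfolding z(2) norm_mult using Fb[OF z(1)] eb[OF z(1)] by (intro mult_mono) auto
      qed
      show "AE \<omega> in lborel. \<exists>l. ((\<lambda>\<sigma>. ?G (Complex \<sigma> \<omega>)) \<longlongrightarrow> l) (at_right 0) \<and> norm l \<le> 1"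
        using Fatou_radial_limits[OF F bd] Fatou_radial_limits[OF hol bdG]
      proof eventually_elim
        case (elim \<omega>)
        then obtain l l' where l: "((\<lambda>\<sigma>. F (Complex \<sigma> \<omega>)) \<longlongrightarrow> l) (at_right 0)"
          and l': "((\<lambda>\<sigma>. ?G (Complex \<sigma> \<omega>)) \<longlongrightarrow> l') (at_right 0)" by blast
        have r: "Complex \<sigma> \<omega> \<in> rhp" if "0 < \<sigma>" for \<sigma> using that by (simp add: rhp_def)
        have "norm l' \<le> 1"
        \<comment> \<open>On K the limit 0 of F absorbs the factor exp(n w), which is at most exp(n
          \<kappa>). Off K this factor has limiting modulus 1 and |F/B| \<le> 1.\<close>
        proof (cases "\<omega> \<in> K")
          case True
          then have "\<omega> \<in> Z" using K(2) by (auto simp: Z'_def)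
          then have "(\<lambda>k. F (Complex (\<sigma> k) \<omega>)) \<longlonglongrightarrow> 0" by (simp add: Zlim)
          moreover have "(\<lambda>k. F (Complex (\<sigma> k) \<omega>)) \<longlonglongrightarrow> l"
            unfolding \<sigma>_def by (rule tendsto_at_right_0_sequentially[OF l])
          ultimately have "l = 0" using LIMSEQ_unique by blast
          have "((\<lambda>\<sigma>. norm (F (Complex \<sigma> \<omega>) / of_real B) * exp (n * \<kappa>)) \<longlongrightarrow> norm (l / of_real B) * exp (n * \<kappa>)) (at_right 0)"
            using B(1) l by (intro tendsto_intros) auto
          moreover have "\<forall>\<^sub>F \<sigma> in at_right 0. norm (?G (Complex \<sigma> \<omega>)) \<le> norm (F (Complex \<sigma> \<omega>) / of_real B) * exp (n * \<kappa>)"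
            by (rule eventually_mono[OF eventually_at_right_less[of "0::real"]])
              (unfold norm_mult, intro mult_left_mono eb r, auto)
          ultimately have "norm l' \<le> norm (l / of_real B) * exp (n * \<kappa>)"
            using tendsto_norm[OF l'] by (intro tendsto_le[OF trivial_limit_at_right_real])
          then show ?thesis using \<open>l = 0\<close> by simp
        next
          case False
          have "((\<lambda>\<sigma>. exp (n * Re (?w (Complex \<sigma> \<omega>)))) \<longlongrightarrow> exp (real n * 0)) (at_right 0)"
            by (intro tendsto_intros Re_cauchy_transform_tendsto_0[OF cK False])
          moreover have "\<forall>\<^sub>F \<sigma> in at_right 0. norm (?G (Complex \<sigma> \<omega>)) \<le> exp (n * Re (?w (Complex \<sigma> \<omega>)))"
          proof (rule eventually_mono[OF eventually_at_right_less[of "0::real"]])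
            fix \<sigma> :: real assume "0 < \<sigma>"
            from Fb[OF r[OF this]] have "norm (F (Complex \<sigma> \<omega>) / of_real B) * exp (n * Re (?w (Complex \<sigma> \<omega>))) \<le> 1 * exp (n * Re (?w (Complex \<sigma> \<omega>)))"
              by (rule mult_right_mono) simp
            then show "norm (?G (Complex \<sigma> \<omega>)) \<le> exp (n * Re (?w (Complex \<sigma> \<omega>)))"
              unfolding norm_mult norm_exp_eq_Re by simp
          qed
          ultimately have "norm l' \<le> exp (real n * 0)"
            using tendsto_norm[OF l'] by (intro tendsto_le[OF trivial_limit_at_right_real])
          then show ?thesis by simp
        qed
        with l' show ?case by blast
      qed
    qed
    define r where "r = Re (?w s)"
    have r: "r > 0" unfolding r_def by (rule Re_cauchy_transform_pos[OF cK s(1) Kpos])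
    \<comment> \<open>As exp(x) > x, it is enough that n r exceeds B/|F(s)| for the value at s to
      break the bound 1.\<close>
    obtain n :: nat where n: "B / norm (F s) < real n * r"
      using reals_Archimedean3[OF r] by blast
    have "norm (F s) / B * exp (real n * r) \<le> 1"
      using bnd[OF s(1), of n] B(1) by (simp add: norm_mult norm_divide norm_exp_eq_Re r_def)
    moreover have "real n * r < exp (real n * r)"
      using exp_ge_add_one_self[of "real n * r"] by linarith
    then have "B / norm (F s) < exp (real n * r)" using n by linarith
    then have "1 < norm (F s) / B * exp (real n * r)"
      using B(1) s(2) by (simp add: field_simps)
    ultimately show False by simp
  qed
  then have "AE \<omega> in lborel. \<omega> \<notin> Z" by (rule AE_not_in)
  then show ?thesis
  proof (rule eventually_mono)
    fix \<omega> assume "\<omega> \<notin> Z"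
    then show "\<not> ((\<lambda>\<sigma>. F (Complex \<sigma> \<omega>)) \<longlongrightarrow> 0) (at_right 0)"
      using tendsto_at_right_0_sequentially[of "\<lambda>\<sigma>. F (Complex \<sigma> \<omega>)" 0] Zlim by (auto simp: \<sigma>_def)
  qed
qed

section \<open>Plancherel's theorem\<close>

lemma norm_add_power2_le: "(norm (a + b))\<^sup>2 \<le> 2 * (norm a)\<^sup>2 + 2 * (norm (b::'a::real_normed_vector))\<^sup>2"
proof -
  have "(norm (a + b))\<^sup>2 \<le> (norm a + norm b)\<^sup>2"
    by (intro power_mono norm_triangle_ineq) auto
  also have "\<dots> \<le> 2 * (norm a)\<^sup>2 + 2 * (norm b)\<^sup>2"
    using sum_squares_bound[of "norm a" "norm b"] by (simp add: power2_sum)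
  finally show ?thesis .
qed

lemma norm_diff_power2_le: "(norm (a - b))\<^sup>2 \<le> 2 * (norm a)\<^sup>2 + 2 * (norm (b::'a::real_normed_vector))\<^sup>2"
  using norm_add_power2_le[of a "- b"] by simp

lemma integrable_indicator_interval: "integrable lborel (indicat_real {a..b :: real})"
  by (intro integrable_real_indicator) (auto simp: emeasure_lborel_Icc_eq)

text \<open>First \<phi> is truncated in argument and value. The truncation is an almost everywhere
  limit of continuous functions, and once these are cut down to a common bound and support,
  dominated convergence turns this into L2 convergence. Each stage costs e/4, doubled by the squared
  triangle inequality.\<close>

lemma L2_dense_continuous:
  fixes \<phi> :: "real \<Rightarrow> complex"
  assumes \<phi> [measurable]: "\<phi> \<in> borel_measurable borel" and int: "integrable lborel (\<lambda>t. (norm (\<phi> t))\<^sup>2)"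
    and e: "e > 0"
  obtains \<psi> n where "continuous_on UNIV \<psi>" "\<And>t. norm (\<psi> t) \<le> real n * indicator {- real n - 1..real n + 1} t"
    "integrable lborel (\<lambda>t. (norm (\<phi> t - \<psi> t))\<^sup>2)" "(\<integral>t. (norm (\<phi> t - \<psi> t))\<^sup>2 \<partial>lborel) < e"
proof -
  define \<phi>n where "\<phi>n n t = (if \<bar>t\<bar> \<le> real n \<and> norm (\<phi> t) \<le> real n then \<phi> t else 0)" for n t
  have \<phi>n [measurable]: "\<phi>n n \<in> borel_measurable borel" for n
    unfolding \<phi>n_def by measurable
  have "(\<lambda>n. \<integral>t. (norm (\<phi> t - \<phi>n n t))\<^sup>2 \<partial>lborel) \<longlonglongrightarrow> (\<integral>t. 0 \<partial>(lborel :: real measure))"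
  proof (rule integral_dominated_convergence[where w = "\<lambda>t. (norm (\<phi> t))\<^sup>2"])
    show "AE t in lborel. (\<lambda>n. (norm (\<phi> t - \<phi>n n t))\<^sup>2) \<longlonglongrightarrow> 0"
    proof (rule AE_I2)
      fix t
      obtain N :: nat where N: "max \<bar>t\<bar> (norm (\<phi> t)) \<le> real N" using real_arch_simple by blast
      have "\<forall>\<^sub>F n in sequentially. 0 = (norm (\<phi> t - \<phi>n n t))\<^sup>2"
        using eventually_ge_at_top[of N]
      proof eventually_elim
        case (elim n)
        then have "real N \<le> real n" by simp
        with N show ?case by (simp add: \<phi>n_def)
      qed
      then show "(\<lambda>n. (norm (\<phi> t - \<phi>n n t))\<^sup>2) \<longlonglongrightarrow> 0"
        by (rule Lim_transform_eventually[OF tendsto_const])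
    qed
  qed (use int in \<open>auto simp: \<phi>n_def\<close>)
  then have "(\<lambda>n. \<integral>t. (norm (\<phi> t - \<phi>n n t))\<^sup>2 \<partial>lborel) \<longlonglongrightarrow> 0" by simp
  then have "\<forall>\<^sub>F n in sequentially. (\<integral>t. (norm (\<phi> t - \<phi>n n t))\<^sup>2 \<partial>lborel) < e / 4"
    using e by (intro order_tendstoD(2)[of _ 0]) auto
  then have "\<forall>\<^sub>F n in sequentially. (\<integral>t. (norm (\<phi> t - \<phi>n n t))\<^sup>2 \<partial>lborel) < e / 4 \<and> 1 \<le> n"
    using eventually_ge_at_top[of 1] by (rule eventually_conj)
  then obtain n where n: "(\<integral>t. (norm (\<phi> t - \<phi>n n t))\<^sup>2 \<partial>lborel) < e / 4" "1 \<le> n"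
    by (auto simp: eventually_sequentially)
  have int1: "integrable lborel (\<lambda>t. (norm (\<phi> t - \<phi>n n t))\<^sup>2)"
    by (rule Bochner_Integration.integrable_bound[OF int]) (auto simp: \<phi>n_def)
  have "\<phi>n n \<in> borel_measurable (lebesgue_on UNIV)"
    unfolding lebesgue_on_UNIV_eq by (rule measurable_completion) (simp add: \<phi>n)
  then have "\<phi>n n measurable_on UNIV"
    by (simp add: measurable_on_iff_borel_measurable)
  then obtain N g where N: "negligible N" and gc: "\<And>k. continuous_on UNIV (g k)"
    and glim: "\<And>t. t \<notin> N \<Longrightarrow> (\<lambda>k. g k t) \<longlonglongrightarrow> \<phi>n n t"
    unfolding measurable_on_def by auto
  have AEN: "AE t in lborel. t \<notin> N"
    using N unfolding negligible_iff_null_sets by (rule AE_not_in[THEN AE_completion_iff[THEN iffD1]])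
  \<comment> \<open>\<open>c\<close> is a plateau function equal to 1 on [-n, n], and
    \<open>cl\<close> below is the retraction onto the disc of radius n. Both leave the truncation
    \<open>\<phi>n n\<close> unchanged, so the modified functions have the same limit.\<close>
  define c where "c t = max 0 (min 1 (real n + 1 - \<bar>t\<bar>))" for t
  define cl where "cl z = (1 / max 1 (norm z / real n)) *\<^sub>R z" for z :: complex
  define \<psi> where "\<psi> k t = c t *\<^sub>R cl (g k t)" for k t
  have c01: "0 \<le> c t" "c t \<le> indicator {- real n - 1..real n + 1} t" for t
    by (auto simp: c_def split: split_indicator)
  have clb: "norm (cl z) \<le> real n" for z
  proof -
    have "norm z / max 1 (norm z / real n) \<le> real n"
      using n(2) by (simp add: max_def field_simps)
    then show ?thesis by (simp add: cl_def)
  qed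
  have \<psi>c: "continuous_on UNIV (\<psi> k)" for k
    unfolding \<psi>_def c_def cl_def using n(2) gc
    by (intro continuous_intros) (auto intro: continuous_on_subset simp: max_def split: if_splits)
  have \<psi>b: "norm (\<psi> k t) \<le> real n * indicator {- real n - 1..real n + 1} t" for k t
  proof -
    have "norm (\<psi> k t) = c t * norm (cl (g k t))" using c01 by (simp add: \<psi>_def)
    also have "\<dots> \<le> indicator {- real n - 1..real n + 1} t * real n"
      using c01 clb by (intro mult_mono) auto
    finally show ?thesis by (simp add: mult.commute)
  qed
  have [measurable]: "\<psi> k \<in> borel_measurable borel" for k
    using \<psi>c by (rule borel_measurable_continuous_onI)
  let ?w = "\<lambda>t. (2 * real n)\<^sup>2 * indicat_real {- real n - 1..real n + 1} t"
  have wint: "integrable lborel ?w"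
    using integrable_indicator_interval by (rule integrable_mult_right)
  have dom: "(norm (\<phi>n n t - \<psi> k t))\<^sup>2 \<le> ?w t" for k t
  proof -
    have "norm (\<phi>n n t) \<le> real n * indicator {- real n - 1..real n + 1} t"
      by (auto simp: \<phi>n_def split: split_indicator)
    then have "norm (\<phi>n n t - \<psi> k t) \<le> 2 * real n * indicator {- real n - 1..real n + 1} t"
      using norm_triangle_ineq4[of "\<phi>n n t" "\<psi> k t"] \<psi>b[of k t] by linarith
    then have "(norm (\<phi>n n t - \<psi> k t))\<^sup>2 \<le> (2 * real n * indicator {- real n - 1..real n + 1} t)\<^sup>2"
      by (intro power_mono) auto
    also have "\<dots> = ?w t" by (simp add: power_mult_distrib indicator_def)
    finally show ?thesis .
  qed
  have "(\<lambda>k. \<integral>t. (norm (\<phi>n n t - \<psi> k t))\<^sup>2 \<partial>lborel) \<longlonglongrightarrow> (\<integral>t. 0 \<partial>(lborel :: real measure))"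
  proof (rule integral_dominated_convergence[where w = ?w])
    show "AE t in lborel. (\<lambda>k. (norm (\<phi>n n t - \<psi> k t))\<^sup>2) \<longlonglongrightarrow> 0"
      using AEN
    proof eventually_elim
      case (elim t)
      have "isCont cl z" for z
        unfolding cl_def using n(2) by (intro continuous_intros) auto
      then have "(\<lambda>k. \<psi> k t) \<longlonglongrightarrow> c t *\<^sub>R cl (\<phi>n n t)"
        unfolding \<psi>_def using glim[OF elim] by (intro tendsto_intros isCont_tendsto_compose[of _ cl])
      also have "c t *\<^sub>R cl (\<phi>n n t) = \<phi>n n t"
        using n(2) by (auto simp: \<phi>n_def c_def cl_def max_def)
      finally have "(\<lambda>k. (norm (\<phi>n n t - \<psi> k t))\<^sup>2) \<longlonglongrightarrow> (norm (\<phi>n n t - \<phi>n n t))\<^sup>2"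
        by (intro tendsto_intros)
      then show ?case by simp
    qed
    show "AE t in lborel. norm ((norm (\<phi>n n t - \<psi> k t))\<^sup>2) \<le> ?w t" for k
      using dom by auto
  qed (use wint in auto)
  then have "\<forall>\<^sub>F k in sequentially. (\<integral>t. (norm (\<phi>n n t - \<psi> k t))\<^sup>2 \<partial>lborel) < e / 4"
    using e by (intro order_tendstoD(2)[of _ 0]) auto
  then obtain k where k: "(\<integral>t. (norm (\<phi>n n t - \<psi> k t))\<^sup>2 \<partial>lborel) < e / 4"
    by (auto simp: eventually_sequentially)
  have int2: "integrable lborel (\<lambda>t. (norm (\<phi>n n t - \<psi> k t))\<^sup>2)"
    by (rule Bochner_Integration.integrable_bound[OF wint]) (use dom in \<open>auto intro: order_trans[OF _ abs_ge_self]\<close>)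
  have le: "(norm (\<phi> t - \<psi> k t))\<^sup>2 \<le> 2 * (norm (\<phi> t - \<phi>n n t))\<^sup>2 + 2 * (norm (\<phi>n n t - \<psi> k t))\<^sup>2" for t
    using norm_add_power2_le[of "\<phi> t - \<phi>n n t" "\<phi>n n t - \<psi> k t"] by simp
  have int3: "integrable lborel (\<lambda>t. 2 * (norm (\<phi> t - \<phi>n n t))\<^sup>2 + 2 * (norm (\<phi>n n t - \<psi> k t))\<^sup>2)"
    using int1 int2 by simp
  have int4: "integrable lborel (\<lambda>t. (norm (\<phi> t - \<psi> k t))\<^sup>2)"
    by (rule Bochner_Integration.integrable_bound[OF int3]) (use le in \<open>auto intro: order_trans[OF _ abs_ge_self]\<close>)
  have "(\<integral>t. (norm (\<phi> t - \<psi> k t))\<^sup>2 \<partial>lborel) \<le>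
      (\<integral>t. 2 * (norm (\<phi> t - \<phi>n n t))\<^sup>2 + 2 * (norm (\<phi>n n t - \<psi> k t))\<^sup>2 \<partial>lborel)"
    using int4 int3 le by (rule integral_mono)
  also have "\<dots> < e"
    using int1 int2 n(1) k by simp
  finally show thesis
    by (intro that[OF \<psi>c \<psi>b int4])
qed

lemma L2_translation_continuous:
  fixes \<phi> :: "real \<Rightarrow> complex"
  assumes \<phi> [measurable]: "\<phi> \<in> borel_measurable borel" and int: "integrable lborel (\<lambda>t. (norm (\<phi> t))\<^sup>2)"
    and x: "x \<longlonglongrightarrow> 0"
  shows "(\<lambda>k. \<integral>t. (norm (\<phi> (t + x k) - \<phi> t))\<^sup>2 \<partial>lborel) \<longlonglongrightarrow> 0"
proof -
  have shift_int: "integrable lborel (\<lambda>t. f (t + a))" if "integrable lborel f" for f :: "real \<Rightarrow> real" and a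
    using lborel_integrable_real_affine[OF that, of 1 a] by (simp add: add.commute)
  have shift: "(\<integral>t. f (t + a) \<partial>lborel) = (\<integral>t. f t \<partial>lborel)" for f :: "real \<Rightarrow> real" and a
    using lborel_integral_real_affine[of 1 f a] by (simp add: add.commute)
  show ?thesis
  proof (rule tendstoI)
    fix e :: real assume e: "e > 0"
    \<comment> \<open>The squared triangle inequality, used twice, gives weights 4 + 4 + 2 = 10; the
      terms with weights 4 and 2 are approximation errors, one of them translated.\<close>
    then have "e / 10 > 0" by simp
    from L2_dense_continuous[OF \<phi> int this] obtain \<psi> n where \<psi>: "continuous_on UNIV \<psi>"
      "\<And>t. norm (\<psi> t) \<le> real n * indicator {- real n - 1..real n + 1} t"
      "integrable lborel (\<lambda>t. (norm (\<phi> t - \<psi> t))\<^sup>2)" "(\<integral>t. (norm (\<phi> t - \<psi> t))\<^sup>2 \<partial>lborel) < e / 10"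
      by blast
    have [measurable]: "\<psi> \<in> borel_measurable borel"
      using \<psi>(1) by (rule borel_measurable_continuous_onI)
    let ?w = "\<lambda>t. (2 * real n)\<^sup>2 * indicat_real {- real n - 2..real n + 2} t"
    have wint: "integrable lborel ?w"
      using integrable_indicator_interval by (rule integrable_mult_right)
    have dom: "(norm (\<psi> (t + a) - \<psi> t))\<^sup>2 \<le> ?w t" if "\<bar>a\<bar> \<le> 1" for a t
    proof -
      have "norm (\<psi> (t + a) - \<psi> t) \<le> norm (\<psi> (t + a)) + norm (\<psi> t)" by (rule norm_triangle_ineq4)
      also have "\<dots> \<le> 2 * real n * indicat_real {- real n - 2..real n + 2} t"
      proof -
        have "indicat_real {- real n - 1..real n + 1} (t + a) \<le> indicat_real {- real n - 2..real n + 2} t"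
          "indicat_real {- real n - 1..real n + 1} t \<le> indicat_real {- real n - 2..real n + 2} t"
          using that by (auto split: split_indicator)
        from this[THEN mult_left_mono, of "real n"] show ?thesis
          using \<psi>(2)[of "t + a"] \<psi>(2)[of t] by linarith
      qed
      finally have "(norm (\<psi> (t + a) - \<psi> t))\<^sup>2 \<le> (2 * real n * indicat_real {- real n - 2..real n + 2} t)\<^sup>2"
        by (intro power_mono) auto
      also have "\<dots> = ?w t" by (simp add: power_mult_distrib indicator_def)
      finally show ?thesis .
    qed
    \<comment> \<open>Clipping the shifts to [-1, 1] lets one integrable function dominate for every
      k; eventually x' = x.\<close>
    define x' where "x' k = max (- 1) (min 1 (x k))" for k
    have x': "\<bar>x' k\<bar> \<le> 1" for k by (auto simp: x'_def)
    have "x' \<longlonglongrightarrow> max (- 1) (min 1 0)"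
      unfolding x'_def by (intro tendsto_intros x)
    then have x'0: "x' \<longlonglongrightarrow> 0" by simp
    have "(\<lambda>k. \<integral>t. (norm (\<psi> (t + x' k) - \<psi> t))\<^sup>2 \<partial>lborel) \<longlonglongrightarrow> (\<integral>t. 0 \<partial>(lborel :: real measure))"
    proof (rule integral_dominated_convergence[where w = ?w])
      show "AE t in lborel. (\<lambda>k. (norm (\<psi> (t + x' k) - \<psi> t))\<^sup>2) \<longlonglongrightarrow> 0"
      proof (rule AE_I2)
        fix t
        have "isCont \<psi> t" using \<psi>(1) by (simp add: continuous_on_eq_continuous_at)
        moreover have "(\<lambda>k. t + x' k) \<longlonglongrightarrow> t + 0" by (intro tendsto_intros x'0)
        ultimately have "(\<lambda>k. \<psi> (t + x' k)) \<longlonglongrightarrow> \<psi> t"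
          using isCont_tendsto_compose[of t \<psi> "\<lambda>k. t + x' k" sequentially] by simp
        then have "(\<lambda>k. (norm (\<psi> (t + x' k) - \<psi> t))\<^sup>2) \<longlonglongrightarrow> (norm (\<psi> t - \<psi> t))\<^sup>2"
          by (intro tendsto_intros)
        then show "(\<lambda>k. (norm (\<psi> (t + x' k) - \<psi> t))\<^sup>2) \<longlonglongrightarrow> 0" by simp
      qed
    qed (use wint dom[OF x'] in auto)
    then have "\<forall>\<^sub>F k in sequentially. (\<integral>t. (norm (\<psi> (t + x' k) - \<psi> t))\<^sup>2 \<partial>lborel) < e / 10"
      using e by (intro order_tendstoD(2)[of _ 0]) auto
    moreover have "\<forall>\<^sub>F k in sequentially. \<bar>x k\<bar> < 1"
      using tendstoD[OF x, of 1] by simp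
    ultimately show "\<forall>\<^sub>F k in sequentially. dist (\<integral>t. (norm (\<phi> (t + x k) - \<phi> t))\<^sup>2 \<partial>lborel) 0 < e"
    proof eventually_elim
      case (elim k)
      let ?a = "x k"
      have a: "x' k = ?a" "\<bar>?a\<bar> \<le> 1" using elim by (auto simp: x'_def)
      have i1: "integrable lborel (\<lambda>t. (norm (\<phi> (t + ?a) - \<psi> (t + ?a)))\<^sup>2)"
        using shift_int[OF \<psi>(3)] .
      have i2: "integrable lborel (\<lambda>t. (norm (\<psi> (t + ?a) - \<psi> t))\<^sup>2)"
        by (rule Bochner_Integration.integrable_bound[OF wint])
          (use dom[OF a(2)] in \<open>auto intro: order_trans[OF _ abs_ge_self]\<close>)
      have le: "(norm (\<phi> (t + ?a) - \<phi> t))\<^sup>2 \<le> 4 * (norm (\<phi> (t + ?a) - \<psi> (t + ?a)))\<^sup>2 +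
          4 * (norm (\<psi> (t + ?a) - \<psi> t))\<^sup>2 + 2 * (norm (\<phi> t - \<psi> t))\<^sup>2" for t
        using norm_diff_power2_le[of "\<phi> (t + ?a) - \<psi> t" "\<phi> t - \<psi> t"]
          norm_add_power2_le[of "\<phi> (t + ?a) - \<psi> (t + ?a)" "\<psi> (t + ?a) - \<psi> t"] by simp
      have "(\<integral>t. (norm (\<phi> (t + ?a) - \<phi> t))\<^sup>2 \<partial>lborel) \<le> (\<integral>t. 4 * (norm (\<phi> (t + ?a) - \<psi> (t + ?a)))\<^sup>2 +
          4 * (norm (\<psi> (t + ?a) - \<psi> t))\<^sup>2 + 2 * (norm (\<phi> t - \<psi> t))\<^sup>2 \<partial>lborel)"
        using i1 i2 \<psi>(3) le by (intro integral_mono') auto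
      also have "\<dots> = 4 * (\<integral>t. (norm (\<phi> (t + ?a) - \<psi> (t + ?a)))\<^sup>2 \<partial>lborel) +
          4 * (\<integral>t. (norm (\<psi> (t + ?a) - \<psi> t))\<^sup>2 \<partial>lborel) + 2 * (\<integral>t. (norm (\<phi> t - \<psi> t))\<^sup>2 \<partial>lborel)"
        using i1 i2 \<psi>(3) by simp
      also have "(\<integral>t. (norm (\<phi> (t + ?a) - \<psi> (t + ?a)))\<^sup>2 \<partial>lborel) = (\<integral>t. (norm (\<phi> t - \<psi> t))\<^sup>2 \<partial>lborel)"
        by (rule shift)
      also have "4 * (\<integral>t. (norm (\<phi> t - \<psi> t))\<^sup>2 \<partial>lborel) + 4 * (\<integral>t. (norm (\<psi> (t + ?a) - \<psi> t))\<^sup>2 \<partial>lborel) +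
          2 * (\<integral>t. (norm (\<phi> t - \<psi> t))\<^sup>2 \<partial>lborel) < e"
        using \<psi>(4) elim(1) unfolding a(1) by linarith
      finally show ?case by simp
    qed
  qed
qed

lemma L2_correlation_continuous:
  fixes \<phi> \<psi> :: "real \<Rightarrow> complex"
  assumes \<phi> [measurable]: "\<phi> \<in> borel_measurable borel" and i\<phi>: "integrable lborel (\<lambda>t. (norm (\<phi> t))\<^sup>2)"
    and \<psi> [measurable]: "\<psi> \<in> borel_measurable borel" and i\<psi>: "integrable lborel (\<lambda>t. (norm (\<psi> t))\<^sup>2)"
    and x: "x \<longlonglongrightarrow> 0"
  shows "integrable lborel (\<lambda>t. \<phi> (t + a) * \<psi> t)"
    and "(\<integral>t. norm (\<phi> (t + a) * \<psi> t) \<partial>lborel) \<le> (\<integral>t. (norm (\<phi> t))\<^sup>2 \<partial>lborel) + (\<integral>t. (norm (\<psi> t))\<^sup>2 \<partial>lborel)"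
    and "(\<lambda>k. \<integral>t. \<phi> (t + x k) * \<psi> t \<partial>lborel) \<longlonglongrightarrow> (\<integral>t. \<phi> t * \<psi> t \<partial>lborel)"
proof -
  have shift_int: "integrable lborel (\<lambda>t. (norm (\<phi> (t + a)))\<^sup>2)" for a
    using lborel_integrable_real_affine[OF i\<phi>, of 1 a] by (simp add: add.commute)
  have shift: "(\<integral>t. (norm (\<phi> (t + a)))\<^sup>2 \<partial>lborel) = (\<integral>t. (norm (\<phi> t))\<^sup>2 \<partial>lborel)" for a
    using lborel_integral_real_affine[of 1 "\<lambda>t. (norm (\<phi> t))\<^sup>2" a] by (simp add: add.commute)
  \<comment> \<open>The weight r replaces Cauchy-Schwarz: a small factor \<phi>(t + x) - \<phi>(t)
    can be played off against a fixed \<psi>.\<close>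
  have amgm: "norm (u * v) \<le> (norm u)\<^sup>2 / r + r * (norm v)\<^sup>2" if "r > 0" for r :: real and u v :: complex
  proof -
    have "norm (u * v) = (norm u / sqrt r) * (sqrt r * norm v)"
      using that by (simp add: norm_mult)
    also have "\<dots> \<le> (norm u / sqrt r)\<^sup>2 + (sqrt r * norm v)\<^sup>2"
    proof -
      have "2 * ((norm u / sqrt r) * (sqrt r * norm v)) \<le> (norm u / sqrt r)\<^sup>2 + (sqrt r * norm v)\<^sup>2"
        using sum_squares_bound[of "norm u / sqrt r" "sqrt r * norm v"] by (simp only: mult.assoc)
      moreover have "0 \<le> (norm u / sqrt r) * (sqrt r * norm v)" using that by simp
      ultimately show ?thesis by linarith
    qed
    also have "\<dots> = (norm u)\<^sup>2 / r + r * (norm v)\<^sup>2"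
      using that by (simp add: power_divide power_mult_distrib)
    finally show ?thesis .
  qed
  have sum_int: "integrable lborel (\<lambda>t. (norm (\<phi> (t + a)))\<^sup>2 / 1 + 1 * (norm (\<psi> t))\<^sup>2)" for a
    using shift_int i\<psi> by simp
  show int: "integrable lborel (\<lambda>t. \<phi> (t + a) * \<psi> t)" for a
  proof (rule Bochner_Integration.integrable_bound[OF sum_int[of a]])
    show "AE t in lborel. norm (\<phi> (t + a) * \<psi> t) \<le> norm ((norm (\<phi> (t + a)))\<^sup>2 / 1 + 1 * (norm (\<psi> t))\<^sup>2)"
      using amgm[of 1] by (intro AE_I2) (auto intro: order_trans[OF _ abs_ge_self])
  qed simp
  have "(\<integral>t. norm (\<phi> (t + a) * \<psi> t) \<partial>lborel) \<le> (\<integral>t. (norm (\<phi> (t + a)))\<^sup>2 / 1 + 1 * (norm (\<psi> t))\<^sup>2 \<partial>lborel)"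
    using integrable_norm[OF int] sum_int by (rule integral_mono) (rule amgm, simp)
  also have "\<dots> = (\<integral>t. (norm (\<phi> (t + a)))\<^sup>2 \<partial>lborel) + (\<integral>t. (norm (\<psi> t))\<^sup>2 \<partial>lborel)"
    using shift_int i\<psi> by simp
  finally show "(\<integral>t. norm (\<phi> (t + a) * \<psi> t) \<partial>lborel) \<le> (\<integral>t. (norm (\<phi> t))\<^sup>2 \<partial>lborel) + (\<integral>t. (norm (\<psi> t))\<^sup>2 \<partial>lborel)"
    by (simp add: shift)
  show "(\<lambda>k. \<integral>t. \<phi> (t + x k) * \<psi> t \<partial>lborel) \<longlonglongrightarrow> (\<integral>t. \<phi> t * \<psi> t \<partial>lborel)"
  proof (rule tendstoI)
    fix e :: real assume e: "e > 0"
    define P where "P = (\<integral>t. (norm (\<psi> t))\<^sup>2 \<partial>lborel)"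
    have P: "P \<ge> 0" by (simp add: P_def)
    \<comment> \<open>With this r, the term r P is below e/2, and a translation error below r e/2
      leaves less than e/2 after division by r. P + 1 avoids dividing by zero.\<close>
    define r where "r = e / 2 / (P + 1)"
    have r: "r > 0" "r * P < e / 2"
    proof -
      show "r > 0" using e P by (simp add: r_def)
      have "r * P < r * (P + 1)" using \<open>r > 0\<close> by simp
      also have "r * (P + 1) = e / 2" unfolding r_def using P by (intro nonzero_eq_divide_eq[THEN iffD1]) auto
      finally show "r * P < e / 2" .
    qed
    have "\<forall>\<^sub>F k in sequentially. (\<integral>t. (norm (\<phi> (t + x k) - \<phi> t))\<^sup>2 \<partial>lborel) < r * e / 2"
      using L2_translation_continuous[OF \<phi> i\<phi> x] r e by (intro order_tendstoD(2)[of _ 0]) auto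
    then show "\<forall>\<^sub>F k in sequentially. dist (\<integral>t. \<phi> (t + x k) * \<psi> t \<partial>lborel) (\<integral>t. \<phi> t * \<psi> t \<partial>lborel) < e"
    proof eventually_elim
      case (elim k)
      let ?D = "\<lambda>t. \<phi> (t + x k) - \<phi> t"
      have iD: "integrable lborel (\<lambda>t. (norm (?D t))\<^sup>2)"
      proof (rule Bochner_Integration.integrable_bound)
        show "integrable lborel (\<lambda>t. 2 * (norm (\<phi> (t + x k)))\<^sup>2 + 2 * (norm (\<phi> t))\<^sup>2)"
          using shift_int i\<phi> by simp
        show "AE t in lborel. norm ((norm (?D t))\<^sup>2) \<le> norm (2 * (norm (\<phi> (t + x k)))\<^sup>2 + 2 * (norm (\<phi> t))\<^sup>2)"
          using norm_diff_power2_le by (intro AE_I2) (auto intro: order_trans[OF _ abs_ge_self])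
      qed simp
      have iD': "integrable lborel (\<lambda>t. (norm (?D t))\<^sup>2 / r + r * (norm (\<psi> t))\<^sup>2)"
        using iD i\<psi> by simp
      have "(\<integral>t. \<phi> (t + x k) * \<psi> t \<partial>lborel) - (\<integral>t. \<phi> t * \<psi> t \<partial>lborel) = (\<integral>t. ?D t * \<psi> t \<partial>lborel)"
        using int[of "x k"] int[of 0] by (simp add: left_diff_distrib)
      also have "norm \<dots> \<le> (\<integral>t. (norm (?D t))\<^sup>2 / r + r * (norm (\<psi> t))\<^sup>2 \<partial>lborel)"
      proof (rule Bochner_Integration.integral_norm_bound_integral[OF _ iD'])
        show "integrable lborel (\<lambda>t. ?D t * \<psi> t)"
          using int[of "x k"] int[of 0] by (simp add: left_diff_distrib)
      qed (rule amgm[OF r(1)])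
      also have "\<dots> = (\<integral>t. (norm (?D t))\<^sup>2 \<partial>lborel) / r + r * P"
        using iD i\<psi> by (simp add: P_def)
      also have "\<dots> < e / 2 + e / 2"
        using elim r by (intro add_strict_mono) (auto simp: field_simps)
      finally show ?case by (simp add: dist_norm)
    qed
  qed
qed

text \<open>Convergence is asserted after testing against \<psi>. Fubini moves the y-integral
  outside, leaving the correlation of \<phi> and \<psi> at shift x k * y. For each y it tends to its
  value at shift 0, and it is bounded by a constant, so p dominates.\<close>

lemma approximate_identity:
  fixes \<phi> \<psi> :: "real \<Rightarrow> complex" and p :: "real \<Rightarrow> real"
  assumes \<phi> [measurable]: "\<phi> \<in> borel_measurable borel" and i\<phi>: "integrable lborel (\<lambda>t. (norm (\<phi> t))\<^sup>2)"
    and \<psi> [measurable]: "\<psi> \<in> borel_measurable borel" and i\<psi>: "integrable lborel (\<lambda>t. (norm (\<psi> t))\<^sup>2)"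
    and p: "integrable lborel p" and x: "x \<longlonglongrightarrow> 0"
  shows "(\<lambda>k. \<integral>s. (\<integral>y. p y *\<^sub>R \<phi> (s + x k * y) \<partial>lborel) * \<psi> s \<partial>lborel) \<longlonglongrightarrow>
      (\<integral>y. p y \<partial>lborel) *\<^sub>R (\<integral>t. \<phi> t * \<psi> t \<partial>lborel)"
proof -
  have [measurable]: "p \<in> borel_measurable borel"
    using borel_measurable_integrable[OF p] by simp
  define C where "C = (\<integral>t. (norm (\<phi> t))\<^sup>2 \<partial>lborel) + (\<integral>t. (norm (\<psi> t))\<^sup>2 \<partial>lborel)"
  have C: "C \<ge> 0" by (simp add: C_def)
  have swap: "(\<integral>s. (\<integral>y. p y *\<^sub>R \<phi> (s + a * y) \<partial>lborel) * \<psi> s \<partial>lborel) =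
      (\<integral>y. p y *\<^sub>R (\<integral>s. \<phi> (s + a * y) * \<psi> s \<partial>lborel) \<partial>lborel)" for a
  proof -
    have "integrable (lborel \<Otimes>\<^sub>M lborel) (\<lambda>(y, s). p y *\<^sub>R (\<phi> (s + a * y) * \<psi> s))"
    proof (rule lborel_pair.Fubini_integrable)
      show "integrable lborel (\<lambda>y. \<integral>s. norm (case (y, s) of (y, s) \<Rightarrow> p y *\<^sub>R (\<phi> (s + a * y) * \<psi> s)) \<partial>lborel)"
      proof (rule Bochner_Integration.integrable_bound)
        show "integrable lborel (\<lambda>y. norm (p y) * C)"
          using p by (intro integrable_mult_left integrable_norm)
        show "AE y in lborel. norm (\<integral>s. norm (case (y, s) of (y, s) \<Rightarrow> p y *\<^sub>R (\<phi> (s + a * y) * \<psi> s)) \<partial>lborel) \<le> norm (norm (p y) * C)"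
        proof (rule AE_I2)
          fix y
          have "(\<integral>s. norm (p y *\<^sub>R (\<phi> (s + a * y) * \<psi> s)) \<partial>lborel) = \<bar>p y\<bar> * (\<integral>s. norm (\<phi> (s + a * y) * \<psi> s) \<partial>lborel)"
            by simp
          also have "\<dots> \<le> \<bar>p y\<bar> * C"
            unfolding C_def by (intro mult_left_mono L2_correlation_continuous(2)[OF \<phi> i\<phi> \<psi> i\<psi> x]) simp
          finally show "norm (\<integral>s. norm (case (y, s) of (y, s) \<Rightarrow> p y *\<^sub>R (\<phi> (s + a * y) * \<psi> s)) \<partial>lborel) \<le> norm (norm (p y) * C)"
            using C by (simp add: abs_mult integral_nonneg_AE)
        qed
      qed measurable
      show "AE y in lborel. integrable lborel (\<lambda>s. case (y, s) of (y, s) \<Rightarrow> p y *\<^sub>R (\<phi> (s + a * y) * \<psi> s))"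
        using L2_correlation_continuous(1)[OF \<phi> i\<phi> \<psi> i\<psi> x] by simp
    qed measurable
    from lborel_pair.Fubini_integral[OF this]
    show ?thesis
      by (simp add: scaleR_conv_of_real mult.assoc flip: integral_mult_left_zero)
  qed
  have "(\<lambda>k. \<integral>y. p y *\<^sub>R (\<integral>s. \<phi> (s + x k * y) * \<psi> s \<partial>lborel) \<partial>lborel) \<longlonglongrightarrow>
      (\<integral>y. p y *\<^sub>R (\<integral>t. \<phi> t * \<psi> t \<partial>lborel) \<partial>lborel)"
  proof (rule integral_dominated_convergence[where w = "\<lambda>y. norm (p y) * C"])
    show "integrable lborel (\<lambda>y. norm (p y) * C)"
      using p by (intro integrable_mult_left integrable_norm)
    show "AE y in lborel. (\<lambda>k. p y *\<^sub>R (\<integral>s. \<phi> (s + x k * y) * \<psi> s \<partial>lborel)) \<longlonglongrightarrow> p y *\<^sub>R (\<integral>t. \<phi> t * \<psi> t \<partial>lborel)"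
    proof (rule AE_I2)
      fix y
      have "(\<lambda>k. x k * y) \<longlonglongrightarrow> 0 * y" by (intro tendsto_intros x)
      then have "(\<lambda>k. x k * y) \<longlonglongrightarrow> 0" by simp
      from L2_correlation_continuous(3)[OF \<phi> i\<phi> \<psi> i\<psi> this]
      show "(\<lambda>k. p y *\<^sub>R (\<integral>s. \<phi> (s + x k * y) * \<psi> s \<partial>lborel)) \<longlonglongrightarrow> p y *\<^sub>R (\<integral>t. \<phi> t * \<psi> t \<partial>lborel)"
        by (intro tendsto_intros)
    qed
    show "AE y in lborel. norm (p y *\<^sub>R (\<integral>s. \<phi> (s + x k * y) * \<psi> s \<partial>lborel)) \<le> norm (p y) * C" for k
    proof (rule AE_I2)
      fix y
      have "norm (\<integral>s. \<phi> (s + x k * y) * \<psi> s \<partial>lborel) \<le> (\<integral>s. norm (\<phi> (s + x k * y) * \<psi> s) \<partial>lborel)"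
        by (rule integral_norm_bound)
      also have "\<dots> \<le> C"
        unfolding C_def by (rule L2_correlation_continuous(2)[OF \<phi> i\<phi> \<psi> i\<psi> x])
      finally show "norm (p y *\<^sub>R (\<integral>s. \<phi> (s + x k * y) * \<psi> s \<partial>lborel)) \<le> norm (p y) * C"
        by (simp add: mult_left_mono)
    qed
  qed measurable
  then show ?thesis
    unfolding swap using p by simp
qed

section \<open>The Fourier transform of scalar functions\<close>

lemma borel_measurable_cnj [measurable]: "cnj \<in> borel_measurable borel"
  by (intro borel_measurable_continuous_onI continuous_intros)

definition fourier :: "(real \<Rightarrow> complex) \<Rightarrow> real \<Rightarrow> complex" where
  "fourier \<phi> \<omega> = (\<integral>t. exp (- (\<i> * of_real \<omega> * of_real t)) * \<phi> t \<partial>lborel)"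

lemma norm_exp_imag [simp]: "norm (exp (- (\<i> * of_real a * of_real b))) = 1"
  by (simp add: norm_exp_eq_Re)

lemma integrable_gaussian:
  assumes "\<epsilon> > 0"
  shows "integrable lborel (\<lambda>\<omega>. exp (- ((\<epsilon> * \<omega>)\<^sup>2 / 2)) :: real)"
proof -
  have "integrable lborel (\<lambda>\<omega>. sqrt (2 * pi) * std_normal_density (0 + \<epsilon> * \<omega>))"
    using assms by (intro integrable_mult_right lborel_integrable_real_affine) auto
  then show ?thesis
    by (simp add: std_normal_density_def)
qed

text \<open>This is the characteristic function of the standard normal law, rescaled by
  \<epsilon>.\<close>

lemma fourier_gaussian:
  assumes \<epsilon>: "\<epsilon> > 0"
  shows "(\<integral>\<omega>. exp (- (\<i> * of_real \<omega> * of_real x)) * of_real (exp (- ((\<epsilon> * \<omega>)\<^sup>2 / 2))) \<partial>lborel) =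
    of_real (2 * pi / \<epsilon> * std_normal_density (x / \<epsilon>))"
proof -
  have c: "(\<integral>y. std_normal_density y *\<^sub>R iexp (t * y) \<partial>lborel) = of_real (exp (- t\<^sup>2 / 2))" for t
  proof -
    have "char std_normal_distribution t = of_real (exp (- t\<^sup>2 / 2))"
      by (simp add: char_std_normal_distribution)
    then show ?thesis
      unfolding char_def by (subst (asm) integral_density) (auto intro!: borel_measurable_continuous_onI continuous_intros)
  qed
  have "(\<integral>\<omega>. exp (- (\<i> * of_real \<omega> * of_real x)) * of_real (exp (- ((\<epsilon> * \<omega>)\<^sup>2 / 2))) \<partial>lborel) =
      \<bar>1 / \<epsilon>\<bar> *\<^sub>R (\<integral>y. exp (- (\<i> * of_real (0 + 1 / \<epsilon> * y) * of_real x)) * of_real (exp (- ((\<epsilon> * (0 + 1 / \<epsilon> * y))\<^sup>2 / 2))) \<partial>lborel)"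
    using \<epsilon> by (intro lborel_integral_real_affine) auto
  also have "(\<integral>y. exp (- (\<i> * of_real (0 + 1 / \<epsilon> * y) * of_real x)) * of_real (exp (- ((\<epsilon> * (0 + 1 / \<epsilon> * y))\<^sup>2 / 2))) \<partial>lborel) =
      (\<integral>y. of_real (sqrt (2 * pi)) * (std_normal_density y *\<^sub>R iexp (- (x / \<epsilon>) * y)) \<partial>lborel)"
    using \<epsilon> by (intro Bochner_Integration.integral_cong refl)
      (simp add: std_normal_density_def scaleR_conv_of_real mult.commute mult.left_commute)
  also have "\<dots> = of_real (sqrt (2 * pi)) * of_real (exp (- (- (x / \<epsilon>))\<^sup>2 / 2))"
    by (simp only: integral_mult_right_zero c)
  finally show ?thesis
    using \<epsilon> by (simp add: std_normal_density_def scaleR_conv_of_real real_sqrt_mult field_simps flip: of_real_mult of_real_divide)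
qed

lemma integrable_product_bounded:
  fixes a b :: "real \<Rightarrow> complex"
  assumes a: "integrable lborel a" and b: "integrable lborel b"
    and u [measurable]: "u \<in> borel_measurable (borel \<Otimes>\<^sub>M borel)" and u1: "\<And>x y. norm (u (x, y)) \<le> 1"
  shows "integrable (lborel \<Otimes>\<^sub>M lborel) (\<lambda>(x, y). a x * b y * u (x, y))"
proof -
  have [measurable]: "a \<in> borel_measurable borel" "b \<in> borel_measurable borel"
    using a b borel_measurable_integrable by fastforce+
  have le: "norm (a x * b y * u (x, y)) \<le> norm (a x) * norm (b y)" for x y
    using mult_left_mono[OF u1[of x y], of "norm (a x) * norm (b y)"] by (simp add: norm_mult)
  have ib: "integrable lborel (\<lambda>y. a x * b y * u (x, y))" for x
    by (rule Bochner_Integration.integrable_bound[OF integrable_mult_right[OF integrable_norm[OF b], of "norm (a x)"]])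
      (use le in auto)
  show ?thesis
  proof (rule lborel_pair.Fubini_integrable)
    show "integrable lborel (\<lambda>x. \<integral>y. norm (case (x, y) of (x, y) \<Rightarrow> a x * b y * u (x, y)) \<partial>lborel)"
    proof (rule Bochner_Integration.integrable_bound)
      show "integrable lborel (\<lambda>x. norm (a x) * (\<integral>y. norm (b y) \<partial>lborel))"
        using a by (intro integrable_mult_left integrable_norm)
      show "AE x in lborel. norm (\<integral>y. norm (case (x, y) of (x, y) \<Rightarrow> a x * b y * u (x, y)) \<partial>lborel)
          \<le> norm (norm (a x) * (\<integral>y. norm (b y) \<partial>lborel))"
      proof (rule AE_I2)
        fix x
        have "(\<integral>y. norm (a x * b y * u (x, y)) \<partial>lborel) \<le> (\<integral>y. norm (a x) * norm (b y) \<partial>lborel)"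
          using integrable_norm[OF ib] integrable_mult_right[OF integrable_norm[OF b]] le by (rule integral_mono)
        then show "norm (\<integral>y. norm (case (x, y) of (x, y) \<Rightarrow> a x * b y * u (x, y)) \<partial>lborel)
            \<le> norm (norm (a x) * (\<integral>y. norm (b y) \<partial>lborel))"
          by simp
      qed
    qed measurable
    show "AE x in lborel. integrable lborel (\<lambda>y. case (x, y) of (x, y) \<Rightarrow> a x * b y * u (x, y))"
      using ib by simp
  qed measurable
qed

lemma measurable_exp_imag [measurable]:
  "(\<lambda>p. exp (- (\<i> * of_real (fst p) * of_real (snd p)))) \<in> borel_measurable (borel \<Otimes>\<^sub>M (borel :: real measure))"
  unfolding borel_prod by (intro borel_measurable_continuous_onI continuous_intros)

text \<open>A Gaussian factor makes Fubini legitimate. It turns the regularised integral of |F|^2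
  into a correlation of \<phi> smoothed by an approximate identity, whose limit is known. Removing
  the factor by monotone convergence yields integrability and value together.\<close>

theorem fourier_Plancherel:
  assumes \<phi> [measurable]: "\<phi> \<in> borel_measurable borel" and i1: "integrable lborel \<phi>"
    and i2: "integrable lborel (\<lambda>t. (norm (\<phi> t))\<^sup>2)"
  shows "fourier \<phi> \<in> borel_measurable borel" (is ?m)
    and "integrable lborel (\<lambda>\<omega>. (norm (fourier \<phi> \<omega>))\<^sup>2)" (is ?i)
    and "(\<integral>\<omega>. (norm (fourier \<phi> \<omega>))\<^sup>2 \<partial>lborel) = 2 * pi * (\<integral>t. (norm (\<phi> t))\<^sup>2 \<partial>lborel)" (is ?e)
proof -
  let ?F = "fourier \<phi>"
  show m [measurable]: ?m
    unfolding fourier_def by measurable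
  define C where "C = (\<integral>t. norm (\<phi> t) \<partial>lborel)"
  have FC: "norm (?F \<omega>) \<le> C" for \<omega>
  proof -
    have "norm (?F \<omega>) \<le> (\<integral>t. norm (exp (- (\<i> * of_real \<omega> * of_real t)) * \<phi> t) \<partial>lborel)"
      unfolding fourier_def by (rule integral_norm_bound)
    then show ?thesis by (simp add: norm_mult C_def)
  qed
  have cnjF: "cnj (?F \<omega>) = (\<integral>t. exp (\<i> * of_real \<omega> * of_real t) * cnj (\<phi> t) \<partial>lborel)" for \<omega>
  proof -
    have "cnj (?F \<omega>) = (\<integral>t. cnj (exp (- (\<i> * of_real \<omega> * of_real t)) * \<phi> t) \<partial>lborel)"
      unfolding fourier_def by (rule Bochner_Integration.integral_cnj[symmetric])
    then show ?thesis by (simp only: complex_cnj_mult exp_cnj) simp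
  qed
  define e where "e k = inverse (real (Suc k))" for k
  have e: "e k > 0" for k by (simp add: e_def)
  have e0: "e \<longlonglongrightarrow> 0" unfolding e_def by (rule LIMSEQ_inverse_real_of_nat)
  define G where "G k \<omega> = exp (- ((e k * \<omega>)\<^sup>2 / 2))" for k \<omega>
  have [measurable]: "G k \<in> borel_measurable borel" for k
    unfolding G_def by measurable
  have Gi: "integrable lborel (\<lambda>\<omega>. complex_of_real (G k \<omega>))" for k
    unfolding G_def complex_of_real_integrable_eq by (rule integrable_gaussian[OF e])
  have G1: "0 \<le> G k \<omega>" for k \<omega> by (simp add: G_def)
  \<comment> \<open>The transform of \<open>G k\<close> at s - t is a normal density of width
    \<open>e k\<close>; the substitution t = s + e k * y turns it into p. Its mass is the constant 2
    \<pi> of the theorem.\<close>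
  define p where "p y = 2 * pi * std_normal_density y" for y
  have p: "integrable lborel p" "(\<integral>y. p y \<partial>lborel) = 2 * pi"
    unfolding p_def by simp_all
  have inner: "(\<integral>\<omega>. of_real (G k \<omega>) * cnj (?F \<omega>) * exp (- (\<i> * of_real \<omega> * of_real s)) \<partial>lborel) =
      (\<integral>y. p y *\<^sub>R cnj (\<phi> (s + e k * y)) \<partial>lborel)" for k s
  proof -
    have int: "integrable (lborel \<Otimes>\<^sub>M lborel) (\<lambda>(\<omega>, t). of_real (G k \<omega>) * cnj (\<phi> t) * exp (- (\<i> * of_real \<omega> * of_real (s - t))))"
    proof -
      have "integrable (lborel \<Otimes>\<^sub>M lborel) (\<lambda>(\<omega>, t). of_real (G k \<omega>) * cnj (\<phi> t) *
          (case (\<omega>, t) of (\<omega>, t) \<Rightarrow> exp (- (\<i> * of_real \<omega> * of_real (s - t)))))"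
        by (rule integrable_product_bounded[OF Gi])
          (use i1 in \<open>auto simp: borel_prod split_beta intro!: borel_measurable_continuous_onI continuous_intros\<close>)
      then show ?thesis by simp
    qed
    have "(\<integral>\<omega>. of_real (G k \<omega>) * cnj (?F \<omega>) * exp (- (\<i> * of_real \<omega> * of_real s)) \<partial>lborel) =
        (\<integral>\<omega>. (\<integral>t. of_real (G k \<omega>) * cnj (\<phi> t) * exp (- (\<i> * of_real \<omega> * of_real (s - t))) \<partial>lborel) \<partial>lborel)"
    proof (intro Bochner_Integration.integral_cong refl)
      fix \<omega>
      have "of_real (G k \<omega>) * cnj (?F \<omega>) * exp (- (\<i> * of_real \<omega> * of_real s)) =
          (\<integral>t. (of_real (G k \<omega>) * exp (- (\<i> * of_real \<omega> * of_real s))) * (exp (\<i> * of_real \<omega> * of_real t) * cnj (\<phi> t)) \<partial>lborel)"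
        unfolding integral_mult_right_zero cnjF by simp
      also have "\<dots> = (\<integral>t. of_real (G k \<omega>) * cnj (\<phi> t) * exp (- (\<i> * of_real \<omega> * of_real (s - t))) \<partial>lborel)"
      proof (intro Bochner_Integration.integral_cong refl)
        fix t
        have "exp (- (\<i> * of_real \<omega> * of_real (s - t))) = exp (- (\<i> * of_real \<omega> * of_real s)) * exp (\<i> * of_real \<omega> * of_real t)"
          by (simp add: exp_add[symmetric] algebra_simps)
        then show "(of_real (G k \<omega>) * exp (- (\<i> * of_real \<omega> * of_real s))) * (exp (\<i> * of_real \<omega> * of_real t) * cnj (\<phi> t)) =
            of_real (G k \<omega>) * cnj (\<phi> t) * exp (- (\<i> * of_real \<omega> * of_real (s - t)))"
          by (simp add: mult_ac)
      qed
      finally show "of_real (G k \<omega>) * cnj (?F \<omega>) * exp (- (\<i> * of_real \<omega> * of_real s)) = \<dots>" .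
    qed
    also have "\<dots> = (\<integral>t. (\<integral>\<omega>. of_real (G k \<omega>) * cnj (\<phi> t) * exp (- (\<i> * of_real \<omega> * of_real (s - t))) \<partial>lborel) \<partial>lborel)"
      by (rule lborel_pair.Fubini_integral[OF int, symmetric])
    also have "\<dots> = (\<integral>t. of_real (2 * pi / e k * std_normal_density ((s - t) / e k)) * cnj (\<phi> t) \<partial>lborel)"
    proof (intro Bochner_Integration.integral_cong refl)
      fix t
      have "(\<integral>\<omega>. of_real (G k \<omega>) * cnj (\<phi> t) * exp (- (\<i> * of_real \<omega> * of_real (s - t))) \<partial>lborel) =
          (\<integral>\<omega>. (exp (- (\<i> * of_real \<omega> * of_real (s - t))) * of_real (G k \<omega>)) * cnj (\<phi> t) \<partial>lborel)"
        by (simp add: mult_ac)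
      also have "\<dots> = (\<integral>\<omega>. exp (- (\<i> * of_real \<omega> * of_real (s - t))) * of_real (G k \<omega>) \<partial>lborel) * cnj (\<phi> t)"
        by (rule integral_mult_left_zero)
      finally show "(\<integral>\<omega>. of_real (G k \<omega>) * cnj (\<phi> t) * exp (- (\<i> * of_real \<omega> * of_real (s - t))) \<partial>lborel) =
          of_real (2 * pi / e k * std_normal_density ((s - t) / e k)) * cnj (\<phi> t)"
        unfolding G_def fourier_gaussian[OF e] .
    qed
    also have "\<dots> = \<bar>e k\<bar> *\<^sub>R (\<integral>y. of_real (2 * pi / e k * std_normal_density ((s - (s + e k * y)) / e k)) * cnj (\<phi> (s + e k * y)) \<partial>lborel)"
      using e[of k] by (intro lborel_integral_real_affine) auto
    also have "\<dots> = (\<integral>y. e k *\<^sub>R (of_real (2 * pi / e k * std_normal_density ((s - (s + e k * y)) / e k)) * cnj (\<phi> (s + e k * y))) \<partial>lborel)"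
      using e[of k] by (simp only: integral_scaleR_right abs_of_pos)
    also have "\<dots> = (\<integral>y. p y *\<^sub>R cnj (\<phi> (s + e k * y)) \<partial>lborel)"
      using e[of k] by (intro Bochner_Integration.integral_cong refl)
        (simp add: p_def std_normal_density_def scaleR_conv_of_real)
    finally show ?thesis .
  qed
  have outer: "(\<integral>\<omega>. of_real (G k \<omega> * (norm (?F \<omega>))\<^sup>2) \<partial>lborel) =
      (\<integral>s. (\<integral>y. p y *\<^sub>R cnj (\<phi> (s + e k * y)) \<partial>lborel) * \<phi> s \<partial>lborel)" for k
  proof -
    have "integrable lborel (\<lambda>\<omega>. of_real (G k \<omega>) * cnj (?F \<omega>))"
    proof (rule Bochner_Integration.integrable_bound[OF integrable_mult_left[OF integrable_norm[OF Gi[of k]], of C]])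
      show "AE \<omega> in lborel. norm (complex_of_real (G k \<omega>) * cnj (?F \<omega>)) \<le> norm (norm (complex_of_real (G k \<omega>)) * C)"
      proof (rule AE_I2)
        fix \<omega>
        have "norm (complex_of_real (G k \<omega>)) * norm (?F \<omega>) \<le> norm (complex_of_real (G k \<omega>)) * C"
          by (intro mult_left_mono FC) simp
        then show "norm (complex_of_real (G k \<omega>) * cnj (?F \<omega>)) \<le> norm (norm (complex_of_real (G k \<omega>)) * C)"
          using order_trans[OF norm_ge_zero FC[of \<omega>]] by (simp add: norm_mult abs_mult)
      qed
    qed simp
    from integrable_product_bounded[OF this i1 measurable_exp_imag]
    have int: "integrable (lborel \<Otimes>\<^sub>M lborel) (\<lambda>(\<omega>, s). of_real (G k \<omega>) * cnj (?F \<omega>) * \<phi> s * exp (- (\<i> * of_real \<omega> * of_real s)))"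
      by simp
    have "(\<integral>\<omega>. of_real (G k \<omega> * (norm (?F \<omega>))\<^sup>2) \<partial>lborel) =
        (\<integral>\<omega>. (\<integral>s. of_real (G k \<omega>) * cnj (?F \<omega>) * \<phi> s * exp (- (\<i> * of_real \<omega> * of_real s)) \<partial>lborel) \<partial>lborel)"
    proof (intro Bochner_Integration.integral_cong refl)
      fix \<omega>
      have "of_real (G k \<omega> * (norm (?F \<omega>))\<^sup>2) = (of_real (G k \<omega>) * cnj (?F \<omega>)) * ?F \<omega>"
        by (simp only: of_real_mult complex_norm_square mult_ac)
      also have "\<dots> = (\<integral>s. (of_real (G k \<omega>) * cnj (?F \<omega>)) * (exp (- (\<i> * of_real \<omega> * of_real s)) * \<phi> s) \<partial>lborel)"
        unfolding integral_mult_right_zero by (simp add: fourier_def)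
      finally show "of_real (G k \<omega> * (norm (?F \<omega>))\<^sup>2) = (\<integral>s. of_real (G k \<omega>) * cnj (?F \<omega>) * \<phi> s * exp (- (\<i> * of_real \<omega> * of_real s)) \<partial>lborel)"
        by (simp only: mult_ac)
    qed
    also have "\<dots> = (\<integral>s. (\<integral>\<omega>. of_real (G k \<omega>) * cnj (?F \<omega>) * \<phi> s * exp (- (\<i> * of_real \<omega> * of_real s)) \<partial>lborel) \<partial>lborel)"
      by (rule lborel_pair.Fubini_integral[OF int, symmetric])
    also have "\<dots> = (\<integral>s. (\<integral>\<omega>. of_real (G k \<omega>) * cnj (?F \<omega>) * exp (- (\<i> * of_real \<omega> * of_real s)) \<partial>lborel) * \<phi> s \<partial>lborel)"
      unfolding integral_mult_left_zero[symmetric] by (simp only: mult_ac)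
    finally show ?thesis unfolding inner .
  qed
  have "integrable lborel (\<lambda>t. (norm (cnj (\<phi> t)))\<^sup>2)" using i2 by simp
  moreover have "(\<lambda>t. cnj (\<phi> t)) \<in> borel_measurable borel" by measurable
  ultimately have "(\<lambda>k. \<integral>s. (\<integral>y. p y *\<^sub>R cnj (\<phi> (s + e k * y)) \<partial>lborel) * \<phi> s \<partial>lborel) \<longlonglongrightarrow>
      (\<integral>y. p y \<partial>lborel) *\<^sub>R (\<integral>t. cnj (\<phi> t) * \<phi> t \<partial>lborel)"
    by (intro approximate_identity \<phi> i2 p(1) e0)
  then
  have "(\<lambda>k. \<integral>\<omega>. of_real (G k \<omega> * (norm (?F \<omega>))\<^sup>2) \<partial>lborel) \<longlonglongrightarrow> (2 * pi) *\<^sub>R (\<integral>t. cnj (\<phi> t) * \<phi> t \<partial>lborel)"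
    unfolding outer p(2) .
  moreover have "(\<integral>t. cnj (\<phi> t) * \<phi> t \<partial>lborel) = of_real (\<integral>t. (norm (\<phi> t))\<^sup>2 \<partial>lborel)"
    unfolding integral_complex_of_real[symmetric] by (simp only: complex_norm_square mult.commute)
  ultimately have "(\<lambda>k. complex_of_real (\<integral>\<omega>. G k \<omega> * (norm (?F \<omega>))\<^sup>2 \<partial>lborel)) \<longlonglongrightarrow> of_real (2 * pi) * of_real (\<integral>t. (norm (\<phi> t))\<^sup>2 \<partial>lborel)"
    by (simp only: integral_complex_of_real scaleR_conv_of_real)
  then have lim: "(\<lambda>k. \<integral>\<omega>. G k \<omega> * (norm (?F \<omega>))\<^sup>2 \<partial>lborel) \<longlonglongrightarrow> 2 * pi * (\<integral>t. (norm (\<phi> t))\<^sup>2 \<partial>lborel)"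
    unfolding of_real_mult[symmetric] tendsto_of_real_iff .
  have GFi: "integrable lborel (\<lambda>\<omega>. G k \<omega> * (norm (?F \<omega>))\<^sup>2)" for k
  proof (rule Bochner_Integration.integrable_bound)
    show "integrable lborel (\<lambda>\<omega>. G k \<omega> * C\<^sup>2)"
      unfolding G_def by (intro integrable_mult_left integrable_gaussian e)
    show "AE \<omega> in lborel. norm (G k \<omega> * (norm (?F \<omega>))\<^sup>2) \<le> norm (G k \<omega> * C\<^sup>2)"
      using FC G1 by (intro AE_I2) (auto simp: abs_mult intro!: mult_left_mono power_mono)
  qed simp
  \<comment> \<open>The Gaussians widen as \<open>e k\<close> decreases, so the integrands increase
    with k. Monotone convergence can then produce integrability of the limit, which dominated
    convergence would presuppose.\<close>
  have mono: "AE \<omega> in lborel. mono (\<lambda>k. G k \<omega> * (norm (?F \<omega>))\<^sup>2)"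
  proof (intro AE_I2 monoI mult_right_mono)
    fix \<omega> and j k :: nat assume "j \<le> k"
    then have "e k \<le> e j" by (simp add: e_def le_imp_inverse_le)
    then have "(e k)\<^sup>2 * \<omega>\<^sup>2 \<le> (e j)\<^sup>2 * \<omega>\<^sup>2"
      using e[of k] by (intro mult_right_mono power_mono) auto
    then show "G j \<omega> \<le> G k \<omega>" by (simp add: G_def power_mult_distrib)
  qed simp
  have pos: "AE \<omega> in lborel. 0 \<le> G k \<omega> * (norm (?F \<omega>))\<^sup>2" for k
    using G1 by simp
  have pw: "AE \<omega> in lborel. (\<lambda>k. G k \<omega> * (norm (?F \<omega>))\<^sup>2) \<longlonglongrightarrow> (norm (?F \<omega>))\<^sup>2"
  proof (rule AE_I2)
    fix \<omega>
    have "(\<lambda>k. G k \<omega> * (norm (?F \<omega>))\<^sup>2) \<longlonglongrightarrow> exp (- ((0 * \<omega>)\<^sup>2 / 2)) * (norm (?F \<omega>))\<^sup>2"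
      unfolding G_def by (intro tendsto_intros e0) auto
    then show "(\<lambda>k. G k \<omega> * (norm (?F \<omega>))\<^sup>2) \<longlonglongrightarrow> (norm (?F \<omega>))\<^sup>2" by simp
  qed
  note mc = integral_monotone_convergence_nonneg[OF GFi mono pos pw lim]
  show ?i ?e by (rule mc; simp)+
qed

section \<open>Laplace transforms on vertical lines\<close>

lemma borel_measurable_scalar_mult [measurable]:
  fixes f :: "'a \<Rightarrow> complex" and g :: "'a \<Rightarrow> complex^'m::finite"
  assumes f: "f \<in> borel_measurable M" and g: "g \<in> borel_measurable M"
  shows "(\<lambda>t. f t *s g t) \<in> borel_measurable M"
proof -
  have "continuous_on UNIV (\<lambda>p :: complex \<times> (complex^'m). fst p *s snd p)"
    unfolding vector_scalar_mult_def by (intro continuous_intros)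
  from borel_measurable_continuous_on[OF this borel_measurable_Pair[OF f g]]
  show ?thesis by simp
qed

lemma borel_measurable_vec_nth [measurable (raw)]:
  fixes f :: "'a \<Rightarrow> 'b::euclidean_space^'n::finite"
  assumes "f \<in> borel_measurable M"
  shows "(\<lambda>x. f x $ i) \<in> borel_measurable M"
  by (rule borel_measurable_continuous_on[OF _ assms, of "\<lambda>x. x $ i"]) (intro continuous_intros)

lemma norm_vec_power2: "(norm (x :: complex^'m::finite))\<^sup>2 = (\<Sum>i\<in>UNIV. (norm (x $ i))\<^sup>2)"
  by (simp add: norm_vec_def L2_set_def sum_nonneg)

lemma lebesgue_ex_borel_vec:
  fixes f :: "real \<Rightarrow> 'a::euclidean_space"
  assumes "f \<in> borel_measurable lebesgue"
  obtains g where "g \<in> borel_measurable borel" "AE x in lborel. f x = g x"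
proof -
  have "\<exists>g\<in>borel_measurable lborel. AE x in lborel. f x \<bullet> b = g x" for b
    using assms by (intro completion_ex_borel_measurable_real) simp
  then obtain g where g: "\<And>b. g b \<in> borel_measurable lborel" "\<And>b. AE x in lborel. f x \<bullet> b = g b x"
    by metis
  have "AE x in lborel. \<forall>b\<in>Basis. f x \<bullet> b = g b x"
    using g(2) by (intro AE_finite_allI) auto
  then have "AE x in lborel. f x = (\<Sum>b\<in>Basis. g b x *\<^sub>R b)"
  proof eventually_elim
    case (elim x)
    then have "(\<Sum>b\<in>Basis. g b x *\<^sub>R b) = (\<Sum>b\<in>Basis. (f x \<bullet> b) *\<^sub>R b)"
      by (intro sum.cong) auto
    then show ?case by (simp add: euclidean_representation)
  qed
  moreover have "(\<lambda>x. \<Sum>b\<in>Basis. g b x *\<^sub>R b) \<in> borel_measurable borel"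
    using g(1) by (intro borel_measurable_sum borel_measurable_scaleR) auto
  ultimately show thesis by (rule that[rotated])
qed

text \<open>An element of \<open>L2\<close> is a class of Lebesgue measurable functions on the
  half-line. A Borel representative extended by zero to the line makes the Fubini and Fourier
  results over \<open>lborel\<close> applicable.\<close>

lemma L2_representative:
  fixes u :: "'m::finite L2"
  obtains \<phi> :: "real \<Rightarrow> complex^'m" where "\<phi> \<in> borel_measurable borel" "integrable lborel (\<lambda>t. (norm (\<phi> t))\<^sup>2)"
    "\<And>t. t < 0 \<Longrightarrow> \<phi> t = 0" "(norm u)\<^sup>2 = (\<integral>t. (norm (\<phi> t))\<^sup>2 \<partial>lborel)"
    "\<And>s. s \<in> rhp \<Longrightarrow> laplace u s = (\<integral>t. exp (- (s * of_real t)) *s \<phi> t \<partial>lborel)"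
proof -
  have "\<exists>f. L2_rel f f \<and> u = abs_L2 f"
    by (induct u rule: L2.abs_induct) blast
  then obtain f where rel: "L2_rel f f" and u: "u = abs_L2 f" by blast
  from rel have f: "f \<in> borel_measurable halfline" "integrable halfline (\<lambda>t. (norm (f t))\<^sup>2)"
    by (auto simp: L2_rel_def square_integrable_def)
  define f0 where "f0 t = (if t \<in> {0..} then f t else 0)" for t
  have f0: "f0 \<in> borel_measurable lebesgue"
    unfolding f0_def using f(1) by (intro borel_measurable_if_I) (auto simp: halfline_def)
  obtain g where g: "g \<in> borel_measurable borel" "AE t in lborel. f0 t = g t"
    using lebesgue_ex_borel_vec[OF f0] by blast
  define \<phi> where "\<phi> t = indicat_real {0..} t *\<^sub>R g t" for t
  have \<phi> [measurable]: "\<phi> \<in> borel_measurable borel"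
    using g(1) unfolding \<phi>_def by measurable
  have "AE t in lborel. f0 t = \<phi> t"
    using g(2) by eventually_elim (auto simp: \<phi>_def f0_def split: split_indicator)
  then have ae: "AE t in lebesgue. f0 t = \<phi> t"
    by (simp add: AE_completion_iff)
  \<comment> \<open>One change of integral for both uses: the squared norm and the exponential
    kernel of the Laplace transform.\<close>
  have transfer: "(\<integral>t. H t (f t) \<partial>halfline) = (\<integral>t. H t (\<phi> t) \<partial>lborel)"
    if H0: "\<And>t. H t 0 = 0" and H1: "(\<lambda>t. H t (f0 t)) \<in> borel_measurable lebesgue"
      and H2: "(\<lambda>t. H t (\<phi> t)) \<in> borel_measurable borel" for H :: "real \<Rightarrow> complex^'m \<Rightarrow> 'b::euclidean_space"
  proof -
    have "(\<integral>t. H t (f t) \<partial>halfline) = (\<integral>t. indicat_real {0..} t *\<^sub>R H t (f t) \<partial>lebesgue)"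
      unfolding halfline_def by (intro integral_restrict_space) simp
    also have "\<dots> = (\<integral>t. H t (f0 t) \<partial>lebesgue)"
      by (intro Bochner_Integration.integral_cong refl) (auto simp: f0_def H0 split: split_indicator)
    also have "\<dots> = (\<integral>t. H t (\<phi> t) \<partial>lebesgue)"
    proof (rule integral_cong_AE[OF H1])
      show "(\<lambda>t. H t (\<phi> t)) \<in> borel_measurable lebesgue"
        using H2 by (intro measurable_completion) simp
      show "AE t in lebesgue. H t (f0 t) = H t (\<phi> t)"
        using ae by eventually_elim simp
    qed
    also have "\<dots> = (\<integral>t. H t (\<phi> t) \<partial>lborel)"
      using H2 by (intro integral_completion) simp
    finally show ?thesis .
  qed
  show thesis
  proof (rule that)
    show "\<phi> \<in> borel_measurable borel" by fact
    show "\<phi> t = 0" if "t < 0" for t using that by (simp add: \<phi>_def)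
    have "integrable lebesgue (\<lambda>t. indicat_real {0..} t *\<^sub>R (norm (f t))\<^sup>2)"
      using f(2) unfolding halfline_def by (subst (asm) integrable_restrict_space) auto
    also have "(\<lambda>t. indicat_real {0..} t *\<^sub>R (norm (f t))\<^sup>2) = (\<lambda>t. (norm (f0 t))\<^sup>2)"
      by (auto simp: f0_def split: split_indicator)
    finally have "integrable lebesgue (\<lambda>t. (norm (\<phi> t))\<^sup>2)"
    proof (rule integrable_cong_AE_imp)
      show "(\<lambda>t. (norm (\<phi> t))\<^sup>2) \<in> borel_measurable lebesgue"
        by (intro measurable_completion) simp
      show "AE t in lebesgue. (norm (f0 t))\<^sup>2 = (norm (\<phi> t))\<^sup>2"
        using ae by eventually_elim simp
    qed
    then show "integrable lborel (\<lambda>t. (norm (\<phi> t))\<^sup>2)"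
      by (subst (asm) integrable_completion) auto
    have "(norm u)\<^sup>2 = abs_L2 f \<bullet> abs_L2 f"
      unfolding u by (rule power2_norm_eq_inner)
    also have "\<dots> = (\<integral>t. (norm (f t))\<^sup>2 \<partial>halfline)"
      using inner_L2.abs_eq[OF rel rel] by (simp add: power2_norm_eq_inner)
    also have "\<dots> = (\<integral>t. (norm (\<phi> t))\<^sup>2 \<partial>lborel)"
      by (rule transfer) (use f0 in auto)
    finally show "(norm u)\<^sup>2 = (\<integral>t. (norm (\<phi> t))\<^sup>2 \<partial>lborel)" .
    show "laplace u s = (\<integral>t. exp (- (s * of_real t)) *s \<phi> t \<partial>lborel)" if s: "s \<in> rhp" for s
    proof -
      have e: "(\<lambda>t. exp (- (s * of_real t))) \<in> borel_measurable borel"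
        by (intro borel_measurable_continuous_onI continuous_intros)
      have "laplace u s = (\<integral>t. exp (- (s * of_real t)) *s f t \<partial>halfline)"
        using s by (simp add: u laplace.abs_eq[OF rel])
      also have "\<dots> = (\<integral>t. exp (- (s * of_real t)) *s \<phi> t \<partial>lborel)"
      proof (rule transfer)
        have "(\<lambda>t. exp (- (s * of_real t))) \<in> borel_measurable lebesgue"
          using e by (intro measurable_completion) simp
        then show "(\<lambda>t. exp (- (s * of_real t)) *s f0 t) \<in> borel_measurable lebesgue"
          using f0 by (rule borel_measurable_scalar_mult)
        show "(\<lambda>t. exp (- (s * of_real t)) *s \<phi> t) \<in> borel_measurable borel"
          using e by measurable
      qed simp
      finally show ?thesis .
    qed
  qed
qed

definition vfourier :: "(real \<Rightarrow> complex^'m::finite) \<Rightarrow> real \<Rightarrow> complex^'m" where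
  "vfourier \<phi> \<omega> = (\<integral>t. exp (- (\<i> * of_real \<omega> * of_real t)) *s \<phi> t \<partial>lborel)"

lemma integrable_exp_imag_scale:
  assumes "integrable lborel \<phi>"
  shows "integrable lborel (\<lambda>t. exp (- (\<i> * of_real \<omega> * of_real t)) *s (\<phi> t :: complex^'m::finite))"
proof (rule Bochner_Integration.integrable_bound[OF assms])
  have [measurable]: "\<phi> \<in> borel_measurable borel"
    using borel_measurable_integrable[OF assms] by simp
  have "(\<lambda>t. exp (- (\<i> * of_real \<omega> * of_real t))) \<in> borel_measurable borel"
    by (intro borel_measurable_continuous_onI continuous_intros)
  then show "(\<lambda>t. exp (- (\<i> * of_real \<omega> * of_real t)) *s \<phi> t) \<in> borel_measurable lborel"
    by measurable
qed (simp add: norm_vector_scalar_mult)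

lemma vfourier_nth:
  assumes "integrable lborel \<phi>"
  shows "vfourier \<phi> \<omega> $ i = fourier (\<lambda>t. \<phi> t $ i) \<omega>"
  unfolding vfourier_def fourier_def
  by (subst integral_bounded_linear[OF bounded_linear_vec_nth integrable_exp_imag_scale[OF assms], symmetric]) simp

lemma vfourier_diff:
  assumes "integrable lborel \<phi>" "integrable lborel \<psi>"
  shows "vfourier \<phi> \<omega> - vfourier \<psi> \<omega> = vfourier (\<lambda>t. \<phi> t - \<psi> t) \<omega>"
  unfolding vfourier_def
  by (subst Bochner_Integration.integral_diff[symmetric])
    (auto intro: integrable_exp_imag_scale assms simp: vector_ssub_ldistrib)

lemma vfourier_Plancherel:
  fixes \<phi> :: "real \<Rightarrow> complex^'m::finite"
  assumes i1: "integrable lborel \<phi>" and i2: "integrable lborel (\<lambda>t. (norm (\<phi> t))\<^sup>2)"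
  shows "vfourier \<phi> \<in> borel_measurable borel"
    and "integrable lborel (\<lambda>\<omega>. (norm (vfourier \<phi> \<omega>))\<^sup>2)"
    and "(\<integral>\<omega>. (norm (vfourier \<phi> \<omega>))\<^sup>2 \<partial>lborel) = 2 * pi * (\<integral>t. (norm (\<phi> t))\<^sup>2 \<partial>lborel)"
proof -
  have [measurable]: "\<phi> \<in> borel_measurable borel"
    using borel_measurable_integrable[OF i1] by simp
  have m: "(\<lambda>t. \<phi> t $ i) \<in> borel_measurable borel" for i
    by measurable
  have j1: "integrable lborel (\<lambda>t. \<phi> t $ i)" for i
    using i1 by (rule integrable_bounded_linear[OF bounded_linear_vec_nth])
  have j2: "integrable lborel (\<lambda>t. (norm (\<phi> t $ i))\<^sup>2)" for i
    by (rule Bochner_Integration.integrable_bound[OF i2])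
      (auto intro!: power_mono component_le_norm_cart simp: Finite_Cartesian_Product.norm_nth_le)
  note P = fourier_Plancherel[OF m j1 j2]
  have sq: "(norm (vfourier \<phi> \<omega>))\<^sup>2 = (\<Sum>i\<in>UNIV. (norm (fourier (\<lambda>t. \<phi> t $ i) \<omega>))\<^sup>2)" for \<omega>
    by (simp add: norm_vec_power2 vfourier_nth[OF i1])
  show "vfourier \<phi> \<in> borel_measurable borel"
  proof (rule borel_measurable_euclidean_space[THEN iffD2], clarsimp simp: Basis_vec_def)
    fix i and b :: complex
    have "(\<lambda>\<omega>. vfourier \<phi> \<omega> \<bullet> axis i b) = (\<lambda>\<omega>. fourier (\<lambda>t. \<phi> t $ i) \<omega> \<bullet> b)"
      by (simp add: inner_axis vfourier_nth[OF i1])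
    then show "(\<lambda>\<omega>. vfourier \<phi> \<omega> \<bullet> axis i b) \<in> borel_measurable borel"
      using P(1)[of i] by simp
  qed
  show "integrable lborel (\<lambda>\<omega>. (norm (vfourier \<phi> \<omega>))\<^sup>2)"
    unfolding sq using P(2) by (intro Bochner_Integration.integrable_sum)
  have "(\<integral>\<omega>. (norm (vfourier \<phi> \<omega>))\<^sup>2 \<partial>lborel) = (\<Sum>i\<in>UNIV. 2 * pi * (\<integral>t. (norm (\<phi> t $ i))\<^sup>2 \<partial>lborel))"
    unfolding sq by (subst Bochner_Integration.integral_sum[OF P(2)]) (simp add: P(3))
  also have "\<dots> = 2 * pi * (\<integral>t. (norm (\<phi> t))\<^sup>2 \<partial>lborel)"
  proof -
    have "(\<integral>t. (norm (\<phi> t))\<^sup>2 \<partial>lborel) = (\<integral>t. (\<Sum>i\<in>UNIV. (norm (\<phi> t $ i))\<^sup>2) \<partial>lborel)"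
      by (intro Bochner_Integration.integral_cong refl norm_vec_power2)
    also have "\<dots> = (\<Sum>i\<in>UNIV. \<integral>t. (norm (\<phi> t $ i))\<^sup>2 \<partial>lborel)"
      using j2 by (rule Bochner_Integration.integral_sum)
    finally show ?thesis by (simp add: sum_distrib_left)
  qed
  finally show "(\<integral>\<omega>. (norm (vfourier \<phi> \<omega>))\<^sup>2 \<partial>lborel) = 2 * pi * (\<integral>t. (norm (\<phi> t))\<^sup>2 \<partial>lborel)" .
qed

lemma integrable_exp_halfline:
  assumes "a > 0"
  shows "integrable lborel (\<lambda>t. indicat_real {0..} t * exp (- a * t))"
proof -
  have "(\<lambda>x. exp (- a * x)) integrable_on {0..}"
    using has_integral_exp_minus_to_infinity[OF assms, of 0] by blast
  then have "(\<lambda>x. exp (- a * x)) absolutely_integrable_on {0..}"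
    by (rule nonnegative_absolutely_integrable_1) simp
  then have "integrable lebesgue (\<lambda>t. indicat_real {0..} t * exp (- a * t))"
    by (simp add: set_integrable_def)
  then show ?thesis
    by (subst (asm) integrable_completion) auto
qed

text \<open>The axis is approached along this one sequence of lines, so that boundary functions are
  countable limits and dominated convergence applies.\<close>

definition sig :: "nat \<Rightarrow> real" where "sig k = inverse (real (Suc k))"

lemma sig_pos: "sig k > 0" by (simp add: sig_def)

lemma sig_tendsto: "sig \<longlonglongrightarrow> 0"
  unfolding sig_def by (rule LIMSEQ_inverse_real_of_nat)

lemma sig_antimono: "j \<le> k \<Longrightarrow> sig k \<le> sig j"
  by (simp add: sig_def le_imp_inverse_le)

text \<open>On Re s = \<open>sig k\<close> the Laplace transform is the Fourier transform of exp(-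
  sig k * t) \<phi>(t), which is both L1 and L2. Plancherel then turns all claims into dominated
  convergence in t.\<close>

lemma laplace_lines:
  fixes u :: "'m::finite L2"
  shows laplace_line_measurable: "(\<lambda>\<omega>. laplace u (Complex (sig k) \<omega>)) \<in> borel_measurable borel"
    and laplace_line_integrable: "integrable lborel (\<lambda>\<omega>. (norm (laplace u (Complex (sig k) \<omega>)))\<^sup>2)"
    and laplace_line_tendsto:
      "(\<lambda>k. \<integral>\<omega>. (norm (laplace u (Complex (sig k) \<omega>)))\<^sup>2 \<partial>lborel) \<longlonglongrightarrow> 2 * pi * (norm u)\<^sup>2"
    and laplace_line_diff_integrable:
      "integrable lborel (\<lambda>\<omega>. (norm (laplace u (Complex (sig k) \<omega>) - laplace u (Complex (sig j) \<omega>)))\<^sup>2)"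
    and laplace_line_Cauchy:
      "\<exists>d. d \<longlonglongrightarrow> 0 \<and> (\<forall>j k. j \<le> k \<longrightarrow> (\<integral>\<omega>. (norm (laplace u (Complex (sig k) \<omega>) - laplace u (Complex (sig j) \<omega>)))\<^sup>2 \<partial>lborel) \<le> d j)"
proof -
  obtain \<phi> :: "real \<Rightarrow> complex^'m" where \<phi> [measurable]: "\<phi> \<in> borel_measurable borel"
    and i2: "integrable lborel (\<lambda>t. (norm (\<phi> t))\<^sup>2)" and neg: "\<And>t. t < 0 \<Longrightarrow> \<phi> t = 0"
    and nu: "(norm u)\<^sup>2 = (\<integral>t. (norm (\<phi> t))\<^sup>2 \<partial>lborel)"
    and lap: "\<And>s. s \<in> rhp \<Longrightarrow> laplace u s = (\<integral>t. exp (- (s * of_real t)) *s \<phi> t \<partial>lborel)"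
    using L2_representative[of u] by blast
  define \<psi> where "\<psi> k t = exp (- sig k * t) *\<^sub>R \<phi> t" for k t
  have [measurable]: "\<psi> k \<in> borel_measurable borel" for k
    unfolding \<psi>_def by measurable
  have \<psi>2: "(norm (\<psi> k t))\<^sup>2 \<le> (norm (\<phi> t))\<^sup>2" for k t
  proof (cases "t < 0")
    case False
    then have "exp (- sig k * t) * norm (\<phi> t) \<le> 1 * norm (\<phi> t)"
      using sig_pos[of k] by (intro mult_right_mono) auto
    then show ?thesis by (intro power_mono) (auto simp: \<psi>_def)
  qed (simp add: \<psi>_def neg)
  have j2: "integrable lborel (\<lambda>t. (norm (\<psi> k t))\<^sup>2)" for k
    by (rule Bochner_Integration.integrable_bound[OF i2]) (use \<psi>2 in auto)
  \<comment> \<open>The damping factor is square-integrable on t \<ge> 0, and a product of two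
    square-integrable functions is integrable, here by 2 a b \<le> a^2 + b^2.\<close>
  have j1: "integrable lborel (\<psi> k)" for k
  proof (rule Bochner_Integration.integrable_bound)
    show "integrable lborel (\<lambda>t. indicat_real {0..} t * exp (- (2 * sig k) * t) + (norm (\<phi> t))\<^sup>2)"
      using integrable_exp_halfline[of "2 * sig k"] sig_pos[of k] i2 by (intro Bochner_Integration.integrable_add) auto
    show "AE t in lborel. norm (\<psi> k t) \<le> norm (indicat_real {0..} t * exp (- (2 * sig k) * t) + (norm (\<phi> t))\<^sup>2)"
    proof (rule AE_I2)
      fix t
      have "norm (\<psi> k t) \<le> indicat_real {0..} t * exp (- (2 * sig k) * t) + (norm (\<phi> t))\<^sup>2"
      proof (cases "t < 0")
        case False
        have "2 * exp (- sig k * t) * norm (\<phi> t) \<le> (exp (- sig k * t))\<^sup>2 + (norm (\<phi> t))\<^sup>2"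
          by (rule sum_squares_bound)
        also have "(exp (- sig k * t))\<^sup>2 = exp (- (2 * sig k) * t)"
          by (simp add: exp_double[symmetric] mult.assoc)
        finally have "2 * norm (\<psi> k t) \<le> exp (- (2 * sig k) * t) + (norm (\<phi> t))\<^sup>2"
          by (simp add: \<psi>_def)
        then have "norm (\<psi> k t) \<le> exp (- (2 * sig k) * t) + (norm (\<phi> t))\<^sup>2"
          using norm_ge_zero[of "\<psi> k t"] by linarith
        then show ?thesis using False by simp
      qed (simp add: \<psi>_def neg)
      then show "norm (\<psi> k t) \<le> norm (indicat_real {0..} t * exp (- (2 * sig k) * t) + (norm (\<phi> t))\<^sup>2)"
        by (simp add: abs_of_nonneg)
    qed
  qed measurable
  have line: "laplace u (Complex (sig k) \<omega>) = vfourier (\<psi> k) \<omega>" for k \<omega>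
  proof -
    have "Complex (sig k) \<omega> \<in> rhp" by (simp add: rhp_def sig_pos)
    then have "laplace u (Complex (sig k) \<omega>) = (\<integral>t. exp (- (Complex (sig k) \<omega> * of_real t)) *s \<phi> t \<partial>lborel)"
      by (rule lap)
    also have "\<dots> = vfourier (\<psi> k) \<omega>"
      unfolding vfourier_def
    proof (intro Bochner_Integration.integral_cong refl)
      fix t
      have "exp (- (Complex (sig k) \<omega> * of_real t)) = exp (- (\<i> * of_real \<omega> * of_real t)) * of_real (exp (- sig k * t))"
        unfolding exp_of_real[symmetric] exp_add[symmetric] by (simp add: Complex_eq algebra_simps)
      then show "exp (- (Complex (sig k) \<omega> * of_real t)) *s \<phi> t = exp (- (\<i> * of_real \<omega> * of_real t)) *s \<psi> k t"
        by (simp add: \<psi>_def vec_scaleR_conv_scalar_mult vector_smult_assoc)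
    qed
    finally show ?thesis .
  qed
  show "(\<lambda>\<omega>. laplace u (Complex (sig k) \<omega>)) \<in> borel_measurable borel"
    unfolding line by (rule vfourier_Plancherel(1)[OF j1 j2])
  show "integrable lborel (\<lambda>\<omega>. (norm (laplace u (Complex (sig k) \<omega>)))\<^sup>2)"
    unfolding line by (rule vfourier_Plancherel(2)[OF j1 j2])
  have pt: "(\<lambda>k. \<psi> k t) \<longlonglongrightarrow> \<phi> t" for t
  proof -
    have "(\<lambda>k. exp (- sig k * t) *\<^sub>R \<phi> t) \<longlonglongrightarrow> exp (- 0 * t) *\<^sub>R \<phi> t"
      by (intro tendsto_intros sig_tendsto)
    then show ?thesis by (simp add: \<psi>_def)
  qed
  have "(\<lambda>k. \<integral>t. (norm (\<psi> k t))\<^sup>2 \<partial>lborel) \<longlonglongrightarrow> (\<integral>t. (norm (\<phi> t))\<^sup>2 \<partial>lborel)"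
    by (rule integral_dominated_convergence[where w = "\<lambda>t. (norm (\<phi> t))\<^sup>2"])
      (use i2 \<psi>2 in \<open>auto intro!: tendsto_intros pt\<close>)
  then show "(\<lambda>k. \<integral>\<omega>. (norm (laplace u (Complex (sig k) \<omega>)))\<^sup>2 \<partial>lborel) \<longlonglongrightarrow> 2 * pi * (norm u)\<^sup>2"
    unfolding line vfourier_Plancherel(3)[OF j1 j2] nu by (intro tendsto_intros)
  have d1: "integrable lborel (\<lambda>t. \<psi> k t - \<psi> j t)" for k j
    using j1 by simp
  have d2: "integrable lborel (\<lambda>t. (norm (\<psi> k t - \<psi> j t))\<^sup>2)" for k j
  proof (rule Bochner_Integration.integrable_bound)
    show "integrable lborel (\<lambda>t. 2 * (norm (\<psi> k t))\<^sup>2 + 2 * (norm (\<psi> j t))\<^sup>2)"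
      using j2 by simp
    show "AE t in lborel. norm ((norm (\<psi> k t - \<psi> j t))\<^sup>2) \<le> norm (2 * (norm (\<psi> k t))\<^sup>2 + 2 * (norm (\<psi> j t))\<^sup>2)"
      using norm_diff_power2_le by (intro AE_I2) auto
  qed measurable
  have dline: "laplace u (Complex (sig k) \<omega>) - laplace u (Complex (sig j) \<omega>) = vfourier (\<lambda>t. \<psi> k t - \<psi> j t) \<omega>" for k j \<omega>
    unfolding line by (rule vfourier_diff[OF j1 j1])
  show "integrable lborel (\<lambda>\<omega>. (norm (laplace u (Complex (sig k) \<omega>) - laplace u (Complex (sig j) \<omega>)))\<^sup>2)"
    unfolding dline by (rule vfourier_Plancherel(2)[OF d1 d2])
  define d where "d j = 2 * pi * (\<integral>t. (norm (\<phi> t - \<psi> j t))\<^sup>2 \<partial>lborel)" for j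
  have ed: "(norm (\<phi> t - \<psi> j t))\<^sup>2 \<le> (norm (\<phi> t))\<^sup>2" for j t
  proof (cases "t < 0")
    case False
    have "\<phi> t - \<psi> j t = (1 - exp (- sig j * t)) *\<^sub>R \<phi> t"
      by (simp add: \<psi>_def scaleR_diff_left)
    moreover have "0 \<le> 1 - exp (- sig j * t)" "1 - exp (- sig j * t) \<le> 1"
      using False sig_pos[of j] by auto
    then have "(1 - exp (- sig j * t)) * norm (\<phi> t) \<le> 1 * norm (\<phi> t)"
      by (intro mult_right_mono) auto
    ultimately show ?thesis
      using \<open>0 \<le> 1 - exp (- sig j * t)\<close> by (intro power_mono) auto
  qed (simp add: \<psi>_def neg)
  have ei: "integrable lborel (\<lambda>t. (norm (\<phi> t - \<psi> j t))\<^sup>2)" for j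
    by (rule Bochner_Integration.integrable_bound[OF i2]) (use ed in auto)
  have "(\<lambda>j. \<integral>t. (norm (\<phi> t - \<psi> j t))\<^sup>2 \<partial>lborel) \<longlonglongrightarrow> (\<integral>t. 0 \<partial>(lborel :: real measure))"
  proof (rule integral_dominated_convergence[where w = "\<lambda>t. (norm (\<phi> t))\<^sup>2"])
    show "AE t in lborel. (\<lambda>j. (norm (\<phi> t - \<psi> j t))\<^sup>2) \<longlonglongrightarrow> 0"
    proof (rule AE_I2)
      fix t
      have "(\<lambda>j. (norm (\<phi> t - \<psi> j t))\<^sup>2) \<longlonglongrightarrow> (norm (\<phi> t - \<phi> t))\<^sup>2"
        by (intro tendsto_intros pt)
      then show "(\<lambda>j. (norm (\<phi> t - \<psi> j t))\<^sup>2) \<longlonglongrightarrow> 0" by simp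
    qed
  qed (use i2 ed in auto)
  then have "(\<lambda>j. 2 * pi * (\<integral>t. (norm (\<phi> t - \<psi> j t))\<^sup>2 \<partial>lborel)) \<longlonglongrightarrow> 2 * pi * 0"
    by (intro tendsto_intros) simp
  then have "d \<longlonglongrightarrow> 0" by (simp add: d_def[abs_def])
  \<comment> \<open>For j \<le> k the factor exp(- sig k * t) lies between exp(- sig j * t) and 1
    when t \<ge> 0. So \<psi> k is no farther from \<psi> j than \<phi> is, and the bound depends on
    j alone.\<close>
  moreover have "(\<integral>\<omega>. (norm (laplace u (Complex (sig k) \<omega>) - laplace u (Complex (sig j) \<omega>)))\<^sup>2 \<partial>lborel) \<le> d j" if jk: "j \<le> k" for j k
  proof -
    have "(\<integral>\<omega>. (norm (laplace u (Complex (sig k) \<omega>) - laplace u (Complex (sig j) \<omega>)))\<^sup>2 \<partial>lborel) =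
        2 * pi * (\<integral>t. (norm (\<psi> k t - \<psi> j t))\<^sup>2 \<partial>lborel)"
      unfolding dline by (rule vfourier_Plancherel(3)[OF d1 d2])
    also have "(\<integral>t. (norm (\<psi> k t - \<psi> j t))\<^sup>2 \<partial>lborel) \<le> (\<integral>t. (norm (\<phi> t - \<psi> j t))\<^sup>2 \<partial>lborel)"
    proof (rule integral_mono[OF d2 ei])
      fix t
      show "(norm (\<psi> k t - \<psi> j t))\<^sup>2 \<le> (norm (\<phi> t - \<psi> j t))\<^sup>2"
      proof (cases "t < 0")
        case False
        have le: "exp (- sig j * t) \<le> exp (- sig k * t)" "exp (- sig k * t) \<le> 1"
          using False sig_antimono[OF jk] sig_pos[of k] by (auto intro: mult_right_mono)
        have "norm (\<psi> k t - \<psi> j t) = (exp (- sig k * t) - exp (- sig j * t)) * norm (\<phi> t)"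
          using le by (simp add: \<psi>_def flip: scaleR_diff_left)
        also have "\<dots> \<le> (1 - exp (- sig j * t)) * norm (\<phi> t)"
          using le by (intro mult_right_mono) auto
        also have "\<dots> = norm ((1 - exp (- sig j * t)) *\<^sub>R \<phi> t)"
          using le by simp
        also have "(1 - exp (- sig j * t)) *\<^sub>R \<phi> t = \<phi> t - \<psi> j t"
          by (simp add: \<psi>_def scaleR_diff_left)
        finally show ?thesis by (intro power_mono) auto
      qed (simp add: \<psi>_def neg)
    qed
    finally show ?thesis by (simp add: d_def)
  qed
  ultimately show "\<exists>d. d \<longlonglongrightarrow> 0 \<and> (\<forall>j k. j \<le> k \<longrightarrow> (\<integral>\<omega>. (norm (laplace u (Complex (sig k) \<omega>) - laplace u (Complex (sig j) \<omega>)))\<^sup>2 \<partial>lborel) \<le> d j)"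
    by blast
qed

text \<open>The transforms on the lines \<open>Re s = sig k\<close> are Cauchy in \<open>L\<^sup>2\<close>, so the exceptional
  sets, whose indicators tend to \<open>0\<close> almost everywhere, contribute nothing in the limit.\<close>

lemma norm_le_from_laplace_lines:
  fixes u w :: "'m::finite L2"
  assumes C: "0 \<le> C"
    and ev: "AE \<omega> in lborel. \<forall>\<^sub>F k in sequentially.
      norm (laplace w (Complex (sig k) \<omega>)) \<le> C * norm (laplace u (Complex (sig k) \<omega>))"
  shows "norm w \<le> C * norm u"
proof -
  define g h where "g k \<omega> = laplace u (Complex (sig k) \<omega>)" and "h k \<omega> = laplace w (Complex (sig k) \<omega>)" for k \<omega>
  note [measurable] = laplace_line_measurable[of u, folded g_def] laplace_line_measurable[of w, folded h_def]
  note gi = laplace_line_integrable[of u, folded g_def] and hi = laplace_line_integrable[of w, folded h_def]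
  note gl = laplace_line_tendsto[of u, folded g_def] and hl = laplace_line_tendsto[of w, folded h_def]
  note hdi = laplace_line_diff_integrable[of w, folded h_def]
  obtain d where d: "d \<longlonglongrightarrow> 0" "\<And>j k. j \<le> k \<Longrightarrow> (\<integral>\<omega>. (norm (h k \<omega> - h j \<omega>))\<^sup>2 \<partial>lborel) \<le> d j"
    using laplace_line_Cauchy[of w] unfolding h_def by blast
  define E where "E k = {\<omega>. C * norm (g k \<omega>) < norm (h k \<omega>)}" for k
  have [measurable]: "E k \<in> sets borel" for k
    unfolding E_def by measurable
  \<comment> \<open>With j fixed, \<open>h k\<close> is replaced by \<open>h j\<close> on the
    exceptional set \<open>E k\<close> at a cost of 2 d j. The integral of the fixed function over
    \<open>E k\<close> vanishes as k grows; only afterwards does j tend to infinity.\<close>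
  have main: "2 * pi * (norm w)\<^sup>2 \<le> C\<^sup>2 * (2 * pi * (norm u)\<^sup>2) + 2 * d j" for j
  proof -
    have Eji: "integrable lborel (\<lambda>\<omega>. indicat_real (E k) \<omega> * (norm (h j \<omega>))\<^sup>2)" for k
      by (rule Bochner_Integration.integrable_bound[OF hi[of j]]) (auto split: split_indicator)
    have "(\<lambda>k. \<integral>\<omega>. indicat_real (E k) \<omega> * (norm (h j \<omega>))\<^sup>2 \<partial>lborel) \<longlonglongrightarrow> (\<integral>\<omega>. 0 \<partial>(lborel :: real measure))"
    proof (rule integral_dominated_convergence[where w = "\<lambda>\<omega>. (norm (h j \<omega>))\<^sup>2"])
      show "AE \<omega> in lborel. (\<lambda>k. indicat_real (E k) \<omega> * (norm (h j \<omega>))\<^sup>2) \<longlonglongrightarrow> 0"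
        using ev
      proof eventually_elim
        case (elim \<omega>)
        then have "\<forall>\<^sub>F k in sequentially. 0 = indicat_real (E k) \<omega> * (norm (h j \<omega>))\<^sup>2"
          by eventually_elim (simp add: E_def g_def h_def)
        then show ?case by (rule Lim_transform_eventually[OF tendsto_const])
      qed
    qed (use hi in \<open>auto split: split_indicator\<close>)
    then have Ej: "(\<lambda>k. \<integral>\<omega>. indicat_real (E k) \<omega> * (norm (h j \<omega>))\<^sup>2 \<partial>lborel) \<longlonglongrightarrow> 0" by simp
    have "\<forall>\<^sub>F k in sequentially. (\<integral>\<omega>. (norm (h k \<omega>))\<^sup>2 \<partial>lborel) \<le> C\<^sup>2 * (\<integral>\<omega>. (norm (g k \<omega>))\<^sup>2 \<partial>lborel) +
        2 * d j + 2 * (\<integral>\<omega>. indicat_real (E k) \<omega> * (norm (h j \<omega>))\<^sup>2 \<partial>lborel)"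
      using eventually_ge_at_top[of j]
    proof eventually_elim
      case (elim k)
      have le: "(norm (h k \<omega>))\<^sup>2 \<le> C\<^sup>2 * (norm (g k \<omega>))\<^sup>2 + 2 * (norm (h k \<omega> - h j \<omega>))\<^sup>2 +
          2 * (indicat_real (E k) \<omega> * (norm (h j \<omega>))\<^sup>2)" for \<omega>
      proof (cases "\<omega> \<in> E k")
        case True
        have "0 \<le> C\<^sup>2 * (norm (g k \<omega>))\<^sup>2" by simp
        moreover have "(norm (h k \<omega>))\<^sup>2 \<le> 2 * (norm (h k \<omega> - h j \<omega>))\<^sup>2 + 2 * (norm (h j \<omega>))\<^sup>2"
          using norm_add_power2_le[of "h k \<omega> - h j \<omega>" "h j \<omega>"] by simp
        moreover have "indicat_real (E k) \<omega> * (norm (h j \<omega>))\<^sup>2 = (norm (h j \<omega>))\<^sup>2"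
          using True by simp
        ultimately show ?thesis by linarith
      next
        case False
        then have "(norm (h k \<omega>))\<^sup>2 \<le> (C * norm (g k \<omega>))\<^sup>2"
          by (intro power_mono) (auto simp: E_def)
        then show ?thesis using False by (simp add: power_mult_distrib add_increasing2)
      qed
      have "(\<integral>\<omega>. (norm (h k \<omega>))\<^sup>2 \<partial>lborel) \<le> (\<integral>\<omega>. C\<^sup>2 * (norm (g k \<omega>))\<^sup>2 + 2 * (norm (h k \<omega> - h j \<omega>))\<^sup>2 +
          2 * (indicat_real (E k) \<omega> * (norm (h j \<omega>))\<^sup>2) \<partial>lborel)"
        using gi hdi Eji by (intro integral_mono[OF hi _ le]) simp
      also have "\<dots> = C\<^sup>2 * (\<integral>\<omega>. (norm (g k \<omega>))\<^sup>2 \<partial>lborel) + 2 * (\<integral>\<omega>. (norm (h k \<omega> - h j \<omega>))\<^sup>2 \<partial>lborel) +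
          2 * (\<integral>\<omega>. indicat_real (E k) \<omega> * (norm (h j \<omega>))\<^sup>2 \<partial>lborel)"
        using gi hdi Eji by simp
      finally show ?case using d(2)[OF elim] by linarith
    qed
    moreover have "(\<lambda>k. C\<^sup>2 * (\<integral>\<omega>. (norm (g k \<omega>))\<^sup>2 \<partial>lborel) + 2 * d j + 2 * (\<integral>\<omega>. indicat_real (E k) \<omega> * (norm (h j \<omega>))\<^sup>2 \<partial>lborel))
        \<longlonglongrightarrow> C\<^sup>2 * (2 * pi * (norm u)\<^sup>2) + 2 * d j + 2 * 0"
      by (intro tendsto_intros gl Ej)
    ultimately have "2 * pi * (norm w)\<^sup>2 \<le> C\<^sup>2 * (2 * pi * (norm u)\<^sup>2) + 2 * d j + 2 * 0"
      using hl by (intro tendsto_le[OF sequentially_bot])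
    then show ?thesis by simp
  qed
  have "(\<lambda>j. C\<^sup>2 * (2 * pi * (norm u)\<^sup>2) + 2 * d j) \<longlonglongrightarrow> C\<^sup>2 * (2 * pi * (norm u)\<^sup>2) + 2 * 0"
    by (intro tendsto_intros d(1))
  then have "2 * pi * (norm w)\<^sup>2 \<le> C\<^sup>2 * (2 * pi * (norm u)\<^sup>2) + 2 * 0"
    by (rule LIMSEQ_le_const) (use main in auto)
  moreover have "2 * pi * (C * norm u)\<^sup>2 = C\<^sup>2 * (2 * pi * (norm u)\<^sup>2)"
    by (simp add: power_mult_distrib)
  ultimately have "2 * pi * (norm w)\<^sup>2 \<le> 2 * pi * (C * norm u)\<^sup>2"
    by linarith
  then have "(norm w)\<^sup>2 \<le> (C * norm u)\<^sup>2"
    by (rule mult_left_le_imp_le) simp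
  then show ?thesis
    by (rule power2_le_imp_le[OF _ mult_nonneg_nonneg[OF C norm_ge_zero]])
qed

section \<open>Singular values and matrix functions\<close>

lemma conj_transpose_adjoint:
  "((A :: complex^'n::finite^'m::finite) *v x) \<bullet> y = x \<bullet> (conj_transpose A *v y)"
proof -
  have ci: "a \<bullet> b = Re (a * cnj b)" for a b :: complex
    by (simp add: inner_complex_def)
  have "((A *v x) \<bullet> y) = (\<Sum>i\<in>UNIV. \<Sum>j\<in>UNIV. Re (A $ i $ j * x $ j * cnj (y $ i)))"
    by (simp only: inner_vec_def ci matrix_vector_mult_def vec_lambda_beta sum_distrib_right Re_sum)
  also have "\<dots> = (\<Sum>j\<in>UNIV. \<Sum>i\<in>UNIV. Re (A $ i $ j * x $ j * cnj (y $ i)))"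
    by (rule sum.swap)
  also have "\<dots> = x \<bullet> (conj_transpose A *v y)"
    by (simp only: inner_vec_def ci matrix_vector_mult_def conj_transpose_def vec_lambda_beta
        cnj_sum complex_cnj_mult complex_cnj_cnj sum_distrib_left Re_sum mult_ac)
  finally show ?thesis .
qed

text \<open>A maximiser v of the quadratic form on the unit sphere is an eigenvector: moving v along
  the residual w = \<mu> v - S v would otherwise violate maximality to first order. The space is
  real, which suffices for Gram matrices over the complex numbers because their eigenvalues are
  real.\<close>

lemma symmetric_max_eigenvector:
  fixes S :: "'a::euclidean_space \<Rightarrow> 'a"
  assumes lin: "linear S" and sym: "\<And>x y. S x \<bullet> y = x \<bullet> S y"
  obtains v where "v \<noteq> 0" "S v = (v \<bullet> S v / (v \<bullet> v)) *\<^sub>R v" "\<And>x. x \<bullet> S x \<le> (v \<bullet> S v / (v \<bullet> v)) * (x \<bullet> x)"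
proof -
  interpret S: linear S by fact
  have cont: "continuous_on A S" for A
    using lin by (simp add: linear_continuous_on linear_conv_bounded_linear)
  obtain b :: 'a where "b \<in> Basis" using nonempty_Basis by blast
  then have "b \<in> sphere 0 1" by simp
  then have "sphere 0 1 \<noteq> ({} :: 'a set)" by blast
  moreover have "continuous_on (sphere 0 1) (\<lambda>x. x \<bullet> S x)"
    using cont by (intro continuous_intros)
  ultimately obtain v where v: "v \<in> sphere 0 1" "\<And>x. x \<in> sphere 0 1 \<Longrightarrow> x \<bullet> S x \<le> v \<bullet> S v"
    using continuous_attains_sup[OF compact_sphere, of 0 1 "\<lambda>x. x \<bullet> S x"] by blast
  define \<mu> where "\<mu> = v \<bullet> S v"
  have vv: "v \<bullet> v = 1" using v(1) by (simp add: dot_square_norm)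
  have le: "x \<bullet> S x \<le> \<mu> * (x \<bullet> x)" for x
  proof (cases "x = 0")
    case False
    define y where "y = (1 / norm x) *\<^sub>R x"
    have "y \<in> sphere 0 1" using False by (simp add: y_def)
    from v(2)[OF this] have "(1 / norm x)\<^sup>2 * (x \<bullet> S x) \<le> \<mu>"
      by (simp add: y_def S.scale \<mu>_def power2_eq_square)
    then show ?thesis
      using False by (simp add: field_simps power2_norm_eq_inner power_divide)
  qed (simp add: S.zero)
  define w where "w = \<mu> *\<^sub>R v - S v"
  define B where "B = w \<bullet> w"
  define Q where "Q = \<mu> * (w \<bullet> w) - w \<bullet> S w"
  have Q: "0 \<le> Q" using le[of w] by (simp add: Q_def)
  have quad: "0 \<le> 2 * t * B + t\<^sup>2 * Q" for t
  proof -
    have 1: "(v + t *\<^sub>R w) \<bullet> S (v + t *\<^sub>R w) = \<mu> + 2 * t * (S v \<bullet> w) + t\<^sup>2 * (w \<bullet> S w)"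
      using sym[of v w] by (simp add: S.add S.scale inner_add_left inner_add_right \<mu>_def inner_commute power2_eq_square algebra_simps)
    have 2: "(v + t *\<^sub>R w) \<bullet> (v + t *\<^sub>R w) = 1 + 2 * t * (v \<bullet> w) + t\<^sup>2 * (w \<bullet> w)"
      by (simp add: inner_add_left inner_add_right vv inner_commute power2_eq_square algebra_simps)
    have 3: "B = \<mu> * (v \<bullet> w) - S v \<bullet> w"
      unfolding B_def by (subst (1) w_def) (simp add: inner_diff_left)
    show ?thesis
      using le[of "v + t *\<^sub>R w"] unfolding 1 2 3 Q_def by (simp add: algebra_simps)
  qed
  have "B = 0"
  proof (rule ccontr)
    assume "B \<noteq> 0"
    then have B: "B > 0" by (simp add: B_def)
    \<comment> \<open>For this negative t the expression 2 t B + t^2 Q equals -t^2 (Q + 2) <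
      0.\<close>
    define t where "t = - B / (Q + 1)"
    have t: "B = - t * (Q + 1)" "t \<noteq> 0" using Q B by (auto simp: t_def)
    have "0 \<le> 2 * t * B + t\<^sup>2 * Q" by (rule quad)
    also have "\<dots> = - (t\<^sup>2 * (Q + 2))"
      unfolding t(1) by (simp add: power2_eq_square algebra_simps)
    also have "\<dots> < 0" using t(2) Q by (simp add: mult_pos_pos)
    finally show False by simp
  qed
  then have "S v = \<mu> *\<^sub>R v" by (simp add: B_def w_def)
  then show thesis
    using le vv by (intro that[of v]) (auto simp: \<mu>_def)
qed

context
  fixes A :: "complex^'m^'m::finite"
begin

lemma gram_inner: "x \<bullet> ((conj_transpose A ** A) *v y) = (A *v x) \<bullet> (A *v y)"
  by (simp add: conj_transpose_adjoint matrix_vector_mul_assoc)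

lemma gram_norm: "x \<bullet> ((conj_transpose A ** A) *v x) = (norm (A *v x))\<^sup>2"
  by (simp add: gram_inner power2_norm_eq_inner)

lemma gram_linear: "linear (\<lambda>x. (conj_transpose A ** A) *v x)"
  by (rule linearI) (simp_all add: matrix_vector_right_distrib vec_scaleR_conv_scalar_mult vector_scalar_commute)

lemma gram_symmetric: "((conj_transpose A ** A) *v x) \<bullet> y = x \<bullet> ((conj_transpose A ** A) *v y)"
  using gram_inner[of x y] gram_inner[of y x] by (simp add: inner_commute)

lemma singular_values_iff:
  "r \<in> singular_values A \<longleftrightarrow> 0 \<le> r \<and> (\<exists>v. v \<noteq> 0 \<and> (conj_transpose A ** A) *v v = r\<^sup>2 *\<^sub>R v)"
  by (simp add: singular_values_def vec_scaleR_conv_scalar_mult)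

text \<open>\<open>Max\<close> and \<open>Min\<close> are meaningful only for finite sets.
  Eigenvectors for distinct singular values are orthogonal, and a pairwise orthogonal set is
  finite.\<close>

lemma finite_singular_values: "finite (singular_values A)"
proof -
  obtain v where v: "\<And>r. r \<in> singular_values A \<Longrightarrow> v r \<noteq> 0 \<and> (conj_transpose A ** A) *v v r = r\<^sup>2 *\<^sub>R v r"
    using singular_values_iff by metis
  have orth: "v r \<bullet> v r' = 0" if "r \<in> singular_values A" "r' \<in> singular_values A" "r \<noteq> r'" for r r'
  proof -
    have "r\<^sup>2 * (v r \<bullet> v r') = r'\<^sup>2 * (v r \<bullet> v r')"
      using gram_symmetric[of "v r" "v r'"] v[OF that(1)] v[OF that(2)] by simp
    moreover have "r\<^sup>2 \<noteq> r'\<^sup>2"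
      using that by (simp add: singular_values_iff power2_eq_iff_nonneg)
    ultimately show ?thesis by simp
  qed
  have "inj_on v (singular_values A)"
  proof (rule inj_onI)
    fix r r' assume rr: "r \<in> singular_values A" "r' \<in> singular_values A" "v r = v r'"
    show "r = r'"
    proof (rule ccontr)
      assume "r \<noteq> r'"
      from orth[OF rr(1,2) this] rr(3) v[OF rr(2)] show False by simp
    qed
  qed
  moreover have "finite (v ` singular_values A)"
    by (rule pairwise_orthogonal_imp_finite) (auto simp: pairwise_def orthogonal_def intro!: orth)
  ultimately show ?thesis by (simp add: finite_image_iff)
qed

text \<open>The largest eigenvalue of the Gram matrix is the maximum of |A x|^2/|x|^2, so
  \<open>sigma_max A\<close> is the operator norm, attained at an eigenvector.\<close>

lemma sigma_max_le_iff: "sigma_max A \<le> c \<longleftrightarrow> (\<forall>x. norm (A *v x) \<le> c * norm x)"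
proof -
  obtain v where v: "v \<noteq> 0" "(conj_transpose A ** A) *v v = ((norm (A *v v))\<^sup>2 / (v \<bullet> v)) *\<^sub>R v"
    "\<And>x. (norm (A *v x))\<^sup>2 \<le> ((norm (A *v v))\<^sup>2 / (v \<bullet> v)) * (x \<bullet> x)"
    using symmetric_max_eigenvector[OF gram_linear gram_symmetric] unfolding gram_norm by metis
  define r where "r = norm (A *v v) / norm v"
  have r2: "(norm (A *v v))\<^sup>2 / (v \<bullet> v) = r\<^sup>2"
    by (simp add: r_def power_divide power2_norm_eq_inner)
  have r0: "0 \<le> r" by (simp add: r_def)
  have rs: "r \<in> singular_values A"
    using v(1,2) r0 unfolding singular_values_iff r2 by blast
  have bound: "norm (A *v x) \<le> r * norm x" for x
  proof (rule power2_le_imp_le)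
    show "(norm (A *v x))\<^sup>2 \<le> (r * norm x)\<^sup>2"
      using v(3)[of x] unfolding r2 by (simp add: power_mult_distrib power2_norm_eq_inner)
  qed (use r0 in simp)
  have "r' \<le> r" if "r' \<in> singular_values A" for r'
  proof -
    obtain w where w: "w \<noteq> 0" "(conj_transpose A ** A) *v w = r'\<^sup>2 *\<^sub>R w" "0 \<le> r'"
      using \<open>r' \<in> singular_values A\<close> unfolding singular_values_iff by blast
    have "(norm (A *v w))\<^sup>2 = (r' * norm w)\<^sup>2"
      using gram_norm[of w] w(2) by (simp add: power_mult_distrib power2_norm_eq_inner)
    then have "norm (A *v w) = r' * norm w"
      by (rule power2_eq_imp_eq[OF _ norm_ge_zero mult_nonneg_nonneg[OF w(3) norm_ge_zero]])
    then show ?thesis using bound[of w] w(1) by simp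
  qed
  then have max: "sigma_max A = r"
    unfolding sigma_max_def by (intro Max_eqI finite_singular_values rs)
  show "sigma_max A \<le> c \<longleftrightarrow> (\<forall>x. norm (A *v x) \<le> c * norm x)"
  proof
    assume "sigma_max A \<le> c"
    then have "r * norm x \<le> c * norm x" for x :: "complex^'m"
      unfolding max by (rule mult_right_mono) simp
    then show "\<forall>x. norm (A *v x) \<le> c * norm x"
      using order_trans[OF bound] by blast
  next
    assume "\<forall>x. norm (A *v x) \<le> c * norm x"
    then have "norm (A *v v) \<le> c * norm v" by blast
    then show "sigma_max A \<le> c" using v(1) by (simp add: max r_def divide_le_eq)
  qed
qed

text \<open>The smallest eigenvalue of the Gram matrix is found by applying the maximum argument to
  its negative.\<close>

lemma le_sigma_min_iff: "c \<le> sigma_min A \<longleftrightarrow> (\<forall>x. c * norm x \<le> norm (A *v x))"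
    and sigma_min_nonneg: "0 \<le> sigma_min A"
proof -
  obtain v where v': "v \<noteq> 0"
    "- ((conj_transpose A ** A) *v v) = (v \<bullet> - ((conj_transpose A ** A) *v v) / (v \<bullet> v)) *\<^sub>R v"
    "\<And>x. x \<bullet> - ((conj_transpose A ** A) *v x) \<le> (v \<bullet> - ((conj_transpose A ** A) *v v) / (v \<bullet> v)) * (x \<bullet> x)"
  proof (rule symmetric_max_eigenvector[of "\<lambda>x. - ((conj_transpose A ** A) *v x)"])
    show "linear (\<lambda>x. - ((conj_transpose A ** A) *v x))"
      using gram_linear by (rule linear_compose_neg)
    show "- ((conj_transpose A ** A) *v x) \<bullet> y = x \<bullet> - ((conj_transpose A ** A) *v y)" for x y
      by (simp only: inner_minus_left inner_minus_right gram_symmetric)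
  qed blast
  have v: "v \<noteq> 0" "(conj_transpose A ** A) *v v = ((norm (A *v v))\<^sup>2 / (v \<bullet> v)) *\<^sub>R v" by (fact v'(1))
    (use v'(2) in \<open>simp only: inner_minus_right gram_norm minus_divide_left[symmetric] scaleR_minus_left neg_equal_iff_equal\<close>)
  have v3: "((norm (A *v v))\<^sup>2 / (v \<bullet> v)) * (x \<bullet> x) \<le> (norm (A *v x))\<^sup>2" for x
    using v'(3)[of x] by (simp only: inner_minus_right gram_norm minus_divide_left[symmetric] mult_minus_left neg_le_iff_le)
  define r where "r = norm (A *v v) / norm v"
  have r2: "(norm (A *v v))\<^sup>2 / (v \<bullet> v) = r\<^sup>2"
    by (simp add: r_def power_divide power2_norm_eq_inner)
  have r0: "0 \<le> r" by (simp add: r_def)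
  have rs: "r \<in> singular_values A"
    using v(1,2) r0 unfolding singular_values_iff r2 by blast
  have bound: "r * norm x \<le> norm (A *v x)" for x
  proof (rule power2_le_imp_le)
    show "(r * norm x)\<^sup>2 \<le> (norm (A *v x))\<^sup>2"
      using v3[of x] unfolding r2 by (simp add: power_mult_distrib power2_norm_eq_inner)
  qed simp
  have "r \<le> r'" if "r' \<in> singular_values A" for r'
  proof -
    obtain w where w: "w \<noteq> 0" "(conj_transpose A ** A) *v w = r'\<^sup>2 *\<^sub>R w" "0 \<le> r'"
      using \<open>r' \<in> singular_values A\<close> unfolding singular_values_iff by blast
    have "(norm (A *v w))\<^sup>2 = (r' * norm w)\<^sup>2"
      using gram_norm[of w] w(2) by (simp add: power_mult_distrib power2_norm_eq_inner)
    then have "norm (A *v w) = r' * norm w"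
      by (rule power2_eq_imp_eq[OF _ norm_ge_zero mult_nonneg_nonneg[OF w(3) norm_ge_zero]])
    then show ?thesis using bound[of w] w(1) by simp
  qed
  then have min: "sigma_min A = r"
    unfolding sigma_min_def by (intro Min_eqI finite_singular_values rs)
  show "0 \<le> sigma_min A" using r0 min by simp
  show "c \<le> sigma_min A \<longleftrightarrow> (\<forall>x. c * norm x \<le> norm (A *v x))"
  proof
    assume "c \<le> sigma_min A"
    then have "c * norm x \<le> r * norm x" for x :: "complex^'m"
      unfolding min by (rule mult_right_mono) simp
    then show "\<forall>x. c * norm x \<le> norm (A *v x)"
      using order_trans[OF _ bound] by blast
  next
    assume "\<forall>x. c * norm x \<le> norm (A *v x)"
    then have "c * norm v \<le> norm (A *v v)" by blast
    then show "c \<le> sigma_min A" using v(1) by (simp add: min r_def le_divide_eq)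
  qed
qed

end

section \<open>Continuity and measurability of matrix functions\<close>

lemma norm_matrix_vector_mult_le: "norm ((A :: complex^'n::finite^'m::finite) *v x) \<le> norm A * norm x"
proof -
  have row: "norm ((A *v x) $ i) \<le> norm (A $ i) * norm x" for i
  proof -
    have "norm ((A *v x) $ i) \<le> (\<Sum>j\<in>UNIV. norm (A $ i $ j) * norm (x $ j))"
      unfolding matrix_vector_mult_def by (auto intro!: order_trans[OF norm_sum] simp: norm_mult)
    also have "\<dots> \<le> (\<Sum>j\<in>UNIV. \<bar>norm (A $ i $ j)\<bar> * \<bar>norm (x $ j)\<bar>)" by simp
    also have "\<dots> \<le> L2_set (\<lambda>j. norm (A $ i $ j)) UNIV * L2_set (\<lambda>j. norm (x $ j)) UNIV"
      by (rule L2_set_mult_ineq)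
    finally show ?thesis by (simp add: norm_vec_def)
  qed
  have "norm (A *v x) = L2_set (\<lambda>i. norm ((A *v x) $ i)) UNIV" by (simp add: norm_vec_def)
  also have "\<dots> \<le> L2_set (\<lambda>i. norm (A $ i) * norm x) UNIV"
    using row by (intro L2_set_mono) auto
  also have "\<dots> = L2_set (\<lambda>i. norm (A $ i)) UNIV * norm x"
    by (simp add: L2_set_left_distrib)
  also have "\<dots> = norm A * norm x" by (simp add: norm_vec_def[of A])
  finally show ?thesis .
qed

text \<open>As an operator norm \<open>sigma_max\<close> is 1-Lipschitz for the entrywise Euclidean
  norm; this supplies the measurability that \<open>esssup\<close> demands.\<close>

lemma continuous_on_sigma_max: "continuous_on UNIV (sigma_max :: complex^'m^'m::finite \<Rightarrow> real)"
proof -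
  have le: "sigma_max A \<le> sigma_max B + norm (A - B)" for A B :: "complex^'m^'m"
  proof (rule sigma_max_le_iff[THEN iffD2])
    show "\<forall>x. norm (A *v x) \<le> (sigma_max B + norm (A - B)) * norm x"
    proof
      fix x
      have "A *v x = B *v x + (A - B) *v x"
        by (simp add: matrix_vector_mult_diff_rdistrib)
      then have "norm (A *v x) \<le> norm (B *v x) + norm ((A - B) *v x)"
        using norm_triangle_ineq[of "B *v x" "(A - B) *v x"] by simp
      also have "norm (B *v x) \<le> sigma_max B * norm x"
        using sigma_max_le_iff[of B "sigma_max B"] by simp
      also have "norm ((A - B) *v x) \<le> norm (A - B) * norm x"
        by (rule norm_matrix_vector_mult_le)
      finally show "norm (A *v x) \<le> (sigma_max B + norm (A - B)) * norm x"
        by (simp add: distrib_right)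
    qed
  qed
  have "1-lipschitz_on UNIV (sigma_max :: complex^'m^'m \<Rightarrow> real)"
  proof (rule lipschitz_onI)
    fix A B :: "complex^'m^'m"
    show "dist (sigma_max A) (sigma_max B) \<le> 1 * dist A B"
      using le[of A B] le[of B A] by (simp add: dist_real_def dist_norm norm_minus_commute abs_le_iff)
  qed simp
  then show ?thesis by (rule lipschitz_on_continuous_on)
qed

text \<open>\<open>matrix_inv\<close> is a choice operator; the formula by Cramer's rule makes
  continuity and measurability of inverses visible.\<close>

definition cramer_inv :: "complex^'m^'m \<Rightarrow> complex^'m^'m::finite" where
  "cramer_inv A = (\<chi> k j. det (\<chi> i l. if l = k then axis j 1 $ i else A $ i $ l) / det A)"

lemma matrix_inv_eq_cramer_inv:
  fixes A :: "complex^'m^'m::finite"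
  assumes "det A \<noteq> 0"
  shows "matrix_inv A = cramer_inv A"
proof -
  have inv: "A ** matrix_inv A = mat 1"
    using assms someI_ex[of "\<lambda>B. A ** B = mat 1 \<and> B ** A = mat 1"]
    unfolding matrix_inv_def invertible_det_nz[symmetric] invertible_def by blast
  have "matrix_inv A *v axis j 1 = (\<chi> k. det (\<chi> i l. if l = k then axis j 1 $ i else A $ i $ l) / det A)" for j
    using cramer[OF assms, of "matrix_inv A *v axis j 1" "axis j 1"]
    by (simp add: matrix_vector_mul_assoc inv)
  moreover have "(matrix_inv A *v axis j 1) $ k = matrix_inv A $ k $ j" for j k
    by (simp add: matrix_vector_mult_def axis_def if_distrib cong: if_cong)
  ultimately show ?thesis
    by (simp add: vec_eq_iff cramer_inv_def)
qed

lemma continuous_det: "continuous_on UNIV (det :: complex^'m^'m::finite \<Rightarrow> complex)"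
  unfolding det_def by (intro continuous_intros)

lemma tendsto_det [tendsto_intros]:
  "(f \<longlongrightarrow> A) F \<Longrightarrow> ((\<lambda>x. det (f x :: complex^'m^'m::finite)) \<longlongrightarrow> det A) F"
  using continuous_det by (auto simp: continuous_on_eq_continuous_at intro: isCont_tendsto_compose)

lemma tendsto_matrix_mult [tendsto_intros]:
  fixes f g :: "'a \<Rightarrow> complex^'m^'m::finite"
  assumes "(f \<longlongrightarrow> A) F" "(g \<longlongrightarrow> B) F"
  shows "((\<lambda>x. f x ** g x) \<longlongrightarrow> A ** B) F"
  unfolding matrix_matrix_mult_def using assms by (intro tendsto_intros)

lemma tendsto_matrix_vector_mult [tendsto_intros]:
  fixes f :: "'a \<Rightarrow> complex^'m^'m::finite"
  assumes "(f \<longlongrightarrow> A) F" "(g \<longlongrightarrow> x) F"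
  shows "((\<lambda>t. f t *v g t) \<longlongrightarrow> A *v x) F"
  unfolding matrix_vector_mult_def using assms by (intro tendsto_intros)

lemma tendsto_if_const:
  "(P \<Longrightarrow> (f \<longlongrightarrow> a) F) \<Longrightarrow> (\<not> P \<Longrightarrow> (g \<longlongrightarrow> b) F) \<Longrightarrow> ((\<lambda>x. if P then f x else g x) \<longlongrightarrow> (if P then a else b)) F"
  by simp

lemma tendsto_matrix_inv:
  fixes f :: "'a \<Rightarrow> complex^'m^'m::finite"
  assumes f: "(f \<longlongrightarrow> A) F" and A: "det A \<noteq> 0"
  shows "((\<lambda>x. matrix_inv (f x)) \<longlongrightarrow> matrix_inv A) F"
proof -
  have "((\<lambda>x. cramer_inv (f x)) \<longlongrightarrow> cramer_inv A) F"
    unfolding cramer_inv_def by (intro tendsto_intros tendsto_if_const f A)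
  moreover have "\<forall>\<^sub>F x in F. det (f x) \<noteq> 0"
    using tendsto_det[OF f] A by (rule tendsto_imp_eventually_ne)
  then have "\<forall>\<^sub>F x in F. cramer_inv (f x) = matrix_inv (f x)"
    by (rule eventually_mono) (simp add: matrix_inv_eq_cramer_inv)
  ultimately have "((\<lambda>x. matrix_inv (f x)) \<longlongrightarrow> cramer_inv A) F"
    by (rule Lim_transform_eventually)
  then show ?thesis
    by (simp add: matrix_inv_eq_cramer_inv[OF A])
qed

lemma borel_measurable_vecI:
  fixes f :: "'a \<Rightarrow> 'b::euclidean_space^'n::finite"
  assumes "\<And>i. (\<lambda>x. f x $ i) \<in> borel_measurable M"
  shows "f \<in> borel_measurable M"
proof (rule borel_measurable_euclidean_space[THEN iffD2], clarsimp simp: Basis_vec_def)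
  fix i and b :: 'b
  show "(\<lambda>x. f x \<bullet> axis i b) \<in> borel_measurable M"
    using assms[of i] by (simp add: inner_axis)
qed

lemma borel_measurable_matrix_mult:
  fixes f g :: "'a \<Rightarrow> complex^'m^'m::finite"
  assumes [measurable]: "f \<in> borel_measurable M" "g \<in> borel_measurable M"
  shows "(\<lambda>x. f x ** g x) \<in> borel_measurable M"
  by (intro borel_measurable_vecI) (simp add: matrix_matrix_mult_def)

lemma borel_measurable_matrix_vector_mult:
  fixes f :: "'a \<Rightarrow> complex^'m^'m::finite"
  assumes [measurable]: "f \<in> borel_measurable M"
  shows "(\<lambda>x. f x *v v) \<in> borel_measurable M"
  by (intro borel_measurable_vecI) (simp add: matrix_vector_mult_def)

lemma borel_measurable_det:
  fixes f :: "'a \<Rightarrow> complex^'m^'m::finite"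
  assumes "f \<in> borel_measurable M"
  shows "(\<lambda>x. det (f x)) \<in> borel_measurable M"
  using continuous_det assms by (rule borel_measurable_continuous_on)

lemma borel_measurable_cramer_inv:
  fixes f :: "'a \<Rightarrow> complex^'m^'m::finite"
  assumes [measurable]: "f \<in> borel_measurable M"
  shows "(\<lambda>x. cramer_inv (f x)) \<in> borel_measurable M"
proof (intro borel_measurable_vecI)
  fix k j
  have "(\<lambda>x. \<chi> i l. if l = k then axis j 1 $ i else f x $ i $ l) \<in> borel_measurable M"
  proof (intro borel_measurable_vecI)
    fix i l show "(\<lambda>x. (\<chi> i l. if l = k then axis j 1 $ i else f x $ i $ l) $ i $ l) \<in> borel_measurable M"
      by (cases "l = k") simp_all
  qed
  then show "(\<lambda>x. cramer_inv (f x) $ k $ j) \<in> borel_measurable M"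
    using borel_measurable_divide[OF borel_measurable_det borel_measurable_det[OF assms]]
    by (simp add: cramer_inv_def)
qed

section \<open>Boundary values of matrix fractions\<close>

lemma hardy_inf_entry:
  assumes "F \<in> hardy_inf"
  shows "(\<lambda>s. F s $ i $ j) holomorphic_on rhp" "bounded ((\<lambda>s. F s $ i $ j) ` rhp)"
proof -
  show "(\<lambda>s. F s $ i $ j) holomorphic_on rhp"
    using assms by (simp add: hardy_inf_def)
  obtain B where B: "\<And>s. s \<in> rhp \<Longrightarrow> norm (F s) \<le> B"
    using assms by (auto simp: hardy_inf_def bounded_iff)
  have "norm (F s $ i $ j) \<le> B" if "s \<in> rhp" for s
    using Finite_Cartesian_Product.norm_nth_le[of "F s $ i" j] Finite_Cartesian_Product.norm_nth_le[of "F s" i] B[OF that] by linarith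
  then show "bounded ((\<lambda>s. F s $ i $ j) ` rhp)"
    by (auto simp: bounded_iff)
qed

lemma hardy_inf_continuous:
  assumes "F \<in> hardy_inf"
  shows "continuous_on rhp F"
proof -
  have "continuous_on rhp (\<lambda>s. \<chi> i j. F s $ i $ j)"
    by (intro continuous_intros holomorphic_on_imp_continuous_on hardy_inf_entry[OF assms])
  then show ?thesis by simp
qed

text \<open>\<open>boundary_value\<close> is a \<open>Lim\<close> and carries information only where
  the limit exists; Fatou's theorem for the finitely many entries provides this almost
  everywhere.\<close>

lemma hardy_inf_boundary_value:
  assumes F: "F \<in> hardy_inf"
  shows "AE \<omega> in lborel. ((\<lambda>\<sigma>. F (Complex \<sigma> \<omega>)) \<longlongrightarrow> boundary_value F \<omega>) (at_right 0)"
proof -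
  have "AE \<omega> in lborel. \<forall>i j. \<exists>l. ((\<lambda>\<sigma>. F (Complex \<sigma> \<omega>) $ i $ j) \<longlongrightarrow> l) (at_right 0)"
    by (intro eventually_all_finite Fatou_radial_limits hardy_inf_entry[OF F])
  then show ?thesis
  proof eventually_elim
    case (elim \<omega>)
    then obtain l where l: "\<And>i j. ((\<lambda>\<sigma>. F (Complex \<sigma> \<omega>) $ i $ j) \<longlongrightarrow> l i j) (at_right 0)"
      by metis
    have "((\<lambda>\<sigma>. F (Complex \<sigma> \<omega>)) \<longlongrightarrow> (\<chi> i j. l i j)) (at_right 0)"
      by (intro vec_tendstoI) (simp add: l)
    then show ?case
      unfolding boundary_value_def using tendsto_Lim[OF trivial_limit_at_right_real] by metis
  qed
qed

lemma boundary_det_nonzero: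
  fixes M :: "complex \<Rightarrow> complex^'m^'m::finite"
  assumes M: "M \<in> hardy_inf" and s: "s \<in> rhp" "det (M s) \<noteq> 0"
  shows "AE \<omega> in lborel. det (boundary_value M \<omega>) \<noteq> 0"
proof -
  have hol: "(\<lambda>s. det (M s)) holomorphic_on rhp"
    unfolding det_def by (intro holomorphic_intros hardy_inf_entry[OF M])
  obtain B where "\<And>s. s \<in> rhp \<Longrightarrow> norm (M s) \<le> B"
    using M by (auto simp: hardy_inf_def bounded_iff)
  \<comment> \<open>det M is bounded because M takes values in a closed ball, whose image under the
    continuous determinant is compact.\<close>
  then have "(\<lambda>s. det (M s)) ` rhp \<subseteq> det ` cball (0 :: complex^'m^'m) B" by (auto intro!: imageI)
  moreover have "compact (det ` cball (0 :: complex^'m^'m) B)"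
    using continuous_on_subset[OF continuous_det] by (intro compact_continuous_image compact_cball) auto
  ultimately have bd: "bounded ((\<lambda>s. det (M s)) ` rhp)"
    using bounded_subset compact_imp_bounded by blast
  show ?thesis
    using boundary_uniqueness[OF hol bd s] hardy_inf_boundary_value[OF M]
  proof eventually_elim
    case (elim \<omega>)
    then show ?case
      using tendsto_det[OF elim(2)] by auto
  qed
qed

lemma tendsto_at_hardy_inf:
  assumes "F \<in> hardy_inf" "s \<in> rhp"
  shows "(F \<longlongrightarrow> F s) (at s)"
  using hardy_inf_continuous[OF assms(1)] assms(2) open_rhp
  by (simp add: continuous_on_eq_continuous_at isCont_def)

text \<open>Two fractions of T are only known to agree off a sparse set. By continuity they agree
  wherever both denominators are invertible, which near almost every boundary point includes the end
  of the radius, so the radial limits coincide.\<close>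

lemma right_fraction_boundary_eq:
  fixes T :: "complex \<Rightarrow> complex^'m^'m::finite"
  assumes f: "right_fraction T M N" and f': "right_fraction T M' N'"
  shows "AE \<omega> in lborel. boundary_value N \<omega> ** matrix_inv (boundary_value M \<omega>) =
    boundary_value N' \<omega> ** matrix_inv (boundary_value M' \<omega>)"
proof -
  have h: "M \<in> hardy_inf" "N \<in> hardy_inf" "M' \<in> hardy_inf" "N' \<in> hardy_inf"
    using f f' by (auto simp: right_fraction_def)
  have T: "\<forall>\<^sub>F z in at s. T z = N z ** matrix_inv (M z)" "\<forall>\<^sub>F z in at s. T z = N' z ** matrix_inv (M' z)"
    if "s \<in> rhp" for s
    using f f' that by (auto simp: right_fraction_def eventually_cosparse_open_eq[OF open_rhp])
  \<comment> \<open>Agreement in a punctured neighbourhood of s passes to s, since both sides are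
    continuous there.\<close>
  have eq: "N s ** matrix_inv (M s) = N' s ** matrix_inv (M' s)"
    if s: "s \<in> rhp" and d: "det (M s) \<noteq> 0" "det (M' s) \<noteq> 0" for s
  proof (rule tendsto_unique[OF at_neq_bot])
    show "((\<lambda>z. N z ** matrix_inv (M z)) \<longlongrightarrow> N s ** matrix_inv (M s)) (at s)"
      using h s d by (intro tendsto_matrix_mult tendsto_matrix_inv tendsto_at_hardy_inf)
    have "\<forall>\<^sub>F z in at s. N' z ** matrix_inv (M' z) = N z ** matrix_inv (M z)"
      using T[OF s] by eventually_elim simp
    then show "((\<lambda>z. N z ** matrix_inv (M z)) \<longlongrightarrow> N' s ** matrix_inv (M' s)) (at s)"
      by (rule Lim_transform_eventually[rotated])
        (use h s d in \<open>intro tendsto_matrix_mult tendsto_matrix_inv tendsto_at_hardy_inf\<close>)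
  qed
  obtain s s' where s: "s \<in> rhp" "det (M s) \<noteq> 0" "s' \<in> rhp" "det (M' s') \<noteq> 0"
    using f f' by (auto simp: right_fraction_def)
  show ?thesis
    using hardy_inf_boundary_value[OF h(1)] hardy_inf_boundary_value[OF h(2)]
      hardy_inf_boundary_value[OF h(3)] hardy_inf_boundary_value[OF h(4)]
      boundary_det_nonzero[OF h(1) s(1,2)] boundary_det_nonzero[OF h(3) s(3,4)]
  proof eventually_elim
    case (elim \<omega>)
    have "\<forall>\<^sub>F \<sigma> in at_right 0. det (M (Complex \<sigma> \<omega>)) \<noteq> 0" "\<forall>\<^sub>F \<sigma> in at_right 0. det (M' (Complex \<sigma> \<omega>)) \<noteq> 0"
      using tendsto_imp_eventually_ne[OF tendsto_det[OF elim(1)] elim(5)]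
        tendsto_imp_eventually_ne[OF tendsto_det[OF elim(3)] elim(6)] .
    then have "\<forall>\<^sub>F \<sigma> in at_right 0. N' (Complex \<sigma> \<omega>) ** matrix_inv (M' (Complex \<sigma> \<omega>)) =
        N (Complex \<sigma> \<omega>) ** matrix_inv (M (Complex \<sigma> \<omega>))"
      using eventually_at_right_less[of "0::real"]
    proof eventually_elim
      case (elim \<sigma>)
      then show ?case using eq[of "Complex \<sigma> \<omega>"] by (simp add: rhp_def)
    qed
    then have "((\<lambda>\<sigma>. N (Complex \<sigma> \<omega>) ** matrix_inv (M (Complex \<sigma> \<omega>))) \<longlongrightarrow>
        boundary_value N' \<omega> ** matrix_inv (boundary_value M' \<omega>)) (at_right 0)"
      by (rule Lim_transform_eventually[rotated]) (use elim in \<open>intro tendsto_matrix_mult tendsto_matrix_inv\<close>)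
    moreover have "((\<lambda>\<sigma>. N (Complex \<sigma> \<omega>) ** matrix_inv (M (Complex \<sigma> \<omega>))) \<longlongrightarrow>
        boundary_value N \<omega> ** matrix_inv (boundary_value M \<omega>)) (at_right 0)"
      using elim by (intro tendsto_matrix_mult tendsto_matrix_inv)
    ultimately show ?case
      using tendsto_unique[OF trivial_limit_at_right_real] by blast
  qed
qed

lemma invertible_norm_bound:
  fixes A :: "complex^'m^'m::finite"
  assumes "det A \<noteq> 0"
  obtains K where "K > 0" "\<And>v. norm v \<le> K * norm (A *v v)"
proof
  have inv: "matrix_inv A ** A = mat 1"
    using assms someI_ex[of "\<lambda>B. A ** B = mat 1 \<and> B ** A = mat 1"]
    unfolding matrix_inv_def invertible_det_nz[symmetric] invertible_def by blast
  show "0 < norm (matrix_inv A) + 1" by (simp add: add_nonneg_pos)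
  show "norm v \<le> (norm (matrix_inv A) + 1) * norm (A *v v)" for v
  proof -
    have "norm v = norm (matrix_inv A *v (A *v v))"
      by (simp add: matrix_vector_mul_assoc inv)
    also have "\<dots> \<le> norm (matrix_inv A) * norm (A *v v)"
      by (rule norm_matrix_vector_mult_le)
    also have "\<dots> \<le> (norm (matrix_inv A) + 1) * norm (A *v v)"
      by (intro mult_right_mono) auto
    finally show ?thesis .
  qed
qed

text \<open>Invertibility of A bounds |v| by K |A v|, so the perturbation errors, proportional to
  |v|, are absorbed in \<delta> uniformly in v. Uniformity matters because the vector will depend on
  k.\<close>

lemma eventually_matrix_norm_le:
  fixes A B :: "complex^'m^'m::finite"
  assumes f: "(f \<longlongrightarrow> A) F" and g: "(g \<longlongrightarrow> B) F" and A: "det A \<noteq> 0"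
    and C: "0 \<le> C" and le: "\<And>v. norm (B *v v) \<le> C * norm (A *v v)" and \<delta>: "0 < \<delta>"
  shows "\<forall>\<^sub>F k in F. \<forall>v. norm (g k *v v) \<le> (C + \<delta>) * norm (f k *v v)"
proof -
  obtain K where K: "K > 0" "\<And>v. norm v \<le> K * norm (A *v v)"
    using invertible_norm_bound[OF A] by blast
  \<comment> \<open>The first entry gives |A v| \<le> 2 |f k v| and so |v| \<le> 2 K |f k v|; the
    second makes the collected error (C + 1) \<eta> |v| at most \<delta> |f k v|.\<close>
  define \<eta> where "\<eta> = min (1 / (2 * K)) (\<delta> / (2 * K * (C + 1)))"
  have \<eta>: "\<eta> > 0" "\<eta> * K \<le> 1 / 2" "(C + 1) * \<eta> * (2 * K) \<le> \<delta>"
  proof -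
    show "\<eta> > 0" using K(1) C \<delta> by (simp add: \<eta>_def)
    have "\<eta> \<le> 1 / (2 * K)" by (simp add: \<eta>_def)
    then show "\<eta> * K \<le> 1 / 2" using K(1) by (simp add: field_simps)
    have "\<eta> \<le> \<delta> / (2 * K * (C + 1))" by (simp add: \<eta>_def)
    moreover have "0 < 2 * K * (C + 1)" using K(1) C by simp
    ultimately have "\<eta> * (2 * K * (C + 1)) \<le> \<delta>" by (simp add: pos_le_divide_eq)
    then show "(C + 1) * \<eta> * (2 * K) \<le> \<delta>" by (simp add: mult_ac)
  qed
  have "\<forall>\<^sub>F k in F. dist (f k) A < \<eta>" "\<forall>\<^sub>F k in F. dist (g k) B < \<eta>"
    using tendstoD[OF f \<eta>(1)] tendstoD[OF g \<eta>(1)] .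
  then show ?thesis
  proof eventually_elim
    case (elim k)
    show ?case
    proof
      fix v
      have d1: "norm (A *v v) \<le> norm (f k *v v) + \<eta> * norm v"
      proof -
        have "A *v v = f k *v v - (f k - A) *v v" by (simp add: matrix_vector_mult_diff_rdistrib)
        then have "norm (A *v v) \<le> norm (f k *v v) + norm ((f k - A) *v v)"
          using norm_triangle_ineq4[of "f k *v v" "(f k - A) *v v"] by simp
        moreover have "norm ((f k - A) *v v) \<le> norm (f k - A) * norm v" by (rule norm_matrix_vector_mult_le)
        moreover have "norm (f k - A) * norm v \<le> \<eta> * norm v"
          using elim(1) by (intro mult_right_mono) (auto simp: dist_norm)
        ultimately show ?thesis by linarith
      qed
      have d2: "norm (g k *v v) \<le> norm (B *v v) + \<eta> * norm v"
      proof -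
        have "g k *v v = B *v v + (g k - B) *v v" by (simp add: matrix_vector_mult_diff_rdistrib)
        then have "norm (g k *v v) \<le> norm (B *v v) + norm ((g k - B) *v v)"
          using norm_triangle_ineq[of "B *v v" "(g k - B) *v v"] by simp
        moreover have "norm ((g k - B) *v v) \<le> norm (g k - B) * norm v" by (rule norm_matrix_vector_mult_le)
        moreover have "norm (g k - B) * norm v \<le> \<eta> * norm v"
          using elim(2) by (intro mult_right_mono) (auto simp: dist_norm)
        ultimately show ?thesis by linarith
      qed
      have "\<eta> * norm v \<le> \<eta> * (K * norm (A *v v))"
        using K(2)[of v] \<eta>(1) by (intro mult_left_mono) auto
      also have "\<dots> \<le> 1 / 2 * norm (A *v v)"
        using mult_right_mono[OF \<eta>(2), of "norm (A *v v)"] by (simp add: mult.assoc)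
      finally have "norm (A *v v) \<le> 2 * norm (f k *v v)" using d1 by linarith
      then have "K * norm (A *v v) \<le> K * (2 * norm (f k *v v))"
        using K(1) by (intro mult_left_mono) auto
      then have v: "norm v \<le> 2 * K * norm (f k *v v)" using K(2)[of v] by linarith
      have "norm (g k *v v) \<le> C * norm (A *v v) + \<eta> * norm v"
        using d2 le[of v] by linarith
      also have "C * norm (A *v v) \<le> C * (norm (f k *v v) + \<eta> * norm v)"
        using d1 C by (rule mult_left_mono)
      finally have "norm (g k *v v) \<le> C * norm (f k *v v) + (C + 1) * \<eta> * norm v"
        by (simp add: algebra_simps)
      also have "(C + 1) * \<eta> * norm v \<le> (C + 1) * \<eta> * (2 * K * norm (f k *v v))"
        using v C \<eta>(1) by (intro mult_left_mono) auto
      also have "\<dots> = (C + 1) * \<eta> * (2 * K) * norm (f k *v v)" by (simp only: mult.assoc)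
      also have "\<dots> \<le> \<delta> * norm (f k *v v)"
        using \<eta>(3) by (rule mult_right_mono) simp
      finally show "norm (g k *v v) \<le> (C + \<delta>) * norm (f k *v v)"
        by (simp add: distrib_right)
    qed
  qed
qed

text \<open>f enters only through its values on the lines Re s = \<open>sig k\<close>, where the
  perturbed inequality is applied to them. Pairing the two matrix functions freely allows M and N to
  be exchanged later.\<close>

lemma norm_le_from_boundary:
  fixes M N :: "complex \<Rightarrow> complex^'m^'m::finite"
  assumes M: "M \<in> hardy_inf" and N: "N \<in> hardy_inf" and C: "0 \<le> C"
    and u: "laplace u = (\<lambda>s. M s *v f s)" and w: "laplace w = (\<lambda>s. N s *v f s)"
    and det: "AE \<omega> in lborel. det (boundary_value M \<omega>) \<noteq> 0"
    and le: "AE \<omega> in lborel. \<forall>v. norm (boundary_value N \<omega> *v v) \<le> C * norm (boundary_value M \<omega> *v v)"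
  shows "norm w \<le> C * norm u"
proof -
  have *: "norm w \<le> (C + \<delta>) * norm u" if \<delta>: "\<delta> > 0" for \<delta>
  proof (rule norm_le_from_laplace_lines)
    show "0 \<le> C + \<delta>" using C \<delta> by simp
    show "AE \<omega> in lborel. \<forall>\<^sub>F k in sequentially.
        norm (laplace w (Complex (sig k) \<omega>)) \<le> (C + \<delta>) * norm (laplace u (Complex (sig k) \<omega>))"
      using hardy_inf_boundary_value[OF M] hardy_inf_boundary_value[OF N] det le
    proof eventually_elim
      case (elim \<omega>)
      have "(\<lambda>k. M (Complex (sig k) \<omega>)) \<longlonglongrightarrow> boundary_value M \<omega>" "(\<lambda>k. N (Complex (sig k) \<omega>)) \<longlonglongrightarrow> boundary_value N \<omega>"
        unfolding sig_def using tendsto_at_right_0_sequentially[OF elim(1)] tendsto_at_right_0_sequentially[OF elim(2)] .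
      then have "\<forall>\<^sub>F k in sequentially. \<forall>v. norm (N (Complex (sig k) \<omega>) *v v) \<le> (C + \<delta>) * norm (M (Complex (sig k) \<omega>) *v v)"
        by (rule eventually_matrix_norm_le) (use elim C \<delta> in auto)
      then show ?case
        by (rule eventually_mono) (simp add: u w)
    qed
  qed
  have "((\<lambda>\<delta>. (C + \<delta>) * norm u) \<longlongrightarrow> (C + 0) * norm u) (at_right 0)"
    by (intro tendsto_intros)
  moreover have "\<forall>\<^sub>F \<delta> in at_right 0. norm w \<le> (C + \<delta>) * norm u"
    by (rule eventually_mono[OF eventually_at_right_less[of "0::real"]]) (rule *)
  ultimately have "norm w \<le> (C + 0) * norm u"
    by (rule tendsto_lowerbound) (rule trivial_limit_at_right_real)
  then show ?thesis by (simp only: add_0_right)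
qed

text \<open>A version of \<open>boundary_value\<close> as a sequential limit, hence Borel
  measurable; the two agree almost everywhere on \<open>hardy_inf\<close>.\<close>

definition bdry :: "(complex \<Rightarrow> complex^'q^'p) \<Rightarrow> real \<Rightarrow> complex^'q::finite^'p::finite" where
  "bdry F \<omega> = lim (\<lambda>k. F (Complex (sig k) \<omega>))"

lemma hardy_inf_line_measurable:
  assumes "F \<in> hardy_inf"
  shows "(\<lambda>\<omega>. F (Complex (sig k) \<omega>)) \<in> borel_measurable borel"
proof (rule borel_measurable_continuous_onI)
  show "continuous_on UNIV (\<lambda>y. F (Complex (sig k) y))"
    by (rule continuous_on_compose2[OF hardy_inf_continuous[OF assms]])
      (auto simp: rhp_def sig_pos Complex_eq intro!: continuous_intros)
qed

lemma bdry_measurable [measurable]: "F \<in> hardy_inf \<Longrightarrow> bdry F \<in> borel_measurable borel"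
  unfolding bdry_def[abs_def] by (intro borel_measurable_lim_metric hardy_inf_line_measurable)

lemma bdry_AE:
  assumes "F \<in> hardy_inf"
  shows "AE \<omega> in lborel. (\<lambda>k. F (Complex (sig k) \<omega>)) \<longlonglongrightarrow> bdry F \<omega> \<and> bdry F \<omega> = boundary_value F \<omega>"
  using hardy_inf_boundary_value[OF assms]
proof eventually_elim
  case (elim \<omega>)
  have "(\<lambda>k. F (Complex (sig k) \<omega>)) \<longlonglongrightarrow> boundary_value F \<omega>"
    unfolding sig_def by (rule tendsto_at_right_0_sequentially[OF elim])
  then show ?case
    by (simp add: bdry_def limI)
qed

section \<open>Test functions\<close>

text \<open>The factor \<open>s + 1\<close> only makes the weight times a bounded function square-integrable.\<close>

definition test_function :: "real \<Rightarrow> real \<Rightarrow> complex^'m \<Rightarrow> complex \<Rightarrow> complex^'m::finite" where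
  "test_function \<epsilon> \<omega>\<^sub>0 v s =
     (if s \<in> rhp then (1 / ((s + of_real \<epsilon> - \<i> * of_real \<omega>\<^sub>0) * (s + 1))) *s v else 0)"

definition test_weight :: "real \<Rightarrow> real \<Rightarrow> real \<Rightarrow> real \<Rightarrow> real" where
  "test_weight \<sigma> \<epsilon> \<omega>\<^sub>0 \<omega> = 1 / (((\<sigma> + \<epsilon>)\<^sup>2 + (\<omega> - \<omega>\<^sub>0)\<^sup>2) * ((\<sigma> + 1)\<^sup>2 + \<omega>\<^sup>2))"

lemma norm_test_scalar:
  "(norm (1 / ((Complex \<sigma> \<omega> + of_real \<epsilon> - \<i> * of_real \<omega>\<^sub>0) * (Complex \<sigma> \<omega> + 1))))\<^sup>2 = test_weight \<sigma> \<epsilon> \<omega>\<^sub>0 \<omega>"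
  by (simp add: test_weight_def norm_divide norm_mult power_divide power_mult_distrib cmod_power2)

lemma test_weight_nonneg: "0 \<le> test_weight \<sigma> \<epsilon> \<omega>\<^sub>0 \<omega>"
  by (simp add: test_weight_def)

text \<open>A single integrable majorant for all lines serves both membership in
  \<open>hardy2\<close> and dominated convergence towards the axis.\<close>

lemma test_weight_le:
  assumes "0 < \<epsilon>" "0 \<le> \<sigma>"
  shows "test_weight \<sigma> \<epsilon> \<omega>\<^sub>0 \<omega> \<le> 1 / \<epsilon>\<^sup>2 * (1 / (1 + \<omega>\<^sup>2))"
proof -
  have "\<epsilon>\<^sup>2 \<le> (\<sigma> + \<epsilon>)\<^sup>2" "1\<^sup>2 \<le> (\<sigma> + 1)\<^sup>2"
    using assms by (intro power_mono; simp)+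
  then have "\<epsilon>\<^sup>2 * (1 + \<omega>\<^sup>2) \<le> ((\<sigma> + \<epsilon>)\<^sup>2 + (\<omega> - \<omega>\<^sub>0)\<^sup>2) * ((\<sigma> + 1)\<^sup>2 + \<omega>\<^sup>2)"
    by (intro mult_mono) (auto simp: add_increasing2)
  moreover have "0 < \<epsilon>\<^sup>2 * (1 + \<omega>\<^sup>2)"
    using assms by (intro mult_pos_pos add_pos_nonneg) auto
  ultimately have "test_weight \<sigma> \<epsilon> \<omega>\<^sub>0 \<omega> \<le> 1 / (\<epsilon>\<^sup>2 * (1 + \<omega>\<^sup>2))"
    unfolding test_weight_def by (intro frac_le) auto
  then show ?thesis by simp
qed

lemma test_weight_measurable [measurable]: "test_weight \<sigma> \<epsilon> \<omega>\<^sub>0 \<in> borel_measurable borel"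
  unfolding test_weight_def by measurable

lemma test_function_hardy2:
  assumes \<epsilon>: "0 < \<epsilon>"
  shows "test_function \<epsilon> \<omega>\<^sub>0 v \<in> hardy2"
  unfolding hardy2_def
proof (clarsimp, intro conjI allI impI)
  fix i
  have nz: "s + of_real \<epsilon> - \<i> * of_real \<omega>\<^sub>0 \<noteq> 0" "s + 1 \<noteq> 0" if "s \<in> rhp" for s
    using that \<epsilon> by (auto simp: rhp_def complex_eq_iff)
  have "(\<lambda>s. (1 / ((s + of_real \<epsilon> - \<i> * of_real \<omega>\<^sub>0) * (s + 1))) * v $ i) holomorphic_on rhp"
    using nz by (intro holomorphic_intros) auto
  then show "(\<lambda>s. test_function \<epsilon> \<omega>\<^sub>0 v s $ i) holomorphic_on rhp"
    by (rule holomorphic_transform) (simp add: test_function_def)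
next
  show "test_function \<epsilon> \<omega>\<^sub>0 v s = 0" if "s \<notin> rhp" for s
    using that by (simp add: test_function_def)
next
  let ?g = "\<lambda>\<omega>. 1 / \<epsilon>\<^sup>2 * (1 / (1 + \<omega>\<^sup>2)) * (norm v)\<^sup>2"
  have int: "integrable lborel ?g"
    by (intro integrable_mult_left integrable_mult_right integrable_inverse_one_plus_square)
  have "(SUP \<sigma>\<in>{0<..}. \<integral>\<^sup>+ \<omega>. ennreal ((norm (test_function \<epsilon> \<omega>\<^sub>0 v (Complex \<sigma> \<omega>)))\<^sup>2) \<partial>lborel) \<le> (\<integral>\<^sup>+ \<omega>. ennreal (?g \<omega>) \<partial>lborel)"
  proof (intro SUP_least nn_integral_mono ennreal_leI)
    fix \<sigma> \<omega> :: real assume "\<sigma> \<in> {0<..}"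
    then have \<sigma>: "0 < \<sigma>" by simp
    have "(norm (test_function \<epsilon> \<omega>\<^sub>0 v (Complex \<sigma> \<omega>)))\<^sup>2 = test_weight \<sigma> \<epsilon> \<omega>\<^sub>0 \<omega> * (norm v)\<^sup>2"
      using \<sigma> by (simp only: test_function_def rhp_def mem_Collect_eq complex.sel if_True norm_vector_scalar_mult power_mult_distrib norm_test_scalar)
    also have "\<dots> \<le> ?g \<omega>"
      using test_weight_le[of \<epsilon> \<sigma>] \<epsilon> \<sigma> by (intro mult_right_mono) auto
    finally show "(norm (test_function \<epsilon> \<omega>\<^sub>0 v (Complex \<sigma> \<omega>)))\<^sup>2 \<le> ?g \<omega>" .
  qed
  also have "\<dots> < top"
    using int by (subst nn_integral_eq_integral) (auto simp: less_top[symmetric])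
  finally show "(SUP \<sigma>\<in>{0<..}. \<integral>\<^sup>+ \<omega>. ennreal ((norm (test_function \<epsilon> \<omega>\<^sub>0 v (Complex \<sigma> \<omega>)))\<^sup>2) \<partial>lborel) < top" .
qed

lemma bdry_bound:
  assumes F: "F \<in> hardy_inf"
  obtains B where "0 \<le> B" "\<And>s. s \<in> rhp \<Longrightarrow> norm (F s) \<le> B" "AE \<omega> in lborel. norm (bdry F \<omega>) \<le> B"
proof -
  obtain B where B: "\<And>s. s \<in> rhp \<Longrightarrow> norm (F s) \<le> B"
    using F by (auto simp: hardy_inf_def bounded_iff)
  have "(1::complex) \<in> rhp" by (simp add: rhp_def)
  from order_trans[OF norm_ge_zero B[OF this]] have "0 \<le> B" .
  moreover have "AE \<omega> in lborel. norm (bdry F \<omega>) \<le> B"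
    using bdry_AE[OF F]
  proof eventually_elim
    case (elim \<omega>)
    then have "(\<lambda>k. norm (F (Complex (sig k) \<omega>))) \<longlonglongrightarrow> norm (bdry F \<omega>)"
      by (rule tendsto_norm[OF conjunct1])
    then show ?case
      by (rule LIMSEQ_le_const2) (auto intro!: exI[of _ 0] B simp: rhp_def sig_pos)
  qed
  ultimately show thesis using B that by blast
qed

text \<open>The weight of a test function is continuous up to the axis, so here, unlike for general
  f, the norm on the lines passes to an exact boundary integral.\<close>

lemma test_function_norm:
  fixes F :: "complex \<Rightarrow> complex^'m^'m::finite"
  assumes F: "F \<in> hardy_inf" and \<epsilon>: "0 < \<epsilon>"
    and u: "laplace u = (\<lambda>s. F s *v test_function \<epsilon> \<omega>\<^sub>0 v s)"
  shows "integrable lborel (\<lambda>\<omega>. test_weight 0 \<epsilon> \<omega>\<^sub>0 \<omega> * (norm (bdry F \<omega> *v v))\<^sup>2)"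
    and "2 * pi * (norm u)\<^sup>2 = (\<integral>\<omega>. test_weight 0 \<epsilon> \<omega>\<^sub>0 \<omega> * (norm (bdry F \<omega> *v v))\<^sup>2 \<partial>lborel)"
proof -
  obtain B where B: "0 \<le> B" "\<And>s. s \<in> rhp \<Longrightarrow> norm (F s) \<le> B" "AE \<omega> in lborel. norm (bdry F \<omega>) \<le> B"
    using bdry_bound[OF F] by blast
  let ?w = "\<lambda>\<omega>. 1 / \<epsilon>\<^sup>2 * (1 / (1 + \<omega>\<^sup>2)) * (B * norm v)\<^sup>2"
  have wi: "integrable lborel ?w"
    by (intro integrable_mult_left integrable_mult_right integrable_inverse_one_plus_square)
  have Av: "(norm (A *v v))\<^sup>2 \<le> (B * norm v)\<^sup>2" if "norm A \<le> B" for A :: "complex^'m^'m"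
  proof (rule power_mono)
    have "norm (A *v v) \<le> norm A * norm v" by (rule norm_matrix_vector_mult_le)
    also have "\<dots> \<le> B * norm v" using that by (rule mult_right_mono) simp
    finally show "norm (A *v v) \<le> B * norm v" .
  qed simp
  have dom: "test_weight \<sigma> \<epsilon> \<omega>\<^sub>0 \<omega> * (norm (A *v v))\<^sup>2 \<le> ?w \<omega>" if "0 \<le> \<sigma>" "norm A \<le> B" for \<sigma> \<omega> and A :: "complex^'m^'m"
    using test_weight_le[OF \<epsilon> that(1)] Av[OF that(2)] by (intro mult_mono) auto
  have [measurable]: "(\<lambda>\<omega>. bdry F \<omega> *v v) \<in> borel_measurable borel"
    "(\<lambda>\<omega>. F (Complex (sig k) \<omega>) *v v) \<in> borel_measurable borel" for k
    by (intro borel_measurable_matrix_vector_mult bdry_measurable hardy_inf_line_measurable F)+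
  have line: "(norm (laplace u (Complex (sig k) \<omega>)))\<^sup>2 = test_weight (sig k) \<epsilon> \<omega>\<^sub>0 \<omega> * (norm (F (Complex (sig k) \<omega>) *v v))\<^sup>2" for k \<omega>
  proof -
    have "laplace u (Complex (sig k) \<omega>) = F (Complex (sig k) \<omega>) *v ((1 / ((Complex (sig k) \<omega> + of_real \<epsilon> - \<i> * of_real \<omega>\<^sub>0) * (Complex (sig k) \<omega> + 1))) *s v)"
      using sig_pos[of k] by (simp only: u test_function_def rhp_def mem_Collect_eq complex.sel if_True)
    then show ?thesis
      by (simp only: vector_scalar_commute norm_vector_scalar_mult power_mult_distrib norm_test_scalar)
  qed
  show int: "integrable lborel (\<lambda>\<omega>. test_weight 0 \<epsilon> \<omega>\<^sub>0 \<omega> * (norm (bdry F \<omega> *v v))\<^sup>2)"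
  proof (rule Bochner_Integration.integrable_bound[OF wi])
    show "AE \<omega> in lborel. norm (test_weight 0 \<epsilon> \<omega>\<^sub>0 \<omega> * (norm (bdry F \<omega> *v v))\<^sup>2) \<le> norm (?w \<omega>)"
      using B(3)
    proof eventually_elim
      case (elim \<omega>)
      from dom[OF order_refl elim, of \<omega>] show ?case
        by (simp only: real_norm_def abs_of_nonneg test_weight_nonneg mult_nonneg_nonneg zero_le_power2)
    qed
  qed measurable
  have "(\<lambda>k. \<integral>\<omega>. test_weight (sig k) \<epsilon> \<omega>\<^sub>0 \<omega> * (norm (F (Complex (sig k) \<omega>) *v v))\<^sup>2 \<partial>lborel) \<longlonglongrightarrow>
      (\<integral>\<omega>. test_weight 0 \<epsilon> \<omega>\<^sub>0 \<omega> * (norm (bdry F \<omega> *v v))\<^sup>2 \<partial>lborel)"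
  proof (rule integral_dominated_convergence[where w = ?w])
    show "AE \<omega> in lborel. (\<lambda>k. test_weight (sig k) \<epsilon> \<omega>\<^sub>0 \<omega> * (norm (F (Complex (sig k) \<omega>) *v v))\<^sup>2) \<longlonglongrightarrow>
        test_weight 0 \<epsilon> \<omega>\<^sub>0 \<omega> * (norm (bdry F \<omega> *v v))\<^sup>2"
      using bdry_AE[OF F]
    proof eventually_elim
      case (elim \<omega>)
      have nz: "((0 + \<epsilon>)\<^sup>2 + (\<omega> - \<omega>\<^sub>0)\<^sup>2) * ((0 + 1)\<^sup>2 + \<omega>\<^sup>2) \<noteq> 0"
        using \<epsilon> by (simp add: sum_power2_eq_zero_iff add_nonneg_eq_0_iff)
      show ?case
        unfolding test_weight_def using elim
        by (intro tendsto_intros sig_tendsto nz) auto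
    qed
    show "AE \<omega> in lborel. norm (test_weight (sig k) \<epsilon> \<omega>\<^sub>0 \<omega> * (norm (F (Complex (sig k) \<omega>) *v v))\<^sup>2) \<le> ?w \<omega>" for k
    proof (rule AE_I2)
      fix \<omega>
      have "norm (F (Complex (sig k) \<omega>)) \<le> B"
        using sig_pos[of k] by (intro B(2)) (simp add: rhp_def)
      from dom[OF less_imp_le[OF sig_pos] this]
      show "norm (test_weight (sig k) \<epsilon> \<omega>\<^sub>0 \<omega> * (norm (F (Complex (sig k) \<omega>) *v v))\<^sup>2) \<le> ?w \<omega>"
        by (simp only: real_norm_def abs_of_nonneg test_weight_nonneg mult_nonneg_nonneg zero_le_power2)
    qed
  qed (use wi in measurable)
  from LIMSEQ_unique[OF laplace_line_tendsto[of u, unfolded line] this]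
  show "2 * pi * (norm u)\<^sup>2 = (\<integral>\<omega>. test_weight 0 \<epsilon> \<omega>\<^sub>0 \<omega> * (norm (bdry F \<omega> *v v))\<^sup>2 \<partial>lborel)" .
qed

section \<open>From Poisson means to pointwise inequalities\<close>

lemma integral_inverse_one_plus_square: "(\<integral>x. 1 / (1 + x\<^sup>2) \<partial>lborel) = pi"
  using LBINT_inverse_1_plus_square
  by (simp add: interval_lebesgue_integral_def set_lebesgue_integral_def inverse_eq_divide)

text \<open>The Poisson means of q' = q p are nonpositive, hence so are their integrals against
  \<psi> = p on {q > 0}. In the limit the integral of q' \<psi> is nonpositive, although its
  integrand is nonnegative and positive exactly where q > 0. The factor p = 1/(1 + \<omega>^2) puts
  q' and \<psi> in L2.\<close>

lemma AE_nonpos_if_Poisson_nonpos: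
  fixes q :: "real \<Rightarrow> real" and Q :: real
  assumes q [measurable]: "q \<in> borel_measurable borel" and bd: "AE \<omega> in lborel. \<bar>q \<omega>\<bar> \<le> Q"
    and P: "\<And>\<epsilon> \<omega>\<^sub>0. 0 < \<epsilon> \<Longrightarrow> (\<integral>\<omega>. test_weight 0 \<epsilon> \<omega>\<^sub>0 \<omega> * q \<omega> \<partial>lborel) \<le> 0"
  shows "AE \<omega> in lborel. q \<omega> \<le> 0"
proof -
  define p where "p y = 1 / (1 + y\<^sup>2)" for y :: real
  define q' where "q' \<omega> = q \<omega> * p \<omega>" for \<omega>
  define \<psi> where "\<psi> \<omega> = (if 0 < q \<omega> then p \<omega> else 0)" for \<omega>
  have [measurable]: "p \<in> borel_measurable borel" unfolding p_def by measurable
  have [measurable]: "q' \<in> borel_measurable borel" unfolding q'_def by measurable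
  have [measurable]: "\<psi> \<in> borel_measurable borel" unfolding \<psi>_def by measurable
  have p01: "0 < p y" "p y \<le> 1" for y
    by (auto simp: p_def add_pos_nonneg)
  have pi: "integrable lborel p" unfolding p_def by (rule integrable_inverse_one_plus_square)
  have p2: "p y * p y \<le> p y" for y
    using mult_left_mono[OF p01(2)[of y], of "p y"] p01(1)[of y] by simp
  \<comment> \<open>Under \<omega> = s + \<epsilon> y the test weight factors as p(y) p(s +
    \<epsilon> y)/\<epsilon>^2. The second p, coming from the factor s + 1 of the test function,
    joins q to form q'.\<close>
  have J: "(\<integral>y. p y * q' (s + \<epsilon> * y) \<partial>lborel) \<le> 0" if \<epsilon>: "0 < \<epsilon>" for \<epsilon> s
  proof -
    have "(\<integral>\<omega>. test_weight 0 \<epsilon> s \<omega> * q \<omega> \<partial>lborel) = \<bar>\<epsilon>\<bar> *\<^sub>R (\<integral>y. test_weight 0 \<epsilon> s (s + \<epsilon> * y) * q (s + \<epsilon> * y) \<partial>lborel)"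
      using \<epsilon> by (intro lborel_integral_real_affine) auto
    also have "(\<lambda>y. test_weight 0 \<epsilon> s (s + \<epsilon> * y) * q (s + \<epsilon> * y)) = (\<lambda>y. (1 / \<epsilon>\<^sup>2) * (p y * q' (s + \<epsilon> * y)))"
    proof
      fix y
      have "(0 + \<epsilon>)\<^sup>2 + (s + \<epsilon> * y - s)\<^sup>2 = \<epsilon>\<^sup>2 * (1 + y\<^sup>2)"
        by (simp add: power_mult_distrib algebra_simps)
      then have "test_weight 0 \<epsilon> s (s + \<epsilon> * y) = 1 / \<epsilon>\<^sup>2 * p y * p (s + \<epsilon> * y)"
        by (simp only: test_weight_def p_def) simp
      then show "test_weight 0 \<epsilon> s (s + \<epsilon> * y) * q (s + \<epsilon> * y) = (1 / \<epsilon>\<^sup>2) * (p y * q' (s + \<epsilon> * y))"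
        by (simp add: q'_def)
    qed
    also have "\<bar>\<epsilon>\<bar> *\<^sub>R (\<integral>y. (1 / \<epsilon>\<^sup>2) * (p y * q' (s + \<epsilon> * y)) \<partial>lborel) = (\<epsilon> / \<epsilon>\<^sup>2) * (\<integral>y. p y * q' (s + \<epsilon> * y) \<partial>lborel)"
      using \<epsilon> by (simp only: integral_mult_right_zero) simp
    finally have "(\<epsilon> / \<epsilon>\<^sup>2) * (\<integral>y. p y * q' (s + \<epsilon> * y) \<partial>lborel) \<le> 0"
      using P[OF \<epsilon>, of s] by simp
    moreover have "0 < \<epsilon> / \<epsilon>\<^sup>2" using \<epsilon> by simp
    ultimately show ?thesis by (simp only: mult_le_0_iff) auto
  qed
  have q2: "integrable lborel (\<lambda>t. (norm (complex_of_real (q' t)))\<^sup>2)"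
  proof (rule Bochner_Integration.integrable_bound)
    show "integrable lborel (\<lambda>t. Q\<^sup>2 * p t)" using pi by (rule integrable_mult_right)
    show "AE t in lborel. norm ((norm (complex_of_real (q' t)))\<^sup>2) \<le> norm (Q\<^sup>2 * p t)"
      using bd
    proof eventually_elim
      case (elim t)
      have "(q' t)\<^sup>2 = \<bar>q t\<bar>\<^sup>2 * (p t * p t)" by (simp add: q'_def power2_eq_square)
      also have "\<dots> \<le> Q\<^sup>2 * p t"
        using elim p2[of t] by (intro mult_mono power_mono) auto
      finally show ?case using p01(1)[of t] by (simp add: abs_mult)
    qed
  qed measurable
  have \<psi>2: "integrable lborel (\<lambda>t. (norm (complex_of_real (\<psi> t)))\<^sup>2)"
  proof (rule Bochner_Integration.integrable_bound[OF pi])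
    show "AE t in lborel. norm ((norm (complex_of_real (\<psi> t)))\<^sup>2) \<le> norm (p t)"
      using p2 p01(1) by (intro AE_I2) (auto simp: \<psi>_def power2_eq_square less_imp_le)
  qed measurable
  have "(\<lambda>k. \<integral>s. (\<integral>y. p y *\<^sub>R complex_of_real (q' (s + sig k * y)) \<partial>lborel) * complex_of_real (\<psi> s) \<partial>lborel) \<longlonglongrightarrow>
      (\<integral>y. p y \<partial>lborel) *\<^sub>R (\<integral>t. complex_of_real (q' t) * complex_of_real (\<psi> t) \<partial>lborel)"
    by (rule approximate_identity[OF _ q2 _ \<psi>2 pi sig_tendsto]) measurable
  also have "(\<lambda>k. \<integral>s. (\<integral>y. p y *\<^sub>R complex_of_real (q' (s + sig k * y)) \<partial>lborel) * complex_of_real (\<psi> s) \<partial>lborel) =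
      (\<lambda>k. complex_of_real (\<integral>s. (\<integral>y. p y * q' (s + sig k * y) \<partial>lborel) * \<psi> s \<partial>lborel))"
    by (simp only: scaleR_conv_of_real of_real_mult[symmetric] integral_complex_of_real)
  also have "(\<integral>y. p y \<partial>lborel) *\<^sub>R (\<integral>t. complex_of_real (q' t) * complex_of_real (\<psi> t) \<partial>lborel) =
      complex_of_real (pi * (\<integral>t. q' t * \<psi> t \<partial>lborel))"
    unfolding p_def integral_inverse_one_plus_square
    by (simp only: scaleR_conv_of_real of_real_mult[symmetric] integral_complex_of_real)
  finally have "(\<lambda>k. \<integral>s. (\<integral>y. p y * q' (s + sig k * y) \<partial>lborel) * \<psi> s \<partial>lborel) \<longlonglongrightarrow> pi * (\<integral>t. q' t * \<psi> t \<partial>lborel)"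
    unfolding tendsto_of_real_iff .
  moreover have "(\<integral>s. (\<integral>y. p y * q' (s + sig k * y) \<partial>lborel) * \<psi> s \<partial>lborel) \<le> 0" for k
  proof -
    have "0 \<le> (\<integral>s. - ((\<integral>y. p y * q' (s + sig k * y) \<partial>lborel) * \<psi> s) \<partial>lborel)"
      using J[OF sig_pos] p01(1)
      by (intro Bochner_Integration.integral_nonneg) (auto simp: \<psi>_def mult_le_0_iff less_imp_le)
    then show ?thesis by simp
  qed
  ultimately have "pi * (\<integral>t. q' t * \<psi> t \<partial>lborel) \<le> 0"
    by (intro LIMSEQ_le_const2) auto
  then have le0: "(\<integral>t. q' t * \<psi> t \<partial>lborel) \<le> 0"
    using pi_gt_zero by (auto simp: mult_le_0_iff)
  have nn: "0 \<le> q' t * \<psi> t" for t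
    using p01(1)[of t] by (cases "0 < q t") (simp_all add: q'_def \<psi>_def)
  have "integrable lborel (\<lambda>t. q' t * \<psi> t)"
  proof (rule Bochner_Integration.integrable_bound)
    show "integrable lborel (\<lambda>t. Q * p t)" using pi by (rule integrable_mult_right)
    show "AE t in lborel. norm (q' t * \<psi> t) \<le> norm (Q * p t)"
      using bd
    proof eventually_elim
      case (elim t)
      have "q' t * \<psi> t \<le> \<bar>q t\<bar> * (p t * p t)"
        using p01(1)[of t] by (cases "0 < q t") (simp_all add: q'_def \<psi>_def mult_nonpos_nonneg)
      also have "\<dots> \<le> Q * p t"
        using elim p2[of t] p01(1)[of t] by (intro mult_mono) auto
      finally show ?case using nn[of t] by simp
    qed
  qed measurable
  moreover have "(\<integral>t. q' t * \<psi> t \<partial>lborel) = 0"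
    using le0 Bochner_Integration.integral_nonneg[of lborel "\<lambda>t. q' t * \<psi> t", OF nn] by (rule antisym)
  ultimately have "AE t in lborel. q' t * \<psi> t = 0"
    using nn by (subst (asm) integral_nonneg_eq_0_iff_AE) auto
  then show ?thesis
  proof eventually_elim
    case (elim t)
    show ?case
    proof (rule ccontr)
      assume "\<not> q t \<le> 0"
      then have "0 < q' t * \<psi> t" using p01(1)[of t] by (simp add: q'_def \<psi>_def)
      with elim show False by linarith
    qed
  qed
qed

text \<open>For fixed v, testing with \<open>test_function\<close> makes all Poisson means of |N
  v|^2 - C^2 |M v|^2 nonpositive, hence the function itself almost everywhere.\<close>

lemma boundary_le_from_norm:
  fixes M N :: "complex \<Rightarrow> complex^'m^'m::finite"
  assumes M: "M \<in> hardy_inf" and N: "N \<in> hardy_inf" and C: "0 \<le> C"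
    and le: "\<And>f. f \<in> hardy2 \<Longrightarrow> \<exists>u w. laplace u = (\<lambda>s. M s *v f s) \<and> laplace w = (\<lambda>s. N s *v f s) \<and> norm w \<le> C * norm u"
  shows "AE \<omega> in lborel. \<forall>v. norm (boundary_value N \<omega> *v v) \<le> C * norm (boundary_value M \<omega> *v v)"
proof -
  obtain BM where BM: "0 \<le> BM" "\<And>s. s \<in> rhp \<Longrightarrow> norm (M s) \<le> BM" "AE \<omega> in lborel. norm (bdry M \<omega>) \<le> BM"
    using bdry_bound[OF M] by blast
  obtain BN where BN: "0 \<le> BN" "\<And>s. s \<in> rhp \<Longrightarrow> norm (N s) \<le> BN" "AE \<omega> in lborel. norm (bdry N \<omega>) \<le> BN"
    using bdry_bound[OF N] by blast
  have fixed: "AE \<omega> in lborel. norm (bdry N \<omega> *v v) \<le> C * norm (bdry M \<omega> *v v)" for v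
  proof -
    define q where "q \<omega> = (norm (bdry N \<omega> *v v))\<^sup>2 - C\<^sup>2 * (norm (bdry M \<omega> *v v))\<^sup>2" for \<omega>
    have [measurable]: "(\<lambda>\<omega>. bdry M \<omega> *v v) \<in> borel_measurable borel" "(\<lambda>\<omega>. bdry N \<omega> *v v) \<in> borel_measurable borel"
      by (intro borel_measurable_matrix_vector_mult bdry_measurable M N)+
    have "AE \<omega> in lborel. q \<omega> \<le> 0"
    proof (rule AE_nonpos_if_Poisson_nonpos)
      show "q \<in> borel_measurable borel" unfolding q_def by measurable
      show "AE \<omega> in lborel. \<bar>q \<omega>\<bar> \<le> (BN * norm v)\<^sup>2 + C\<^sup>2 * (BM * norm v)\<^sup>2"
        using BM(3) BN(3)
      proof eventually_elim
        case (elim \<omega>)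
        have "(norm (bdry N \<omega> *v v))\<^sup>2 \<le> (BN * norm v)\<^sup>2"
          using elim by (intro power_mono order_trans[OF norm_matrix_vector_mult_le] mult_right_mono) auto
        moreover have "(norm (bdry M \<omega> *v v))\<^sup>2 \<le> (BM * norm v)\<^sup>2"
          using elim by (intro power_mono order_trans[OF norm_matrix_vector_mult_le] mult_right_mono) auto
        then have "C\<^sup>2 * (norm (bdry M \<omega> *v v))\<^sup>2 \<le> C\<^sup>2 * (BM * norm v)\<^sup>2"
          by (rule mult_left_mono) simp
        moreover have "0 \<le> (norm (bdry N \<omega> *v v))\<^sup>2" "0 \<le> C\<^sup>2 * (norm (bdry M \<omega> *v v))\<^sup>2" by simp_all
        ultimately show ?case unfolding q_def abs_le_iff by linarith
      qed
      fix \<epsilon> \<omega>\<^sub>0 :: real assume \<epsilon>: "0 < \<epsilon>"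
      obtain u w where uw: "laplace u = (\<lambda>s. M s *v test_function \<epsilon> \<omega>\<^sub>0 v s)"
        "laplace w = (\<lambda>s. N s *v test_function \<epsilon> \<omega>\<^sub>0 v s)" "norm w \<le> C * norm u"
        using le[OF test_function_hardy2[OF \<epsilon>]] by blast
      note tM = test_function_norm[OF M \<epsilon> uw(1)] and tN = test_function_norm[OF N \<epsilon> uw(2)]
      have "(\<integral>\<omega>. test_weight 0 \<epsilon> \<omega>\<^sub>0 \<omega> * q \<omega> \<partial>lborel) =
          (\<integral>\<omega>. test_weight 0 \<epsilon> \<omega>\<^sub>0 \<omega> * (norm (bdry N \<omega> *v v))\<^sup>2 - C\<^sup>2 * (test_weight 0 \<epsilon> \<omega>\<^sub>0 \<omega> * (norm (bdry M \<omega> *v v))\<^sup>2) \<partial>lborel)"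
        by (simp only: q_def right_diff_distrib mult.left_commute)
      also have "\<dots> = 2 * pi * (norm w)\<^sup>2 - C\<^sup>2 * (2 * pi * (norm u)\<^sup>2)"
        unfolding tM(2) tN(2) using tM(1) tN(1)
        by (subst Bochner_Integration.integral_diff) auto
      also have "(norm w)\<^sup>2 \<le> (C * norm u)\<^sup>2"
        using uw(3) by (rule power_mono) (rule norm_ge_zero)
      then have "2 * pi * (norm w)\<^sup>2 \<le> 2 * pi * (C * norm u)\<^sup>2"
        by (rule mult_left_mono) simp
      then have "2 * pi * (norm w)\<^sup>2 - C\<^sup>2 * (2 * pi * (norm u)\<^sup>2) \<le> 0"
        by (simp only: power_mult_distrib mult.left_commute diff_le_0_iff_le)
      finally show "(\<integral>\<omega>. test_weight 0 \<epsilon> \<omega>\<^sub>0 \<omega> * q \<omega> \<partial>lborel) \<le> 0" .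
    qed
    then show ?thesis
    proof eventually_elim
      case (elim \<omega>)
      then have "(norm (bdry N \<omega> *v v))\<^sup>2 \<le> (C * norm (bdry M \<omega> *v v))\<^sup>2"
        by (simp only: q_def power_mult_distrib diff_le_0_iff_le)
      then show ?case
        by (rule power2_le_imp_le[OF _ mult_nonneg_nonneg[OF C norm_ge_zero]])
    qed
  qed
  \<comment> \<open>The null set obtained so far depends on v. A countable dense set of vectors
    gives a common one, and continuity in v does the rest.\<close>
  obtain D :: "(complex^'m) set" where D: "countable D" "\<And>X. open X \<Longrightarrow> X \<noteq> {} \<Longrightarrow> \<exists>d\<in>D. d \<in> X"
    using countable_dense_setE by blast
  have "AE \<omega> in lborel. \<forall>v\<in>D. norm (bdry N \<omega> *v v) \<le> C * norm (bdry M \<omega> *v v)"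
    using D(1) fixed by (simp add: AE_ball_countable)
  then show ?thesis
    using bdry_AE[OF M] bdry_AE[OF N]
  proof eventually_elim
    case (elim \<omega>)
    let ?X = "{v. C * norm (bdry M \<omega> *v v) < norm (bdry N \<omega> *v v)}"
    have "continuous_on UNIV (\<lambda>v. A *v v)" for A :: "complex^'m^'m"
      unfolding matrix_vector_mult_def by (intro continuous_intros)
    then have "open ?X"
      by (intro open_Collect_less continuous_intros)
    then have "?X = {}"
      using D(2)[of ?X] elim(1) by (force simp: not_less)
    then show ?case using elim(2,3) by (auto simp: not_less set_eq_iff)
  qed
qed

text \<open>For the lower bound N takes the place of the denominator; the inequality itself shows
  that its boundary values are invertible.\<close>

lemma det_nonzero_if_norm_le:
  fixes A B :: "complex^'m^'m::finite"
  assumes A: "det A \<noteq> 0" and le: "\<And>v. norm (A *v v) \<le> C * norm (B *v v)"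
  shows "det B \<noteq> 0"
proof -
  have "\<forall>v. B *v v = 0 \<longrightarrow> v = 0"
  proof (intro allI impI)
    fix v assume "B *v v = 0"
    with le[of v] have "norm (A *v v) \<le> 0" by simp
    moreover obtain K where "K > 0" "norm v \<le> K * norm (A *v v)"
      using invertible_norm_bound[OF A] by blast
    ultimately show "v = 0" by simp
  qed
  then have "invertible B"
    unfolding invertible_left_inverse by (rule matrix_left_invertible_ker[THEN iffD2])
  then show ?thesis by (simp add: invertible_det_nz)
qed

lemma esssup_le_iff_AE:
  assumes "f \<in> borel_measurable M"
  shows "esssup M f \<le> z \<longleftrightarrow> (AE x in M. f x \<le> z)"
proof
  assume "esssup M f \<le> z"
  then show "AE x in M. f x \<le> z"
    using esssup_AE[of f M] by (auto elim: eventually_mono order_trans)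
next
  assume "AE x in M. f x \<le> z"
  then show "esssup M f \<le> z"
    unfolding esssup_eq_AE[OF assms] by (intro Inf_lower) simp
qed

theorem theorem3:
  fixes T :: "complex \<Rightarrow> complex^'m^'m::finite"
    and Tb :: "real \<Rightarrow> complex^'m^'m"
    and Tmax :: "'m L2 \<rightharpoonup> 'm L2"
  assumes "T \<in> F_inf"
    and "is_boundary_function T Tb"
    and "is_maximal_operator T Tmax"
  shows "op_sigma_max Tmax = esssup lebesgue (\<lambda>\<omega>. ennreal (sigma_max (Tb \<omega>))) \<and>
    op_sigma_min Tmax = essinf lebesgue (\<lambda>\<omega>. ennreal (sigma_min (Tb \<omega>)))"
proof -
  from assms(3) obtain M N where lin: "linear_operator Tmax" and rf: "right_fraction T M N"
    and graph: "laplace_graph Tmax = (\<lambda>f. (\<lambda>s. M s *v f s, \<lambda>s. N s *v f s)) ` hardy2"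
    by (auto simp: is_maximal_operator_def fraction_operators_def)
  from assms(2) obtain M' N' where rf': "right_fraction T M' N'"
    and Tb: "AE \<omega> in lebesgue. Tb \<omega> = boundary_value N' \<omega> ** matrix_inv (boundary_value M' \<omega>)"
    by (auto simp: is_boundary_function_def)
  from rf obtain s\<^sub>0 where M: "M \<in> hardy_inf" and N: "N \<in> hardy_inf" and s0: "s\<^sub>0 \<in> rhp" "det (M s\<^sub>0) \<noteq> 0"
    by (auto simp: right_fraction_def)
  let ?M = "boundary_value M" and ?N = "boundary_value N"
  have detM: "AE \<omega> in lborel. det (?M \<omega>) \<noteq> 0"
    by (rule boundary_det_nonzero[OF M s0])
  \<comment> \<open>\<open>Tb\<close> comes from a fraction M', N' of T, the graph of
    \<open>Tmax\<close> from another; both have the same boundary function.\<close>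
  have TbMN: "AE \<omega> in lborel. Tb \<omega> = ?N \<omega> ** matrix_inv (?M \<omega>)"
    using Tb[unfolded AE_completion_iff] right_fraction_boundary_eq[OF rf rf']
    by eventually_elim simp
  \<comment> \<open>Surjectivity of the boundary matrix of M lets a bound on
    \<open>Tb \<omega>\<close> over all x be read as a bound over all v with x = M v.\<close>
  have TbM: "AE \<omega> in lborel. det (?M \<omega>) \<noteq> 0 \<and> Tb \<omega> ** ?M \<omega> = ?N \<omega> \<and> (\<forall>x. \<exists>v. x = ?M \<omega> *v v)"
    using detM TbMN
  proof eventually_elim
    case (elim \<omega>)
    have inv: "matrix_inv (?M \<omega>) ** ?M \<omega> = mat 1" "?M \<omega> ** matrix_inv (?M \<omega>) = mat 1"
      using elim(1) someI_ex[of "\<lambda>B. ?M \<omega> ** B = mat 1 \<and> B ** ?M \<omega> = mat 1"]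
      unfolding matrix_inv_def invertible_det_nz[symmetric] invertible_def by blast+
    have "Tb \<omega> ** ?M \<omega> = ?N \<omega>"
      by (simp add: elim(2) inv matrix_mul_assoc[symmetric])
    moreover have "x = ?M \<omega> *v (matrix_inv (?M \<omega>) *v x)" for x
      by (simp add: matrix_vector_mul_assoc inv)
    ultimately show ?case using elim(1) by blast
  qed
  have graphD: "\<exists>f\<in>hardy2. laplace u = (\<lambda>s. M s *v f s) \<and> laplace y = (\<lambda>s. N s *v f s)" if "Tmax u = Some y" for u y
  proof -
    have "(laplace u, laplace y) \<in> laplace_graph Tmax"
      unfolding laplace_graph_def using that by (force simp: Map.graph_def)
    then show ?thesis unfolding graph by auto
  qed
  have graphI: "\<exists>u y. Tmax u = Some y \<and> laplace u = (\<lambda>s. M s *v f s) \<and> laplace y = (\<lambda>s. N s *v f s)" if "f \<in> hardy2" for f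
  proof -
    have "(\<lambda>s. M s *v f s, \<lambda>s. N s *v f s) \<in> laplace_graph Tmax"
      unfolding graph using that by blast
    then show ?thesis unfolding laplace_graph_def by (force simp: Map.graph_def)
  qed
  have T0: "Tmax 0 = Some 0" using lin by (simp add: linear_operator_def)
  have max_iff: "(\<forall>u y. Tmax u = Some y \<longrightarrow> norm y \<le> C * norm u) \<longleftrightarrow> (AE \<omega> in lborel. sigma_max (Tb \<omega>) \<le> C)"
    if C: "0 \<le> C" for C
  proof -
    have "(AE \<omega> in lborel. sigma_max (Tb \<omega>) \<le> C) \<longleftrightarrow>
        (AE \<omega> in lborel. \<forall>v. norm (?N \<omega> *v v) \<le> C * norm (?M \<omega> *v v))"
    proof (rule eventually_cong[OF TbM])
      fix \<omega> assume T: "det (?M \<omega>) \<noteq> 0 \<and> Tb \<omega> ** ?M \<omega> = ?N \<omega> \<and> (\<forall>x. \<exists>v. x = ?M \<omega> *v v)"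
      then have "?N \<omega> *v v = Tb \<omega> *v (?M \<omega> *v v)" for v by (simp add: matrix_vector_mul_assoc)
      then show "sigma_max (Tb \<omega>) \<le> C \<longleftrightarrow> (\<forall>v. norm (?N \<omega> *v v) \<le> C * norm (?M \<omega> *v v))"
        unfolding sigma_max_le_iff using T by metis
    qed
    also have "\<dots> \<longleftrightarrow> (\<forall>u y. Tmax u = Some y \<longrightarrow> norm y \<le> C * norm u)"
    proof
      assume b: "AE \<omega> in lborel. \<forall>v. norm (?N \<omega> *v v) \<le> C * norm (?M \<omega> *v v)"
      show "\<forall>u y. Tmax u = Some y \<longrightarrow> norm y \<le> C * norm u"
      proof (intro allI impI)
        fix u y assume "Tmax u = Some y"
        from graphD[OF this] obtain f where "laplace u = (\<lambda>s. M s *v f s)" "laplace y = (\<lambda>s. N s *v f s)"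
          by blast
        then show "norm y \<le> C * norm u" by (rule norm_le_from_boundary[OF M N C _ _ detM b])
      qed
    next
      assume *: "\<forall>u y. Tmax u = Some y \<longrightarrow> norm y \<le> C * norm u"
      show "AE \<omega> in lborel. \<forall>v. norm (?N \<omega> *v v) \<le> C * norm (?M \<omega> *v v)"
        using graphI * by (intro boundary_le_from_norm[OF M N C]) blast
    qed
    finally show ?thesis by (rule sym)
  qed
  \<comment> \<open>A lower bound with c > 0 is an upper bound with constant 1/c after exchanging M
    and N. The value c = 0 is trivial and is treated separately.\<close>
  have min_iff: "(\<forall>u y. Tmax u = Some y \<longrightarrow> c * norm u \<le> norm y) \<longleftrightarrow> (AE \<omega> in lborel. c \<le> sigma_min (Tb \<omega>))"
    if c: "0 < c" for c
  proof -
    have swap: "c * a \<le> b \<longleftrightarrow> a \<le> (1 / c) * b" for a b :: real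
      using c by (simp add: field_simps)
    have c': "0 \<le> 1 / c" using c by simp
    have "(AE \<omega> in lborel. c \<le> sigma_min (Tb \<omega>)) \<longleftrightarrow>
        (AE \<omega> in lborel. \<forall>v. norm (?M \<omega> *v v) \<le> (1 / c) * norm (?N \<omega> *v v))"
    proof (rule eventually_cong[OF TbM])
      fix \<omega> assume T: "det (?M \<omega>) \<noteq> 0 \<and> Tb \<omega> ** ?M \<omega> = ?N \<omega> \<and> (\<forall>x. \<exists>v. x = ?M \<omega> *v v)"
      then have "?N \<omega> *v v = Tb \<omega> *v (?M \<omega> *v v)" for v by (simp add: matrix_vector_mul_assoc)
      then show "c \<le> sigma_min (Tb \<omega>) \<longleftrightarrow> (\<forall>v. norm (?M \<omega> *v v) \<le> (1 / c) * norm (?N \<omega> *v v))"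
        unfolding le_sigma_min_iff swap using T by metis
    qed
    also have "\<dots> \<longleftrightarrow> (\<forall>u y. Tmax u = Some y \<longrightarrow> c * norm u \<le> norm y)"
    proof
      assume b: "AE \<omega> in lborel. \<forall>v. norm (?M \<omega> *v v) \<le> (1 / c) * norm (?N \<omega> *v v)"
      have detN: "AE \<omega> in lborel. det (?N \<omega>) \<noteq> 0"
        using detM b by eventually_elim (rule det_nonzero_if_norm_le[where C = "1 / c"], blast+)
      show "\<forall>u y. Tmax u = Some y \<longrightarrow> c * norm u \<le> norm y"
      proof (intro allI impI)
        fix u y assume "Tmax u = Some y"
        from graphD[OF this] obtain f where "laplace u = (\<lambda>s. M s *v f s)" "laplace y = (\<lambda>s. N s *v f s)"
          by blast
        then show "c * norm u \<le> norm y"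
          unfolding swap by (intro norm_le_from_boundary[OF N M c' _ _ detN b])
      qed
    next
      assume *: "\<forall>u y. Tmax u = Some y \<longrightarrow> c * norm u \<le> norm y"
      show "AE \<omega> in lborel. \<forall>v. norm (?M \<omega> *v v) \<le> (1 / c) * norm (?N \<omega> *v v)"
        using graphI * unfolding swap by (intro boundary_le_from_norm[OF N M c']) blast
    qed
    finally show ?thesis by (rule sym)
  qed
  have op_max_iff: "op_sigma_max Tmax \<le> ennreal C \<longleftrightarrow> (\<forall>u y. Tmax u = Some y \<longrightarrow> norm y \<le> C * norm u)"
    if C: "0 \<le> C" for C
  proof -
    have "op_sigma_max Tmax \<le> ennreal C \<longleftrightarrow> (\<forall>u\<in>dom Tmax - {0}. norm (the (Tmax u)) / norm u \<le> C)"
      unfolding op_sigma_max_def SUP_le_iff using C by (simp only: ennreal_le_iff)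
    also have "\<dots> \<longleftrightarrow> (\<forall>u y. Tmax u = Some y \<longrightarrow> norm y \<le> C * norm u)"
    proof
      assume *: "\<forall>u\<in>dom Tmax - {0}. norm (the (Tmax u)) / norm u \<le> C"
      show "\<forall>u y. Tmax u = Some y \<longrightarrow> norm y \<le> C * norm u"
      proof (intro allI impI)
        fix u y assume u: "Tmax u = Some y"
        show "norm y \<le> C * norm u"
        proof (cases "u = 0")
          case True
          then have "y = 0" using T0 u by simp
          then show ?thesis using True by (simp only: norm_zero mult_zero_right)
        next
          case False
          then have "norm y / norm u \<le> C" using bspec[OF *, of u] u by (simp add: domI)
          then show ?thesis using False by (simp only: divide_le_eq zero_less_norm_iff if_True simp_thms)
        qed
      qed
    next
      assume *: "\<forall>u y. Tmax u = Some y \<longrightarrow> norm y \<le> C * norm u"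
      show "\<forall>u\<in>dom Tmax - {0}. norm (the (Tmax u)) / norm u \<le> C"
      proof
        fix u assume "u \<in> dom Tmax - {0}"
        then obtain y where u: "Tmax u = Some y" "u \<noteq> 0" by blast
        then have "norm y \<le> C * norm u" using * by blast
        then show "norm (the (Tmax u)) / norm u \<le> C"
          using u by (simp only: option.sel divide_le_eq zero_less_norm_iff if_True simp_thms)
      qed
    qed
    finally show ?thesis .
  qed
  have op_min_iff: "ennreal c \<le> op_sigma_min Tmax \<longleftrightarrow> (\<forall>u y. Tmax u = Some y \<longrightarrow> c * norm u \<le> norm y)" for c
  proof -
    have "ennreal c \<le> op_sigma_min Tmax \<longleftrightarrow> (\<forall>u\<in>dom Tmax - {0}. c \<le> norm (the (Tmax u)) / norm u)"
      unfolding op_sigma_min_def le_INF_iff by (simp only: ennreal_le_iff divide_nonneg_nonneg norm_ge_zero)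
    also have "\<dots> \<longleftrightarrow> (\<forall>u y. Tmax u = Some y \<longrightarrow> c * norm u \<le> norm y)"
    proof
      assume *: "\<forall>u\<in>dom Tmax - {0}. c \<le> norm (the (Tmax u)) / norm u"
      show "\<forall>u y. Tmax u = Some y \<longrightarrow> c * norm u \<le> norm y"
      proof (intro allI impI)
        fix u y assume u: "Tmax u = Some y"
        show "c * norm u \<le> norm y"
        proof (cases "u = 0")
          case True
          then show ?thesis by (simp only: norm_zero mult_zero_right norm_ge_zero)
        next
          case False
          then have "c \<le> norm y / norm u" using bspec[OF *, of u] u by (simp add: domI)
          then show ?thesis using False by (simp only: le_divide_eq zero_less_norm_iff if_True simp_thms)
        qed
      qed
    next
      assume *: "\<forall>u y. Tmax u = Some y \<longrightarrow> c * norm u \<le> norm y"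
      show "\<forall>u\<in>dom Tmax - {0}. c \<le> norm (the (Tmax u)) / norm u"
      proof
        fix u assume "u \<in> dom Tmax - {0}"
        then obtain y where u: "Tmax u = Some y" "u \<noteq> 0" by blast
        then have "c * norm u \<le> norm y" using * by blast
        then show "c \<le> norm (the (Tmax u)) / norm u"
          using u by (simp only: option.sel le_divide_eq zero_less_norm_iff if_True simp_thms)
      qed
    qed
    finally show ?thesis .
  qed
  \<comment> \<open>\<open>esssup\<close> is \<open>top\<close> on nonmeasurable functions, so
    measurability must be shown. \<open>Tb\<close> is only prescribed almost everywhere and is
    compared with a Borel function built from \<open>bdry\<close> and
    \<open>cramer_inv\<close>.\<close>
  have meas: "(\<lambda>\<omega>. ennreal (sigma_max (Tb \<omega>))) \<in> borel_measurable lebesgue"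
  proof -
    have "(\<lambda>\<omega>. bdry N \<omega> ** cramer_inv (bdry M \<omega>)) \<in> borel_measurable borel"
      by (intro borel_measurable_matrix_mult borel_measurable_cramer_inv bdry_measurable M N)
    then have "(\<lambda>\<omega>. bdry N \<omega> ** cramer_inv (bdry M \<omega>)) \<in> borel_measurable lebesgue"
      by (intro measurable_completion) simp
    moreover have "AE \<omega> in lebesgue. bdry N \<omega> ** cramer_inv (bdry M \<omega>) = Tb \<omega>"
      unfolding AE_completion_iff using bdry_AE[OF M] bdry_AE[OF N] detM TbMN
      by eventually_elim (simp add: matrix_inv_eq_cramer_inv)
    ultimately have "Tb \<in> borel_measurable lebesgue"
      by (rule borel_measurable_AE)
    then have "(\<lambda>\<omega>. sigma_max (Tb \<omega>)) \<in> borel_measurable lebesgue"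
      by (rule borel_measurable_continuous_on[OF continuous_on_sigma_max])
    then show ?thesis by simp
  qed
  have "op_sigma_max Tmax = esssup lebesgue (\<lambda>\<omega>. ennreal (sigma_max (Tb \<omega>)))"
  proof -
    \<comment> \<open>Two extended values with the same upper bounds are equal; the bound
      \<open>top\<close> is trivial, so finite C suffice.\<close>
    have iff: "op_sigma_max Tmax \<le> z \<longleftrightarrow> esssup lebesgue (\<lambda>\<omega>. ennreal (sigma_max (Tb \<omega>))) \<le> z" for z
    proof (cases z)
      case (real C)
      then show ?thesis
        unfolding real esssup_le_iff_AE[OF meas] AE_completion_iff op_max_iff[OF real(1)] max_iff[OF real(1)]
        by (simp only: ennreal_le_iff)
    qed simp
    show ?thesis
      using iff[of "op_sigma_max Tmax"] iff[of "esssup lebesgue (\<lambda>\<omega>. ennreal (sigma_max (Tb \<omega>)))"]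
      by (intro antisym) auto
  qed
  moreover have "op_sigma_min Tmax = essinf lebesgue (\<lambda>\<omega>. ennreal (sigma_min (Tb \<omega>)))"
  proof (rule antisym)
    have iff: "ennreal c \<le> op_sigma_min Tmax \<longleftrightarrow> (AE \<omega> in lebesgue. ennreal c \<le> ennreal (sigma_min (Tb \<omega>)))"
      if "0 \<le> c" for c
    proof (cases "c = 0")
      case False
      then show ?thesis
        using that unfolding AE_completion_iff op_min_iff
        by (subst min_iff) (simp_all add: sigma_min_nonneg)
    qed simp
    \<comment> \<open>Only finite constants are covered by the equivalence. Everything strictly
      below a given value is finite, and density of the order then reaches the value itself, even if
      it is \<open>top\<close>.\<close>
    show "op_sigma_min Tmax \<le> essinf lebesgue (\<lambda>\<omega>. ennreal (sigma_min (Tb \<omega>)))"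
    proof (rule dense_le)
      fix z assume z: "z < op_sigma_min Tmax"
      then obtain c where "0 \<le> c" "z = ennreal c" by (cases z) auto
      then have "AE \<omega> in lebesgue. z \<le> ennreal (sigma_min (Tb \<omega>))"
        using iff[of c] z less_imp_le by blast
      then show "z \<le> essinf lebesgue (\<lambda>\<omega>. ennreal (sigma_min (Tb \<omega>)))"
        unfolding essinf_def by (intro Sup_upper) simp
    qed
    show "essinf lebesgue (\<lambda>\<omega>. ennreal (sigma_min (Tb \<omega>))) \<le> op_sigma_min Tmax"
      unfolding essinf_def
    proof (rule Sup_least, rule dense_le)
      fix y z assume z: "z \<in> {z. AE \<omega> in lebesgue. z \<le> ennreal (sigma_min (Tb \<omega>))}" and y: "y < z"
      then obtain c where c: "0 \<le> c" "y = ennreal c" by (cases y) auto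
      have "AE \<omega> in lebesgue. ennreal c \<le> ennreal (sigma_min (Tb \<omega>))"
        using z c(2) y by (auto elim!: eventually_mono)
      then show "y \<le> op_sigma_min Tmax"
        using iff[OF c(1)] c(2) by simp
    qed
  qed
  ultimately show ?thesis ..
qed

end
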